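(* Let $X, Y$ be complex Banach spaces with $\dim X>1$, and let $\mathcal A \subset B(X)$, $\mathcal B \subset B(Y)$ be standard operator algebras. Suppose that $\phi:\mathcal A \to \mathcal B$ is a bijective transformation (not assumed to be additive or linear) satisfying $$\phi\big(\tfrac12(AB+BA)\big)=\tfrac12\big(\phi(A)\phi(B)+\phi(B)\phi(A)\big)$$ for every $A,B \in \mathcal A$. If $X$ is infinite dimensional, then at least one of the following holds: (i) there exists an invertible bounded linear operator $T: X\to Y$ such that $\phi(A)=TAT^{-1}$ for all $A\in \mathcal A$; (ii) there exists an invertible bounded conjugate-linear operator $T: X\to Y$ such that $\phi(A)=TAT^{-1}$ for all $A\in \mathcal A$; (iii) there exists an invertible bounded linear operator $T: X'\to Y$ such that $\phi(A)=TA'T^{-1}$ for all $A\in \mathcal A$; (iv) there exists an invertible bounded conjugate-linear operator $T: X'\to Y$ such that $\phi(A)=TA'T^{-1}$ for all $A\in \mathcal A$. If $X$ is finite dimensional, then $\dim X=\dim Y$; and, writing $n=\dim X$ and identifying both $\mathcal A=B(X)$ and $\mathcal B=B(Y)$ with the matrix algebra $M_n(\mathbb C)$ (via bases of $X$ and $Y$), so that $\phi$ is regarded as a map $M_n(\mathbb C)\to M_n(\mathbb C)$, at least one of the following holds: (v) there exist a ring automorphism $h$ of $\mathbb C$ and an invertible matrix $T\in M_n(\mathbb C)$ such that $\phi(A)=Th(A)T^{-1}$ for all $A\in M_n(\mathbb C)$; (vi) there exist a ring automorphism $h$ of $\mathbb C$ and an invertible matrix $T\in M_n(\mathbb C)$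 such that $\phi(A)=Th(A)^tT^{-1}$ for all $A\in M_n(\mathbb C)$.
   Context: All linear spaces are over the complex field. For a Banach space $X$, $B(X)$ is the algebra of all bounded linear operators on $X$ and $F(X)$ is the ideal of all bounded linear finite rank operators on $X$. A standard operator algebra on $X$ is a subalgebra of $B(X)$ that contains $F(X)$ (it need not contain the identity and need not be closed in any topology). $X'$ denotes the dual space of $X$, and $A'\in B(X')$ denotes the Banach space adjoint of $A\in B(X)$. For a matrix $A\in M_n(\mathbb C)$, ${}^t$ denotes the transpose and $h(A)$ denotes the matrix obtained from $A$ by applying $h$ to every entry. Ring automorphisms of $\mathbb C$ are not assumed continuous. *)

theory Defs
  imports
    "HOL-Analysis.Bounded_Linear_Function"
    "Jordan_Normal_Form.Matrix"
begin

class complex_normed_vector = real_normed_vector +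
  fixes scaleC :: "complex \<Rightarrow> 'a \<Rightarrow> 'a"  (infixr "*\<^sub>C" 75)
  assumes scaleC_add_right: "a *\<^sub>C (x + y) = a *\<^sub>C x + a *\<^sub>C y"
    and scaleC_add_left: "(a + b) *\<^sub>C x = a *\<^sub>C x + b *\<^sub>C x"
    and scaleC_scaleC: "a *\<^sub>C (b *\<^sub>C x) = (a * b) *\<^sub>C x"
    and scaleC_of_real: "complex_of_real r *\<^sub>C x = r *\<^sub>R x"
    and norm_scaleC: "norm (a *\<^sub>C x) = cmod a * norm x"

class complex_banach = complex_normed_vector + banach

lemma scaleC_one [simp]: "1 *\<^sub>C (x :: 'a::complex_normed_vector) = x"
  using scaleC_of_real[of 1 x] by simp

global_interpretation complex_vector:
  vector_space "scaleC :: complex \<Rightarrow> 'a \<Rightarrow> 'a::complex_normed_vector"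
  by unfold_locales (simp_all add: scaleC_add_right scaleC_add_left scaleC_scaleC)

lemma scaleC_scaleR_commute:
  "c *\<^sub>C (r *\<^sub>R x) = r *\<^sub>R (c *\<^sub>C (x :: 'a::complex_normed_vector))"
  by (simp add: scaleC_of_real[symmetric] scaleC_scaleC mult.commute)

lemma bounded_linear_scaleC_right:
  "bounded_linear (\<lambda>x :: 'a::complex_normed_vector. c *\<^sub>C x)"
  by (rule bounded_linear_intro[where K = "cmod c"])
    (simp_all add: scaleC_add_right scaleC_scaleR_commute norm_scaleC mult.commute)

instantiation complex :: complex_banach
begin

definition scaleC_complex :: "complex \<Rightarrow> complex \<Rightarrow> complex"
  where "scaleC_complex a z = a * z"

instance
  by standard (simp_all add: scaleC_complex_def distrib_left distrib_right mult.assoc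
      scaleR_conv_of_real norm_mult)

end

text \<open>For a linear subspace \<open>S\<close> this says that \<open>S\<close> has a finite basis.\<close>

definition finite_dimensional :: "'a::complex_normed_vector set \<Rightarrow> bool" where
  "finite_dimensional S \<longleftrightarrow> (\<exists>B. finite B \<and> S \<subseteq> complex_vector.span B)"

definition bounded_clinear ::
    "('a::complex_normed_vector \<Rightarrow> 'b::complex_normed_vector) \<Rightarrow> bool" where
  "bounded_clinear f \<longleftrightarrow> bounded_linear f \<and> (\<forall>c x. f (c *\<^sub>C x) = c *\<^sub>C f x)"

definition bounded_antilinear ::
    "('a::complex_normed_vector \<Rightarrow> 'b::complex_normed_vector) \<Rightarrow> bool" where
  "bounded_antilinear f \<longleftrightarrow> bounded_linear f \<and> (\<forall>c x. f (c *\<^sub>C x) = cnj c *\<^sub>C f x)"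

definition invertible_bounded_clinear ::
    "('a::complex_normed_vector \<Rightarrow> 'b::complex_normed_vector) \<Rightarrow> bool" where
  "invertible_bounded_clinear T \<longleftrightarrow> bounded_clinear T \<and> bij T \<and> bounded_clinear (inv_into UNIV T)"

definition invertible_bounded_antilinear ::
    "('a::complex_normed_vector \<Rightarrow> 'b::complex_normed_vector) \<Rightarrow> bool" where
  "invertible_bounded_antilinear T \<longleftrightarrow>
     bounded_antilinear T \<and> bij T \<and> bounded_antilinear (inv_into UNIV T)"

text \<open>
  The type of bounded complex-linear operators, with the operator norm inherited from
  the bounded real-linear ones.
\<close>

typedef (overloaded) ('a, 'b) cblinfun  (infixr "\<Rightarrow>\<^sub>C" 22) =
  "{f :: 'a::complex_normed_vector \<Rightarrow>\<^sub>L 'b::complex_normed_vector.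
      bounded_clinear (blinfun_apply f)}"
  morphisms blinfun_of_cblinfun Abs_cblinfun
  by (rule exI[where x = 0]) (simp add: bounded_clinear_def blinfun.bounded_linear_right)

setup_lifting type_definition_cblinfun

definition cblinfun_apply ::
    "('a::complex_normed_vector \<Rightarrow>\<^sub>C 'b::complex_normed_vector) \<Rightarrow> 'a \<Rightarrow> 'b"
  where "cblinfun_apply f = blinfun_apply (blinfun_of_cblinfun f)"

declare [[coercion cblinfun_apply]]

lift_definition cblinfun_compose ::
    "('b::complex_normed_vector \<Rightarrow>\<^sub>C 'c::complex_normed_vector) \<Rightarrow>
     ('a::complex_normed_vector \<Rightarrow>\<^sub>C 'b) \<Rightarrow> ('a \<Rightarrow>\<^sub>C 'c)"  (infixl "o\<^sub>C" 70)
  is blinfun_compose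
  by (auto simp: bounded_clinear_def blinfun.bounded_linear_right)

lemma cblinfun_eqI: "f = g" if "\<And>x. cblinfun_apply f x = cblinfun_apply g x"
  using that by (metis cblinfun_apply_def blinfun_eqI blinfun_of_cblinfun_inject)

lemma cblinfun_apply_compose: "cblinfun_apply (f o\<^sub>C g) = cblinfun_apply f \<circ> cblinfun_apply g"
  by (simp add: cblinfun_apply_def cblinfun_compose.rep_eq fun_eq_iff)

instantiation cblinfun :: (complex_normed_vector, complex_normed_vector) complex_normed_vector
begin

lift_definition zero_cblinfun :: "'a \<Rightarrow>\<^sub>C 'b" is 0
  by (simp add: bounded_clinear_def blinfun.bounded_linear_right)

lift_definition plus_cblinfun :: "('a \<Rightarrow>\<^sub>C 'b) \<Rightarrow> ('a \<Rightarrow>\<^sub>C 'b) \<Rightarrow> ('a \<Rightarrow>\<^sub>C 'b)" is "(+)"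
  by (simp add: bounded_clinear_def blinfun.add_left blinfun.bounded_linear_right
      scaleC_add_right)

lift_definition uminus_cblinfun :: "('a \<Rightarrow>\<^sub>C 'b) \<Rightarrow> ('a \<Rightarrow>\<^sub>C 'b)" is uminus
  by (simp add: bounded_clinear_def blinfun.minus_left blinfun.bounded_linear_right)

lift_definition minus_cblinfun :: "('a \<Rightarrow>\<^sub>C 'b) \<Rightarrow> ('a \<Rightarrow>\<^sub>C 'b) \<Rightarrow> ('a \<Rightarrow>\<^sub>C 'b)" is "(-)"
  by (simp add: bounded_clinear_def blinfun.diff_left blinfun.bounded_linear_right
      complex_vector.scale_right_diff_distrib)

lift_definition scaleR_cblinfun :: "real \<Rightarrow> ('a \<Rightarrow>\<^sub>C 'b) \<Rightarrow> ('a \<Rightarrow>\<^sub>C 'b)" is scaleR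
  by (simp add: bounded_clinear_def blinfun.scaleR_left blinfun.bounded_linear_right
      scaleC_scaleR_commute)

lift_definition scaleC_cblinfun :: "complex \<Rightarrow> ('a \<Rightarrow>\<^sub>C 'b) \<Rightarrow> ('a \<Rightarrow>\<^sub>C 'b)"
  is "\<lambda>c f. Blinfun (\<lambda>x. c *\<^sub>C blinfun_apply f x)"
  by (simp add: bounded_clinear_def blinfun.bounded_linear_right scaleC_scaleC mult.commute
      bounded_linear_Blinfun_apply bounded_linear_compose[OF bounded_linear_scaleC_right])

lift_definition norm_cblinfun :: "('a \<Rightarrow>\<^sub>C 'b) \<Rightarrow> real" is norm .

definition dist_cblinfun :: "('a \<Rightarrow>\<^sub>C 'b) \<Rightarrow> ('a \<Rightarrow>\<^sub>C 'b) \<Rightarrow> real"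
  where "dist_cblinfun f g = norm (f - g)"

definition sgn_cblinfun :: "('a \<Rightarrow>\<^sub>C 'b) \<Rightarrow> ('a \<Rightarrow>\<^sub>C 'b)"
  where "sgn_cblinfun f = inverse (norm f) *\<^sub>R f"

definition uniformity_cblinfun :: "(('a \<Rightarrow>\<^sub>C 'b) \<times> ('a \<Rightarrow>\<^sub>C 'b)) filter"
  where "uniformity_cblinfun = (INF e\<in>{0 <..}. principal {(f, g). dist f g < e})"

definition open_cblinfun :: "('a \<Rightarrow>\<^sub>C 'b) set \<Rightarrow> bool"
  where "open_cblinfun S \<longleftrightarrow> (\<forall>f\<in>S. \<forall>\<^sub>F (f', g) in uniformity. f' = f \<longrightarrow> g \<in> S)"

lemma blinfun_scaleC_apply:
  "blinfun_apply (Blinfun (\<lambda>x. c *\<^sub>C blinfun_apply f x)) x = c *\<^sub>C blinfun_apply f x"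
  for f :: "'a \<Rightarrow>\<^sub>L 'b"
  by (simp add: bounded_linear_Blinfun_apply blinfun.bounded_linear_right
      bounded_linear_compose[OF bounded_linear_scaleC_right])

lemma norm_blinfun_scaleC:
  "norm (Blinfun (\<lambda>x. c *\<^sub>C blinfun_apply f x)) = cmod c * norm f"
  for f :: "'a \<Rightarrow>\<^sub>L 'b"
proof -
  have le: "norm (Blinfun (\<lambda>x. c *\<^sub>C blinfun_apply f x)) \<le> cmod c * norm f"
    for c and f :: "'a \<Rightarrow>\<^sub>L 'b"
    by (rule norm_blinfun_bound)
      (simp_all add: blinfun_scaleC_apply norm_scaleC mult.assoc mult_left_mono norm_blinfun)
  show ?thesis
  proof (cases "c = 0")
    case True
    then show ?thesis
      using le[of 0 f] by simp
  next
    case False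
    define g where "g = Blinfun (\<lambda>x. c *\<^sub>C blinfun_apply f x)"
    have "f = Blinfun (\<lambda>x. inverse c *\<^sub>C blinfun_apply g x)"
      by (rule blinfun_eqI) (simp add: g_def blinfun_scaleC_apply scaleC_scaleC False blinfun_apply_inverse)
    with le[of "inverse c" g] have "norm f \<le> inverse (cmod c) * norm g"
      by (simp add: norm_inverse)
    with False have "cmod c * norm f \<le> norm g"
      by (simp add: field_simps)
    with le[of c f] show ?thesis
      by (simp add: g_def)
  qed
qed

instance
proof
  fix f g h :: "'a \<Rightarrow>\<^sub>C 'b" and r s :: real and a b :: complex and S :: "('a \<Rightarrow>\<^sub>C 'b) set"
  show "f + g + h = f + (g + h)" "f + g = g + f" "0 + f = f" "- f + f = 0" "f - g = f + - g"
    by (transfer, simp)+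
  show "r *\<^sub>R (f + g) = r *\<^sub>R f + r *\<^sub>R g" "(r + s) *\<^sub>R f = r *\<^sub>R f + s *\<^sub>R f"
    "r *\<^sub>R s *\<^sub>R f = (r * s) *\<^sub>R f" "1 *\<^sub>R f = f"
    by (transfer, simp add: scaleR_add_right scaleR_add_left)+
  show "norm f = 0 \<longleftrightarrow> f = 0" "norm (r *\<^sub>R f) = \<bar>r\<bar> * norm f"
    by (transfer, simp)+
  show "norm (f + g) \<le> norm f + norm g"
    by (transfer, rule norm_triangle_ineq)
  show "dist f g = norm (f - g)" "sgn f = inverse (norm f) *\<^sub>R f"
    by (simp_all add: dist_cblinfun_def sgn_cblinfun_def)
  show "(uniformity :: (('a \<Rightarrow>\<^sub>C 'b) \<times> ('a \<Rightarrow>\<^sub>C 'b)) filter) =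
      (INF e\<in>{0 <..}. principal {(f, g). dist f g < e})"
    by (rule uniformity_cblinfun_def)
  show "open S \<longleftrightarrow> (\<forall>f\<in>S. \<forall>\<^sub>F (f', g) in uniformity. f' = f \<longrightarrow> g \<in> S)"
    by (rule open_cblinfun_def)
  show "a *\<^sub>C (f + g) = a *\<^sub>C f + a *\<^sub>C g"
    by transfer (rule blinfun_eqI, subst blinfun_scaleC_apply,
        simp only: blinfun_scaleC_apply blinfun.add_left,
        rule scaleC_add_right)
  show "(a + b) *\<^sub>C f = a *\<^sub>C f + b *\<^sub>C f"
    by transfer (rule blinfun_eqI, subst blinfun_scaleC_apply,
        simp only: blinfun_scaleC_apply blinfun.add_left,
        rule scaleC_add_left)
  show "a *\<^sub>C (b *\<^sub>C f) = (a * b) *\<^sub>C f"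
    by transfer (simp only: blinfun_scaleC_apply scaleC_scaleC)
  show "complex_of_real r *\<^sub>C f = r *\<^sub>R f"
    by transfer (rule blinfun_eqI, subst blinfun_scaleC_apply,
        simp only: blinfun_scaleC_apply blinfun.scaleR_left,
        rule scaleC_of_real)
  show "norm (a *\<^sub>C f) = cmod a * norm f"
    by transfer (rule norm_blinfun_scaleC)
qed

end

lemma cblinfun_apply_add: "cblinfun_apply (f + g) x = cblinfun_apply f x + cblinfun_apply g x"
  by (simp add: cblinfun_apply_def plus_cblinfun.rep_eq blinfun.add_left)

lemma cblinfun_apply_scaleC: "cblinfun_apply (c *\<^sub>C f) x = c *\<^sub>C cblinfun_apply f x"
  by (simp add: cblinfun_apply_def scaleC_cblinfun.rep_eq blinfun_scaleC_apply)

instance cblinfun :: (complex_normed_vector, complex_banach) complex_banach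
proof
  fix X :: "nat \<Rightarrow> 'a \<Rightarrow>\<^sub>C 'b"
  assume X: "Cauchy X"
  have dist_eq: "dist f g = dist (blinfun_of_cblinfun f) (blinfun_of_cblinfun g)"
    for f g :: "'a \<Rightarrow>\<^sub>C 'b"
    by (simp add: dist_norm norm_cblinfun.rep_eq minus_cblinfun.rep_eq)
  from X have "Cauchy (\<lambda>n. blinfun_of_cblinfun (X n))"
    by (simp add: Cauchy_def dist_eq)
  then obtain L where L: "(\<lambda>n. blinfun_of_cblinfun (X n)) \<longlonglongrightarrow> L"
    using Cauchy_convergent convergent_def by blast
  have lim: "(\<lambda>n. blinfun_of_cblinfun (X n) x) \<longlonglongrightarrow> L x" for x
    by (intro blinfun.tendsto L tendsto_const)
  have "L (c *\<^sub>C x) = c *\<^sub>C L x" for c x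
  proof (rule LIMSEQ_unique[OF lim[of "c *\<^sub>C x"]])
    have "blinfun_of_cblinfun (X n) (c *\<^sub>C x) = c *\<^sub>C blinfun_of_cblinfun (X n) x" for n
      using blinfun_of_cblinfun[of "X n"] by (simp add: bounded_clinear_def)
    then show "(\<lambda>n. blinfun_of_cblinfun (X n) (c *\<^sub>C x)) \<longlonglongrightarrow> c *\<^sub>C L x"
      using bounded_linear.tendsto[OF bounded_linear_scaleC_right lim[of x]] by simp
  qed
  then have "blinfun_of_cblinfun (Abs_cblinfun L) = L"
    by (intro Abs_cblinfun_inverse) (simp add: bounded_clinear_def blinfun.bounded_linear_right)
  with L have "X \<longlonglongrightarrow> Abs_cblinfun L"
    by (simp add: tendsto_iff dist_eq)
  then show "convergent X"
    by (rule convergentI)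
qed

type_synonym 'a dual = "'a \<Rightarrow>\<^sub>C complex"

definition dual_adjoint ::
    "('a::complex_normed_vector \<Rightarrow>\<^sub>C 'b::complex_normed_vector) \<Rightarrow> ('b dual \<Rightarrow>\<^sub>C 'a dual)"
  where "dual_adjoint A = Abs_cblinfun (Blinfun (\<lambda>f. f o\<^sub>C A))"

lemma dual_adjoint_apply: "cblinfun_apply (dual_adjoint A) f = f o\<^sub>C A"
  for A :: "'a::complex_normed_vector \<Rightarrow>\<^sub>C 'b::complex_normed_vector"
proof -
  have "norm (f o\<^sub>C A) \<le> norm f * norm A" for f :: "'b dual"
    by transfer (rule norm_blinfun_compose)
  moreover have "(f + g) o\<^sub>C A = f o\<^sub>C A + g o\<^sub>C A" "(r *\<^sub>R f) o\<^sub>C A = r *\<^sub>R (f o\<^sub>C A)"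
    for f g :: "'b dual" and r
    by (transfer, auto intro!: blinfun_eqI simp: blinfun.add_left blinfun.scaleR_left)+
  ultimately have *: "bounded_linear (\<lambda>f :: 'b dual. f o\<^sub>C A)"
    by (intro bounded_linear_intro[where K = "norm A"])
  have "(c *\<^sub>C f) o\<^sub>C A = c *\<^sub>C (f o\<^sub>C A)" for f :: "'b dual" and c
    by (rule cblinfun_eqI) (simp add: cblinfun_apply_compose cblinfun_apply_scaleC)
  with * have "bounded_clinear (\<lambda>f :: 'b dual. f o\<^sub>C A)"
    by (simp add: bounded_clinear_def)
  with * show ?thesis
    by (simp add: dual_adjoint_def cblinfun_apply_def Abs_cblinfun_inverse bounded_linear_Blinfun_apply)
qed

definition finite_rank :: "('a::complex_normed_vector \<Rightarrow>\<^sub>C 'b::complex_normed_vector) \<Rightarrow> bool"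
  where "finite_rank A \<longleftrightarrow> finite_dimensional (range (cblinfun_apply A))"

definition standard_operator_algebra :: "('a::complex_normed_vector \<Rightarrow>\<^sub>C 'a) set \<Rightarrow> bool" where
  "standard_operator_algebra \<A> \<longleftrightarrow>
     complex_vector.subspace \<A> \<and> (\<forall>A\<in>\<A>. \<forall>B\<in>\<A>. A o\<^sub>C B \<in> \<A>) \<and> {A. finite_rank A} \<subseteq> \<A>"

definition is_ordered_basis :: "nat \<Rightarrow> (nat \<Rightarrow> 'a::complex_normed_vector) \<Rightarrow> bool" where
  "is_ordered_basis n e \<longleftrightarrow>
     inj_on e {..<n} \<and> complex_vector.independent (e ` {..<n}) \<and>
     complex_vector.span (e ` {..<n}) = UNIV"

definition matrix_of ::
    "nat \<Rightarrow> (nat \<Rightarrow> 'a::complex_normed_vector) \<Rightarrow> ('a \<Rightarrow>\<^sub>C 'a) \<Rightarrow> complex mat" where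
  "matrix_of n e A =
     mat n n (\<lambda>(i, j). complex_vector.representation (e ` {..<n}) (A (e j)) (e i))"

text \<open>
  The map on matrices that corresponds to \<open>\<phi>\<close> when operators are identified with matrices
  via the bases \<open>e\<close> and \<open>f\<close>. If \<open>e\<close> is an ordered basis of length \<open>n\<close>, then
  \<^term>\<open>matrix_of n e\<close> is a bijection from all bounded operators onto the \<open>n \<times> n\<close>
  matrices, since linear maps between finite-dimensional spaces are bounded.
\<close>

definition matrix_map ::
    "nat \<Rightarrow> (nat \<Rightarrow> 'a::complex_normed_vector) \<Rightarrow> (nat \<Rightarrow> 'b::complex_normed_vector) \<Rightarrow>
     (('a \<Rightarrow>\<^sub>C 'a) \<Rightarrow> ('b \<Rightarrow>\<^sub>C 'b)) \<Rightarrow> complex mat \<Rightarrow> complex mat" where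
  "matrix_map n e f \<phi> M = matrix_of n f (\<phi> (the_inv (matrix_of n e) M))"

definition ring_automorphism :: "(complex \<Rightarrow> complex) \<Rightarrow> bool" where
  "ring_automorphism h \<longleftrightarrow> bij h \<and> comm_ring_hom h"

end

theory Submission
  imports Defs "HOL-Analysis.Urysohn"
begin

text \<open>
  Write \<open>a \<circ>\<^sub>J b = (a b + b a) / 2\<close>. The proof first shows that the bijection is additive, then that
  it is multiplicative or antimultiplicative, and finally that such a map is implemented by a
  semilinear bijection of the underlying spaces.

  \<^emph>\<open>Additivity.\<close> By surjectivity some \<open>c\<close> satisfies \<open>\<phi> c = \<phi> a + \<phi> b\<close>, and then
  \<open>\<phi> (c \<circ>\<^sub>J x) = \<phi> (a \<circ>\<^sub>J x) + \<phi> (b \<circ>\<^sub>J x)\<close> for all \<open>x\<close>. If \<open>a \<circ>\<^sub>J x = 0\<close>, injectivity yields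
  \<open>c \<circ>\<^sub>J x = b \<circ>\<^sub>J x\<close>. In the Peirce decomposition with respect to a rank-one idempotent there are enough
  such \<open>x\<close> to determine \<open>c\<close> when \<open>a\<close> and \<open>b\<close> lie in suitable corners, and known cases of additivity
  provide more tests for the next case (\<open>additive_defect\<close>, \<open>additive\<close>). The cancellation rules
  behind this come from primeness of the domain, which holds because rank-one operators connect any
  two vectors, and from dimension at least two, which keeps the idempotent from being a unit.

  \<^emph>\<open>Multiplicativity.\<close> An additive Jordan isomorphism preserves \<open>x y x\<close> and its linearisation. Comparing
  two ways of writing one and the same element yields, for \<open>u = \<phi> (x y) - \<phi> x \<phi> y\<close> and
  \<open>v = \<phi> (x y) - \<phi> y \<phi> x\<close>, that \<open>u w v + v w u = 0\<close> for all \<open>w\<close>; since the target is prime, \<open>u = 0\<close> or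
  \<open>v = 0\<close>. As a group is not the union of two proper subgroups, the choice does not depend on \<open>x\<close> and
  \<open>y\<close> (\<open>mult_or_antimult_global\<close>).

  \<^emph>\<open>Implementation.\<close> If \<open>\<phi>\<close> is multiplicative, the left ideal of operators \<open>rank_one z w0\<close> with fixed \<open>w0\<close>
  is a copy of the space itself, and \<open>T z = \<phi> (rank_one z w0) y0\<close> satisfies \<open>\<phi> A T = T A\<close>. This \<open>T\<close> is an
  additive bijection with \<open>T (c z) = h c T z\<close> for an automorphism \<open>h\<close> of the complex field
  (\<open>semilinear_intertwiner\<close>). If \<open>\<phi>\<close> is antimultiplicative, the same construction is applied to the
  ring isomorphism that sends the adjoint of \<open>A\<close> to \<open>\<phi> A\<close>.

  In infinite dimensions a gliding hump along a biorthogonal sequence shows that \<open>h\<close> is bounded near \<open>0\<close>,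
  hence is the identity or the conjugation; the closed graph theorem then makes \<open>T\<close> and its inverse
  bounded (\<open>bounded_intertwiner\<close>). In finite dimensions \<open>T\<close> maps a basis to a basis, and in these bases
  \<open>\<phi>\<close> applies \<open>h\<close> to the entries of the matrix, with a transposition in the dual case; passing to
  given bases conjugates the matrices (\<open>matrix_map_form\<close>).
\<close>

section \<open>Jordan products and prime algebras\<close>

definition jordan_product :: "'r::real_algebra \<Rightarrow> 'r \<Rightarrow> 'r"  (infixl "\<circ>\<^sub>J" 70) where
  "a \<circ>\<^sub>J b = (1/2) *\<^sub>R (a * b + b * a)"

lemma jordan_product_zero [simp]: "a \<circ>\<^sub>J 0 = 0" "0 \<circ>\<^sub>J a = 0"
  by (simp_all add: jordan_product_def)

lemma jordan_product_add_left: "(a + b) \<circ>\<^sub>J c = a \<circ>\<^sub>J c + b \<circ>\<^sub>J c"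
  by (simp add: jordan_product_def algebra_simps)

lemma jordan_product_add_right: "c \<circ>\<^sub>J (a + b) = c \<circ>\<^sub>J a + c \<circ>\<^sub>J b"
  by (simp add: jordan_product_def algebra_simps)

lemma jordan_product_diff_left: "(a - b) \<circ>\<^sub>J c = a \<circ>\<^sub>J c - b \<circ>\<^sub>J c"
  by (simp add: jordan_product_def algebra_simps)

lemma jordan_product_eq_0_iff: "a \<circ>\<^sub>J b = 0 \<longleftrightarrow> a * b + b * a = 0"
  by (simp add: jordan_product_def)

lemma vector_double_eq_0_iff: "x + x = 0 \<longleftrightarrow> (x :: 'r::real_vector) = 0"
proof -
  have "x + x = 2 *\<^sub>R x" by (simp add: scaleR_2)
  then show ?thesis by simp
qed

text \<open>
  Algebras are subsets of a ring type, because an algebra of operators need not be the whole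
  operator ring and need not contain a unit.
\<close>

locale prime_subalgebra =
  fixes R :: "'r::real_algebra set"
  assumes subspace: "subspace R"
    and mult_closed: "\<And>x y. x \<in> R \<Longrightarrow> y \<in> R \<Longrightarrow> x * y \<in> R"
    and prime: "\<And>x y. x \<in> R \<Longrightarrow> y \<in> R \<Longrightarrow> (\<And>r. r \<in> R \<Longrightarrow> x * r * y = 0) \<Longrightarrow> x = 0 \<or> y = 0"
begin

lemma closed [intro, simp]:
  "0 \<in> R" "x \<in> R \<Longrightarrow> y \<in> R \<Longrightarrow> x + y \<in> R" "x \<in> R \<Longrightarrow> y \<in> R \<Longrightarrow> x - y \<in> R"
  "x \<in> R \<Longrightarrow> t *\<^sub>R x \<in> R" "x \<in> R \<Longrightarrow> y \<in> R \<Longrightarrow> x * y \<in> R"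
  "x \<in> R \<Longrightarrow> y \<in> R \<Longrightarrow> x \<circ>\<^sub>J y \<in> R"
  using subspace mult_closed
  by (auto simp: subspace_def jordan_product_def subspace_diff[OF subspace])

end

section \<open>Peirce decomposition\<close>

text \<open>
  The two last assumptions replace the condition that \<open>1 - e\<close> is not zero, which makes no sense
  without a unit.
\<close>

locale peirce_algebra = prime_subalgebra R for R :: "'r::real_algebra set" +
  fixes e :: 'r
  assumes e_in [intro, simp]: "e \<in> R"
    and idem: "e * e = e" and e_nonzero: "e \<noteq> 0"
    and not_left_unit: "\<exists>s\<in>R. e * s \<noteq> s" and not_right_unit: "\<exists>s\<in>R. s * e \<noteq> s"
begin

text \<open>
  \<open>Peirce i j\<close> is the corner \<open>p R q\<close> with \<open>p\<close> equal to \<open>e\<close> or to the formal \<open>1 - e\<close>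
  according to \<open>i\<close>, and \<open>q\<close> likewise according to \<open>j\<close>. Indexing by truth values lets one
  multiplication rule cover all sixteen pairs of corners.
\<close>

definition Peirce :: "bool \<Rightarrow> bool \<Rightarrow> 'r set" where
  "Peirce i j = {x \<in> R. e * x = (if i then x else 0) \<and> x * e = (if j then x else 0)}"

abbreviation "R11 \<equiv> Peirce True True"
abbreviation "R12 \<equiv> Peirce True False"
abbreviation "R21 \<equiv> Peirce False True"
abbreviation "R22 \<equiv> Peirce False False"

lemma Peirce_in: "x \<in> Peirce i j \<Longrightarrow> x \<in> R"
  by (simp add: Peirce_def)

lemma Peirce_zero: "0 \<in> Peirce i j"
  and Peirce_add: "x \<in> Peirce i j \<Longrightarrow> y \<in> Peirce i j \<Longrightarrow> x + y \<in> Peirce i j"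
  and Peirce_scaleR: "x \<in> Peirce i j \<Longrightarrow> t *\<^sub>R x \<in> Peirce i j"
  by (auto simp: Peirce_def distrib_left distrib_right)

lemma Peirce_mult: "x \<in> Peirce i j \<Longrightarrow> y \<in> Peirce j k \<Longrightarrow> x * y \<in> Peirce i k"
proof -
  assume "x \<in> Peirce i j" "y \<in> Peirce j k"
  then have "x \<in> R" "y \<in> R" "e * x = (if i then x else 0)" "y * e = (if k then y else 0)"
    by (simp_all add: Peirce_def)
  moreover have "e * (x * y) = (e * x) * y" "(x * y) * e = x * (y * e)"
    by (simp_all add: mult.assoc)
  ultimately show "x * y \<in> Peirce i k"
    by (auto simp: Peirce_def)
qed

lemma Peirce_mult_zero:
  assumes "x \<in> Peirce i j" "y \<in> Peirce k l" "j \<noteq> k"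
  shows "x * y = 0"
proof (cases j)
  case True
  then have "x * e = x" "e * y = 0" using assms by (auto simp: Peirce_def)
  then show ?thesis by (metis mult.assoc mult_zero_right)
next
  case False
  then have "x * e = 0" "e * y = y" using assms by (auto simp: Peirce_def)
  then show ?thesis by (metis mult.assoc mult_zero_left)
qed

lemma e_Peirce: "e \<in> R11"
  by (simp add: Peirce_def idem)

lemma Peirce_components:
  assumes "r \<in> R"
  shows "e * r * e \<in> R11" "e * r - e * r * e \<in> R12" "r * e - e * r * e \<in> R21"
    "r - e * r - r * e + e * r * e \<in> R22"
proof -
  have idem': "e * (e * x) = e * x" for x
    by (simp add: mult.assoc[symmetric] idem)
  show "e * r * e \<in> R11" "e * r - e * r * e \<in> R12" "r * e - e * r * e \<in> R21"
    "r - e * r - r * e + e * r * e \<in> R22"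
    using assms by (simp_all add: Peirce_def algebra_simps idem idem')
qed

lemma Peirce_decompose:
  assumes "r \<in> R"
  obtains a b c d where "a \<in> R11" "b \<in> R12" "c \<in> R21" "d \<in> R22" "r = a + b + c + d"
proof
  show "r = e * r * e + (e * r - e * r * e) + (r * e - e * r * e)
      + (r - e * r - r * e + e * r * e)"
    by simp
qed (use Peirce_components[OF assms] in auto)

lemma Peirce_sum_zero:
  assumes "a \<in> R11" "b \<in> R12" "c \<in> R21" "d \<in> R22" and z: "a + b + c + d = 0"
  shows "a = 0" "b = 0" "c = 0" "d = 0"
proof -
  have rules: "e * a = a" "a * e = a" "e * b = b" "b * e = 0" "e * c = 0" "c * e = c"
    "e * d = 0" "d * e = 0"
    using assms by (auto simp: Peirce_def)
  have "e * (a + b + c + d) = a + b" "(a + b + c + d) * e = a + c"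
    by (simp_all add: distrib_left distrib_right rules)
  then have 1: "a + b = 0" "a + c = 0" using z by simp_all
  have "(a + b) * e = a" by (simp add: distrib_right rules)
  then show a: "a = 0" using 1 by simp
  show "b = 0" "c = 0" using 1 a by auto
  then show "d = 0" using z a by simp
qed

text \<open>
  The hypothesis says that \<open>x R (1 - e) = 0\<close>. In a prime algebra this kills \<open>x\<close>, because some
  \<open>s - e s\<close> is not zero: for it, \<open>x r (s - e s) = 0\<close> for all \<open>r\<close>. This and the mirror image
  below yield several of the cancellation rules for corners that follow.
\<close>

lemma zero_if_mult_eq_mult_e:
  assumes "x \<in> R" "\<And>r. r \<in> R \<Longrightarrow> x * r = x * r * e"
  shows "x = 0"
proof -
  obtain s where s: "s \<in> R" "e * s \<noteq> s" using not_left_unit by auto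
  have "x * r * (s - e * s) = 0" if "r \<in> R" for r
    by (simp add: right_diff_distrib mult.assoc[symmetric] assms(2)[OF that, symmetric])
  with prime[OF assms(1), of "s - e * s"] s show ?thesis by auto
qed

lemma zero_if_mult_eq_e_mult:
  assumes "x \<in> R" "\<And>r. r \<in> R \<Longrightarrow> r * x = e * r * x"
  shows "x = 0"
proof -
  obtain s where s: "s \<in> R" "s * e \<noteq> s" using not_right_unit by auto
  have "(s - s * e) * r * x = 0" if "r \<in> R" for r
    by (simp add: left_diff_distrib mult.assoc assms(2)[OF that, unfolded mult.assoc, symmetric])
  with prime[OF _ assms(1), of "s - s * e"] s show ?thesis by auto
qed

lemma zero_if_annihilates_R12:
  assumes "x \<in> Peirce i True" "\<And>y. y \<in> R12 \<Longrightarrow> x * y = 0"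
  shows "x = 0"
proof (rule zero_if_mult_eq_mult_e)
  show "x \<in> R" using assms(1) by (rule Peirce_in)
  fix r assume "r \<in> R"
  then have "x * (e * r - e * r * e) = 0" by (intro assms(2) Peirce_components)
  moreover have "x * e = x" using assms(1) by (simp add: Peirce_def)
  ultimately show "x * r = x * r * e"
    by (simp add: right_diff_distrib mult.assoc[symmetric])
qed

lemma zero_if_R12_annihilates:
  assumes "x \<in> Peirce False j" "\<And>y. y \<in> R12 \<Longrightarrow> y * x = 0"
  shows "x = 0"
proof -
  have ex: "e * x = 0" and x: "x \<in> R" using assms(1) by (auto simp: Peirce_def)
  have "e * r * x = 0" if "r \<in> R" for r
  proof -
    have "(e * r - e * r * e) * x = 0" using that by (intro assms(2) Peirce_components)
    then show ?thesis by (simp add: left_diff_distrib mult.assoc ex)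
  qed
  then show ?thesis using prime[OF e_in x] e_nonzero by auto
qed

lemma zero_if_annihilates_R21:
  assumes "x \<in> Peirce i False" "\<And>y. y \<in> R21 \<Longrightarrow> x * y = 0"
  shows "x = 0"
proof -
  have ex: "x * e = 0" and x: "x \<in> R" using assms(1) by (auto simp: Peirce_def)
  have "x * r * e = 0" if "r \<in> R" for r
  proof -
    have "x * (r * e - e * r * e) = 0" using that by (intro assms(2) Peirce_components)
    then show ?thesis by (simp add: right_diff_distrib mult.assoc[symmetric] ex)
  qed
  then show ?thesis using prime[OF x e_in] e_nonzero by auto
qed

lemma zero_if_annihilates_R22:
  assumes "x \<in> Peirce i False" "\<And>y. y \<in> R22 \<Longrightarrow> x * y = 0"
  shows "x = 0"
proof (rule zero_if_mult_eq_mult_e)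
  have ex: "x * e = 0" using assms(1) by (auto simp: Peirce_def)
  show "x \<in> R" using assms(1) by (rule Peirce_in)
  fix r assume "r \<in> R"
  then have "x * (r - e * r - r * e + e * r * e) = 0" by (intro assms(2) Peirce_components)
  then show "x * r = x * r * e"
    by (simp add: right_diff_distrib distrib_left mult.assoc[symmetric] ex)
qed

lemma zero_if_R22_annihilates:
  assumes "x \<in> Peirce False j" "\<And>y. y \<in> R22 \<Longrightarrow> y * x = 0"
  shows "x = 0"
proof (rule zero_if_mult_eq_e_mult)
  have ex: "e * x = 0" using assms(1) by (auto simp: Peirce_def)
  show "x \<in> R" using assms(1) by (rule Peirce_in)
  fix r assume "r \<in> R"
  then have "(r - e * r - r * e + e * r * e) * x = 0" by (intro assms(2) Peirce_components)
  then show "r * x = e * r * x"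
    by (simp add: algebra_simps ex)
qed

text \<open>
  Testing \<open>x\<close> against itself gives \<open>x\<^sup>2 = 0\<close>; multiplying \<open>x y + y x = 0\<close> by \<open>x\<close> then leaves
  \<open>x y x = 0\<close>, and primeness applies.
\<close>

lemma zero_if_square_zero_Jordan_R22:
  assumes x: "x \<in> R22" and anti: "\<And>y. y \<in> R22 \<Longrightarrow> x * y + y * x = 0"
  shows "x = 0"
proof -
  have xx: "x * x = 0" using anti[OF x] by (simp add: vector_double_eq_0_iff)
  have ex: "e * x = 0" "x * e = 0" and xR: "x \<in> R" using x by (auto simp: Peirce_def)
  have "x * r * x = 0" if r: "r \<in> R" for r
  proof -
    let ?y = "r - e * r - r * e + e * r * e"
    have "x * (x * ?y + ?y * x) = 0" using anti[of ?y] Peirce_components[OF r] by simp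
    then have "x * ?y * x = 0" by (simp add: distrib_left mult.assoc[symmetric] xx)
    moreover have "x * ?y * x = x * r * x"
    proof -
      have "x * ?y = x * r - x * r * e"
        by (simp add: right_diff_distrib distrib_left mult.assoc[symmetric] ex)
      then show ?thesis by (simp add: left_diff_distrib mult.assoc ex)
    qed
    ultimately show ?thesis by simp
  qed
  then show ?thesis using prime[OF xR xR] by auto
qed

text \<open>
  The next four lemmas determine which corners of \<open>z\<close> are detected by Jordan multiplication
  with test elements from a given corner. They are read off by splitting the equation
  \<open>z x + x z = 0\<close> into its Peirce components.
\<close>

lemma Jordan_e_kernel:
  assumes "z \<in> R" "z \<circ>\<^sub>J e = 0"
  shows "z \<in> R22"
proof -
  obtain a b c d where z: "a \<in> R11" "b \<in> R12" "c \<in> R21" "d \<in> R22" "z = a + b + c + d"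
    using Peirce_decompose[OF assms(1)] .
  have rules: "e * a = a" "a * e = a" "e * b = b" "b * e = 0" "e * c = 0" "c * e = c"
    "e * d = 0" "d * e = 0"
    using z by (auto simp: Peirce_def)
  have "(a + a) + b + c + 0 = 0"
    using assms(2) by (simp add: jordan_product_eq_0_iff z(5) distrib_left distrib_right rules algebra_simps)
  from Peirce_sum_zero[OF _ _ _ _ this]
  have "a + a = 0" "b = 0" "c = 0" using z by (auto intro: Peirce_add Peirce_zero)
  then show ?thesis using z by (simp add: vector_double_eq_0_iff)
qed

lemma Jordan_R22_kernel:
  assumes "z \<in> R" and ann: "\<And>x. x \<in> R22 \<Longrightarrow> z \<circ>\<^sub>J x = 0"
  shows "z \<in> R11"
proof -
  obtain a b c d where z: "a \<in> R11" "b \<in> R12" "c \<in> R21" "d \<in> R22" "z = a + b + c + d"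
    using Peirce_decompose[OF assms(1)] .
  have *: "b * x = 0 \<and> x * c = 0 \<and> d * x + x * d = 0" if x: "x \<in> R22" for x
  proof -
    have "a * x = 0" "x * a = 0" "x * b = 0" "c * x = 0"
      using z x by (auto intro: Peirce_mult_zero)
    then have "0 + b * x + x * c + (d * x + x * d) = 0"
      using ann[OF x] by (simp add: jordan_product_eq_0_iff z(5) distrib_left distrib_right algebra_simps)
    from Peirce_sum_zero[OF _ _ _ _ this] show ?thesis
      using z x by (auto intro: Peirce_mult Peirce_zero Peirce_add)
  qed
  have "b = 0" using zero_if_annihilates_R22[OF z(2)] * by blast
  moreover have "c = 0" using zero_if_R22_annihilates[OF z(3)] * by blast
  moreover have "d = 0" using zero_if_square_zero_Jordan_R22[OF z(4)] * by blast
  ultimately show ?thesis using z by simp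
qed

lemma Jordan_R12_kernel:
  assumes "z \<in> R11 \<or> z \<in> R22" and ann: "\<And>x. x \<in> R12 \<Longrightarrow> z \<circ>\<^sub>J x = 0"
  shows "z = 0"
  using assms(1)
proof
  assume z: "z \<in> R11"
  show ?thesis
  proof (rule zero_if_annihilates_R12[OF z])
    fix y assume y: "y \<in> R12"
    show "z * y = 0"
      using ann[OF y] Peirce_mult_zero[OF y z] by (simp add: jordan_product_eq_0_iff)
  qed
next
  assume z: "z \<in> R22"
  show ?thesis
  proof (rule zero_if_R12_annihilates[OF z])
    fix y assume y: "y \<in> R12"
    show "y * z = 0"
      using ann[OF y] Peirce_mult_zero[OF z y] by (simp add: jordan_product_eq_0_iff)
  qed
qed

text \<open>
  Off-diagonal tests see the off-diagonal part of \<open>z\<close> completely, but not all of its diagonal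
  part: a scalar multiple of \<open>e - (1 - e)\<close> anticommutes with every off-diagonal element.
\<close>

lemma Jordan_off_diagonal_kernel:
  assumes "z \<in> R" and ann12: "\<And>x. x \<in> R12 \<Longrightarrow> z \<circ>\<^sub>J x = 0"
    and ann21: "\<And>x. x \<in> R21 \<Longrightarrow> z \<circ>\<^sub>J x = 0"
  obtains a d where "a \<in> R11" "d \<in> R22" "z = a + d"
proof -
  obtain a b c d where z: "a \<in> R11" "b \<in> R12" "c \<in> R21" "d \<in> R22" "z = a + b + c + d"
    using Peirce_decompose[OF assms(1)] .
  have "c = 0"
  proof (rule zero_if_R12_annihilates[OF z(3)])
    fix x assume x: "x \<in> R12"
    have "x * a = 0" "b * x = 0" "x * b = 0" "d * x = 0"
      using z x by (auto intro: Peirce_mult_zero)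
    then have "x * c + (a * x + x * d) + 0 + c * x = 0"
      using ann12[OF x] by (simp add: jordan_product_eq_0_iff z(5) distrib_left distrib_right algebra_simps)
    from Peirce_sum_zero(1)[OF _ _ _ _ this] show "x * c = 0"
      using z x by (auto intro: Peirce_mult Peirce_zero Peirce_add)
  qed
  moreover have "b = 0"
  proof (rule zero_if_annihilates_R21[OF z(2)])
    fix x assume x: "x \<in> R21"
    have "a * x = 0" "c * x = 0" "x * c = 0" "x * d = 0"
      using z x by (auto intro: Peirce_mult_zero)
    then have "b * x + 0 + (x * a + d * x) + x * b = 0"
      using ann21[OF x] by (simp add: jordan_product_eq_0_iff z(5) distrib_left distrib_right algebra_simps)
    from Peirce_sum_zero(1)[OF _ _ _ _ this] show "b * x = 0"
      using z x by (auto intro: Peirce_mult Peirce_zero Peirce_add)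
  qed
  ultimately show ?thesis using that z by simp
qed

end

section \<open>Additivity of Jordan multiplicative bijections\<close>

locale Jordan_multiplicative = peirce_algebra R e
  for R :: "'r::real_algebra set" and e +
  fixes S :: "'s::real_algebra set" and \<phi> :: "'r \<Rightarrow> 's"
  assumes bij: "bij_betw \<phi> R S"
    and S_add: "\<And>x y. x \<in> S \<Longrightarrow> y \<in> S \<Longrightarrow> x + y \<in> S" and S_zero: "0 \<in> S"
    and jordan: "\<And>a b. a \<in> R \<Longrightarrow> b \<in> R \<Longrightarrow> \<phi> (a \<circ>\<^sub>J b) = \<phi> a \<circ>\<^sub>J \<phi> b"
begin

definition additive_at :: "'r \<Rightarrow> 'r \<Rightarrow> bool" where
  "additive_at a b \<longleftrightarrow> \<phi> (a + b) = \<phi> a + \<phi> b"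

lemma phi_inj: "x \<in> R \<Longrightarrow> y \<in> R \<Longrightarrow> \<phi> x = \<phi> y \<Longrightarrow> x = y"
  using bij by (auto simp: bij_betw_def inj_on_def)

lemma phi_in: "x \<in> R \<Longrightarrow> \<phi> x \<in> S"
  using bij by (auto simp: bij_betw_def)

lemma phi_surj:
  assumes "s \<in> S" obtains r where "r \<in> R" "\<phi> r = s"
  using bij assms by (auto simp: bij_betw_def)

lemma phi_zero: "\<phi> 0 = 0"
proof -
  obtain a where "a \<in> R" "\<phi> a = 0" using phi_surj[OF S_zero] .
  then show ?thesis using jordan[of a 0] by simp
qed

lemma additive_at_zero [simp]: "additive_at 0 b" "additive_at a 0"
  by (simp_all add: additive_at_def phi_zero)

text \<open>
  By surjectivity some \<open>c\<close> is mapped to \<open>\<phi> a + \<phi> b\<close>, and \<open>z\<close> measures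
  how far \<open>c\<close> is from \<open>a + b\<close>. The Jordan product is additive in the target, hence
  \<open>\<phi> (c \<circ>\<^sub>J x) = \<phi> (a \<circ>\<^sub>J x) + \<phi> (b \<circ>\<^sub>J x)\<close> for every \<open>x\<close>. Whenever \<open>\<phi>\<close> is already known to be additive
  at \<open>a \<circ>\<^sub>J x\<close> and \<open>b \<circ>\<^sub>J x\<close>, injectivity turns this into \<open>z \<circ>\<^sub>J x = 0\<close>. So additivity spreads from
  products to factors as soon as there are enough test elements \<open>x\<close> to force \<open>z = 0\<close>.
\<close>

lemma additive_defect:
  assumes a: "a \<in> R" and b: "b \<in> R"
  obtains z where "z \<in> R" "\<phi> (a + b + z) = \<phi> a + \<phi> b"
    "\<And>x. x \<in> R \<Longrightarrow> \<phi> ((a + b + z) \<circ>\<^sub>J x) = \<phi> (a \<circ>\<^sub>J x) + \<phi> (b \<circ>\<^sub>J x)"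
    "\<And>x. x \<in> R \<Longrightarrow> additive_at (a \<circ>\<^sub>J x) (b \<circ>\<^sub>J x) \<Longrightarrow> z \<circ>\<^sub>J x = 0"
proof -
  obtain c where c: "c \<in> R" "\<phi> c = \<phi> a + \<phi> b"
    using phi_surj S_add phi_in a b by metis
  have 1: "\<phi> (c \<circ>\<^sub>J x) = \<phi> (a \<circ>\<^sub>J x) + \<phi> (b \<circ>\<^sub>J x)" if "x \<in> R" for x
    using that a b c by (simp add: jordan jordan_product_add_left)
  have "(c - (a + b)) \<circ>\<^sub>J x = 0" if x: "x \<in> R" and ad: "additive_at (a \<circ>\<^sub>J x) (b \<circ>\<^sub>J x)" for x
  proof -
    have "\<phi> (c \<circ>\<^sub>J x) = \<phi> ((a + b) \<circ>\<^sub>J x)"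
      using 1[OF x] ad by (simp add: additive_at_def jordan_product_add_left)
    then have "c \<circ>\<^sub>J x = (a + b) \<circ>\<^sub>J x"
      using phi_inj a b c x by simp
    then show ?thesis by (simp add: jordan_product_diff_left)
  qed
  then show thesis using 1 a b c by (intro that[of "c - (a + b)"]) auto
qed

lemma additive_atI:
  assumes a: "a \<in> R" and b: "b \<in> R"
    and *: "\<And>z. z \<in> R \<Longrightarrow>
      (\<And>x. x \<in> R \<Longrightarrow> additive_at (a \<circ>\<^sub>J x) (b \<circ>\<^sub>J x) \<Longrightarrow> z \<circ>\<^sub>J x = 0) \<Longrightarrow> z = 0"
  shows "additive_at a b"
proof -
  obtain z where z: "z \<in> R" "\<phi> (a + b + z) = \<phi> a + \<phi> b"
    "\<And>x. x \<in> R \<Longrightarrow> additive_at (a \<circ>\<^sub>J x) (b \<circ>\<^sub>J x) \<Longrightarrow> z \<circ>\<^sub>J x = 0"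
    using additive_defect[OF a b] by metis
  have "z = 0" using * z by blast
  then show ?thesis using z by (simp add: additive_at_def)
qed

lemma additive_at_R22_R12_tests:
  assumes "a \<in> R" "b \<in> R"
    and 22: "\<And>x. x \<in> R22 \<Longrightarrow> additive_at (a \<circ>\<^sub>J x) (b \<circ>\<^sub>J x)"
    and 12: "\<And>x. x \<in> R12 \<Longrightarrow> additive_at (a \<circ>\<^sub>J x) (b \<circ>\<^sub>J x)"
  shows "additive_at a b"
proof (rule additive_atI[OF assms(1,2)])
  fix z assume z: "z \<in> R"
    "\<And>x. x \<in> R \<Longrightarrow> additive_at (a \<circ>\<^sub>J x) (b \<circ>\<^sub>J x) \<Longrightarrow> z \<circ>\<^sub>J x = 0"
  have "z \<in> R11"
    by (rule Jordan_R22_kernel[OF z(1)], rule z(2)[OF Peirce_in 22])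
  then show "z = 0"
    using Jordan_R12_kernel[of z] z(2)[OF Peirce_in 12] by metis
qed

lemma additive_at_e_R12_tests:
  assumes "a \<in> R" "b \<in> R"
    and "additive_at (a \<circ>\<^sub>J e) (b \<circ>\<^sub>J e)"
    and 12: "\<And>x. x \<in> R12 \<Longrightarrow> additive_at (a \<circ>\<^sub>J x) (b \<circ>\<^sub>J x)"
  shows "additive_at a b"
proof (rule additive_atI[OF assms(1,2)])
  fix z assume z: "z \<in> R"
    "\<And>x. x \<in> R \<Longrightarrow> additive_at (a \<circ>\<^sub>J x) (b \<circ>\<^sub>J x) \<Longrightarrow> z \<circ>\<^sub>J x = 0"
  have "z \<in> R22"
    by (rule Jordan_e_kernel[OF z(1) z(2)[OF e_in assms(3)]])
  then show "z = 0"
    using Jordan_R12_kernel[of z] z(2)[OF Peirce_in 12] by metis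
qed

text \<open>
  Jordan products of corner elements. A summand vanishes whenever
  its inner indices do not match.
\<close>

lemma Jordan_mult_zero:
  assumes "x \<in> Peirce i j" "y \<in> Peirce k l" "j \<noteq> k" "i \<noteq> l"
  shows "x \<circ>\<^sub>J y = 0"
  using Peirce_mult_zero[OF assms(1,2,3)] Peirce_mult_zero[OF assms(2,1) assms(4)[symmetric]]
  by (simp add: jordan_product_def)

lemma Jordan_mult_left:
  assumes "x \<in> Peirce i j" "y \<in> Peirce k l" "i \<noteq> l"
  shows "x \<circ>\<^sub>J y = (1/2) *\<^sub>R (x * y)"
  using Peirce_mult_zero[OF assms(2,1) assms(3)[symmetric]]
  by (simp add: jordan_product_def)

lemma Jordan_mult_right:
  assumes "x \<in> Peirce i j" "y \<in> Peirce k l" "j \<noteq> k"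
  shows "x \<circ>\<^sub>J y = (1/2) *\<^sub>R (y * x)"
  using Peirce_mult_zero[OF assms]
  by (simp add: jordan_product_def)

lemma Jordan_Peirce_left:
  assumes "x \<in> Peirce i j" "y \<in> Peirce j k" "i \<noteq> k"
  shows "x \<circ>\<^sub>J y \<in> Peirce i k"
  unfolding Jordan_mult_left[OF assms] by (intro Peirce_scaleR Peirce_mult[OF assms(1,2)])

lemma Jordan_Peirce_right:
  assumes "x \<in> Peirce i j" "y \<in> Peirce k i" "k \<noteq> j"
  shows "x \<circ>\<^sub>J y \<in> Peirce k j"
  unfolding Jordan_mult_right[OF assms(1,2) assms(3)[symmetric]]
  by (intro Peirce_scaleR Peirce_mult[OF assms(2,1)])

lemma Jordan_e_diagonal: "x \<in> R11 \<Longrightarrow> x \<circ>\<^sub>J e = x" "x \<in> R22 \<Longrightarrow> x \<circ>\<^sub>J e = 0"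
  by (simp_all add: Peirce_def jordan_product_def scaleR_2[symmetric])

lemma additive_R11_R12:
  assumes a: "a \<in> R11" and b: "b \<in> R12"
  shows "additive_at a b"
  by (rule additive_at_R22_R12_tests[OF Peirce_in[OF a] Peirce_in[OF b]])
     (use a b in \<open>simp_all add: Jordan_mult_zero[OF a] Jordan_mult_zero[OF b]\<close>)

lemma additive_R22_R12:
  assumes a: "a \<in> R22" and b: "b \<in> R12"
  shows "additive_at a b"
  by (rule additive_at_e_R12_tests[OF Peirce_in[OF a] Peirce_in[OF b]])
     (use a b in \<open>simp_all add: Jordan_mult_zero[OF b] Jordan_e_diagonal\<close>)

text \<open>
  Here additivity is not inherited from products but produced by a product: for a test element
  \<open>y\<close> of \<open>R22\<close>, the elements \<open>e + a\<close> and \<open>y + b y\<close> are sums of the kinds treated above, and their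
  Jordan product is \<open>b \<circ>\<^sub>J y + a \<circ>\<^sub>J y\<close>. Expanding its image in the target gives additivity at
  \<open>a \<circ>\<^sub>J y\<close> and \<open>b \<circ>\<^sub>J y\<close>.
\<close>

lemma additive_R12_R12:
  assumes a: "a \<in> R12" and b: "b \<in> R12"
  shows "additive_at a b"
proof (rule additive_at_R22_R12_tests[OF Peirce_in[OF a] Peirce_in[OF b]])
  fix x assume x: "x \<in> R12"
  show "additive_at (a \<circ>\<^sub>J x) (b \<circ>\<^sub>J x)"
    using Jordan_mult_zero[OF a x] by simp
next
  fix y assume y: "y \<in> R22"
  let ?b = "b * y"
  have bR: "?b \<in> R12" using b y by (rule Peirce_mult)
  have R: "a \<in> R" "y \<in> R" "?b \<in> R" using a y Peirce_in[OF bR] Peirce_in by auto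
  \<comment> \<open>of the four products of the summands of \<open>e + a\<close> and \<open>y + b y\<close>, only two survive\<close>
  have ye: "e \<circ>\<^sub>J y = 0" using Jordan_mult_zero[OF e_Peirce y] by simp
  have ab: "a \<circ>\<^sub>J ?b = 0" using Jordan_mult_zero[OF a bR] by simp
  have eb: "e \<circ>\<^sub>J ?b = b \<circ>\<^sub>J y"
    using bR Jordan_mult_left[OF b y] Peirce_mult_zero[OF bR e_Peirce]
    by (simp add: jordan_product_def Peirce_def)
  have "\<phi> ((e + a) \<circ>\<^sub>J (y + ?b)) = (\<phi> e + \<phi> a) \<circ>\<^sub>J (\<phi> y + \<phi> ?b)"
    using R additive_R11_R12[OF e_Peirce a] additive_R22_R12[OF y bR]
    by (simp add: jordan additive_at_def)
  also have "\<dots> = \<phi> (e \<circ>\<^sub>J y) + \<phi> (e \<circ>\<^sub>J ?b) + \<phi> (a \<circ>\<^sub>J y) + \<phi> (a \<circ>\<^sub>J ?b)"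
    using R by (simp add: jordan jordan_product_add_left jordan_product_add_right add_ac)
  finally have "\<phi> ((e + a) \<circ>\<^sub>J (y + ?b)) = \<phi> (b \<circ>\<^sub>J y) + \<phi> (a \<circ>\<^sub>J y)"
    by (simp add: ye ab eb phi_zero)
  moreover have "(e + a) \<circ>\<^sub>J (y + ?b) = b \<circ>\<^sub>J y + a \<circ>\<^sub>J y"
    by (simp add: jordan_product_add_left jordan_product_add_right ye ab eb)
  ultimately show "additive_at (a \<circ>\<^sub>J y) (b \<circ>\<^sub>J y)"
    by (simp add: additive_at_def add.commute)
qed

lemma additive_R11_R11:
  assumes a: "a \<in> R11" and b: "b \<in> R11"
  shows "additive_at a b"
  by (rule additive_at_R22_R12_tests[OF Peirce_in[OF a] Peirce_in[OF b]])
     (use a b Jordan_Peirce_left[OF a, of _ False] Jordan_Peirce_left[OF b, of _ False] in \<open>simp_all add: Jordan_mult_zero[OF a] additive_R12_R12\<close>)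

lemma additive_R22_R22:
  assumes a: "a \<in> R22" and b: "b \<in> R22"
  shows "additive_at a b"
  by (rule additive_at_e_R12_tests[OF Peirce_in[OF a] Peirce_in[OF b]])
     (use a b Jordan_Peirce_right[OF a, of _ True] Jordan_Peirce_right[OF b, of _ True] in \<open>simp_all add: Jordan_e_diagonal additive_R12_R12\<close>)

lemma additive_R11_R12_R22:
  assumes a: "a \<in> R11" and b: "b \<in> R12" and d: "d \<in> R22"
  shows "\<phi> (a + b + d) = \<phi> a + \<phi> b + \<phi> d"
proof -
  have "additive_at (a + b) d"
    by (rule additive_at_e_R12_tests[OF closed(2)[OF Peirce_in[OF a] Peirce_in[OF b]] Peirce_in[OF d]])
     (use a b d Jordan_Peirce_left[OF a, of _ False] Jordan_Peirce_right[OF d, of _ True] in \<open>simp_all add: Jordan_e_diagonal jordan_product_add_left Jordan_mult_zero[OF b] additive_R12_R12\<close>)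
  then show ?thesis using additive_R11_R12[OF a b] by (simp add: additive_at_def)
qed

lemma additive_upper_triangular:
  assumes "a \<in> R11" "b \<in> R12" "d \<in> R22" "a' \<in> R11" "b' \<in> R12" "d' \<in> R22"
  shows "additive_at (a + b + d) (a' + b' + d')"
proof -
  have "\<phi> ((a + a') + (b + b') + (d + d')) = \<phi> (a + a') + \<phi> (b + b') + \<phi> (d + d')"
    using assms by (intro additive_R11_R12_R22 Peirce_add)
  then show ?thesis
    using assms additive_R11_R11[of a a'] additive_R12_R12[of b b'] additive_R22_R22[of d d']
      additive_R11_R12_R22[OF assms(1-3)] additive_R11_R12_R22[OF assms(4-6)]
    by (simp add: additive_at_def add_ac)
qed

lemma Jordan_off_diagonal:
  assumes "b \<in> R12" "c \<in> R21" "x \<in> R12 \<or> x \<in> R21"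
  obtains a d where "a \<in> R11" "d \<in> R22" "(b + c) \<circ>\<^sub>J x = a + d"
  using assms(3)
proof
  assume x: "x \<in> R12"
  show thesis
  proof (rule that)
    show "(1/2) *\<^sub>R (x * c) \<in> R11" "(1/2) *\<^sub>R (c * x) \<in> R22"
      using x assms by (auto intro!: Peirce_scaleR Peirce_mult)
    show "(b + c) \<circ>\<^sub>J x = (1/2) *\<^sub>R (x * c) + (1/2) *\<^sub>R (c * x)"
      using Jordan_mult_zero[OF assms(1) x]
      by (simp add: jordan_product_add_left) (simp add: jordan_product_def scaleR_add_right add.commute)
  qed
next
  assume x: "x \<in> R21"
  show thesis
  proof (rule that)
    show "(1/2) *\<^sub>R (b * x) \<in> R11" "(1/2) *\<^sub>R (x * b) \<in> R22"
      using x assms by (auto intro!: Peirce_scaleR Peirce_mult)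
    show "(b + c) \<circ>\<^sub>J x = (1/2) *\<^sub>R (b * x) + (1/2) *\<^sub>R (x * b)"
      using Jordan_mult_zero[OF assms(2) x]
      by (simp add: jordan_product_add_left) (simp add: jordan_product_def scaleR_add_right)
  qed
qed

text \<open>
  Testing with off-diagonal elements leaves a defect \<open>z = a + d\<close> that is diagonal. The same
  argument is then run for the halves of the four elements, which arise as products with \<open>e\<close>.
  Their defect is \<open>z \<circ>\<^sub>J e = a\<close>, without a component in \<open>R22\<close>, so testing against \<open>R12\<close>
  gives \<open>a = 0\<close>. With \<open>a = 0\<close> the tests of \<open>z\<close> itself give \<open>d = 0\<close>.
\<close>

lemma additive_off_diagonal:
  assumes bc: "b \<in> R12" "c \<in> R21" and bc': "b' \<in> R12" "c' \<in> R21"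
  shows "additive_at (b + c) (b' + c')"
proof -
  have test: "additive_at ((b + c) \<circ>\<^sub>J x) ((b' + c') \<circ>\<^sub>J x)"
    if bc: "b \<in> R12" "c \<in> R21" "b' \<in> R12" "c' \<in> R21" and x: "x \<in> R12 \<or> x \<in> R21"
    for b c b' c' x
  proof -
    obtain a d where ad: "a \<in> R11" "d \<in> R22" "(b + c) \<circ>\<^sub>J x = a + d"
      using Jordan_off_diagonal bc x by metis
    obtain a' d' where ad': "a' \<in> R11" "d' \<in> R22" "(b' + c') \<circ>\<^sub>J x = a' + d'"
      using Jordan_off_diagonal bc x by metis
    show ?thesis
      using additive_upper_triangular[OF ad(1) Peirce_zero ad(2) ad'(1) Peirce_zero ad'(2)] ad(3) ad'(3)
      by simp
  qed
  have R: "b + c \<in> R" "b' + c' \<in> R" using bc bc' Peirce_in by auto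
  have half: "(b + c) \<circ>\<^sub>J e = (1/2) *\<^sub>R b + (1/2) *\<^sub>R c" if "b \<in> R12" "c \<in> R21" for b c
    using that by (simp add: jordan_product_def Peirce_def distrib_left distrib_right scaleR_add_right)
  obtain z where z: "z \<in> R" "\<phi> (b + c + (b' + c') + z) = \<phi> (b + c) + \<phi> (b' + c')"
    "\<And>x. x \<in> R \<Longrightarrow> \<phi> ((b + c + (b' + c') + z) \<circ>\<^sub>J x) = \<phi> ((b + c) \<circ>\<^sub>J x) + \<phi> ((b' + c') \<circ>\<^sub>J x)"
    "\<And>x. x \<in> R \<Longrightarrow> additive_at ((b + c) \<circ>\<^sub>J x) ((b' + c') \<circ>\<^sub>J x) \<Longrightarrow> z \<circ>\<^sub>J x = 0"
    using additive_defect[OF R] by metis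
  have zx: "z \<circ>\<^sub>J x = 0" if "x \<in> R12 \<or> x \<in> R21" for x
    using z(4)[of x] test[OF bc bc' that] that Peirce_in by auto
  obtain a d where ad: "a \<in> R11" "d \<in> R22" "z = a + d"
    using Jordan_off_diagonal_kernel[OF z(1)] zx by metis
  \<comment> \<open>now the same test for the halves, where the defect is \<open>a\<close> alone\<close>
  let ?h = "\<lambda>x. (1/2) *\<^sub>R x"
  define u u' where "u = ?h b + ?h c" and "u' = ?h b' + ?h c'"
  have u: "u \<in> R" "u' \<in> R" using bc bc' Peirce_in by (auto simp: u_def u'_def)
  have "\<phi> ((b + c + (b' + c') + z) \<circ>\<^sub>J e) = \<phi> u + \<phi> u'"
    using z(3)[OF e_in] half[OF bc] half[OF bc'] by (simp add: u_def u'_def)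
  moreover have "(b + c + (b' + c') + z) \<circ>\<^sub>J e = (b + c) \<circ>\<^sub>J e + (b' + c') \<circ>\<^sub>J e + z \<circ>\<^sub>J e"
    by (simp only: jordan_product_add_left)
  moreover have "z \<circ>\<^sub>J e = a"
    using ad by (simp add: jordan_product_add_left Jordan_e_diagonal)
  ultimately have ea: "\<phi> (u + u' + a) = \<phi> u + \<phi> u'"
    by (simp add: half[OF bc] half[OF bc'] u_def u'_def)
  have "a \<circ>\<^sub>J x = 0" if x: "x \<in> R12" for x
  proof -
    have xR: "x \<in> R" using x by (rule Peirce_in)
    have "additive_at (u \<circ>\<^sub>J x) (u' \<circ>\<^sub>J x)"
      unfolding u_def u'_def using bc bc' x by (intro test Peirce_scaleR) auto
    then have "\<phi> ((u + u') \<circ>\<^sub>J x) = \<phi> u \<circ>\<^sub>J \<phi> x + \<phi> u' \<circ>\<^sub>J \<phi> x"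
      using u xR by (simp add: additive_at_def jordan_product_add_left jordan)
    also have "\<dots> = (\<phi> u + \<phi> u') \<circ>\<^sub>J \<phi> x"
      by (simp add: jordan_product_add_left)
    also have "\<dots> = \<phi> ((u + u' + a) \<circ>\<^sub>J x)"
      using jordan[OF _ xR, of "u + u' + a"] ea u Peirce_in[OF ad(1)] by simp
    finally have "(u + u') \<circ>\<^sub>J x = (u + u' + a) \<circ>\<^sub>J x"
      using phi_inj u xR ad Peirce_in by (metis closed(2,6))
    then show ?thesis by (simp add: jordan_product_add_left[of "u + u'"])
  qed
  then have a: "a = 0" using Jordan_R12_kernel ad by blast
  then have "d = 0" using Jordan_R12_kernel[of d] zx ad by auto
  then show ?thesis using z(2) ad a by (simp add: additive_at_def)
qed

lemma additive_R11_off_diagonal: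
  assumes a: "a \<in> R11" and b: "b \<in> R12" and c: "c \<in> R21"
  shows "additive_at a (b + c)"
proof (rule additive_at_R22_R12_tests[OF Peirce_in[OF a] closed(2)[OF Peirce_in[OF b] Peirce_in[OF c]]])
  fix x assume x: "x \<in> R22"
  show "additive_at (a \<circ>\<^sub>J x) ((b + c) \<circ>\<^sub>J x)"
    using Jordan_mult_zero[OF a x] by simp
next
  fix x assume x: "x \<in> R12"
  obtain a' d' where ad': "a' \<in> R11" "d' \<in> R22" "(b + c) \<circ>\<^sub>J x = a' + d'"
    using Jordan_off_diagonal b c x by metis
  have "a \<circ>\<^sub>J x \<in> R12" using Jordan_Peirce_left[OF a x] by simp
  from additive_upper_triangular[OF Peirce_zero this Peirce_zero ad'(1) Peirce_zero ad'(2)]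
  show "additive_at (a \<circ>\<^sub>J x) ((b + c) \<circ>\<^sub>J x)"
    by (simp add: ad')
qed

lemma additive_Peirce_sum:
  assumes a: "a \<in> R11" and b: "b \<in> R12" and c: "c \<in> R21" and d: "d \<in> R22"
  shows "\<phi> (a + b + c + d) = \<phi> a + \<phi> (b + c) + \<phi> d"
proof -
  have "additive_at (a + (b + c)) d"
  proof (rule additive_at_e_R12_tests[OF closed(2)[OF Peirce_in[OF a] closed(2)[OF Peirce_in[OF b] Peirce_in[OF c]]] Peirce_in[OF d]])
    show "additive_at ((a + (b + c)) \<circ>\<^sub>J e) (d \<circ>\<^sub>J e)"
      using d by (simp add: Jordan_e_diagonal)
  next
    fix x assume x: "x \<in> R12"
    obtain a' d' where ad': "a' \<in> R11" "d' \<in> R22" "(b + c) \<circ>\<^sub>J x = a' + d'"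
      using Jordan_off_diagonal b c x by metis
    have "a \<circ>\<^sub>J x \<in> R12" "d \<circ>\<^sub>J x \<in> R12"
      using Jordan_Peirce_left[OF a x] Jordan_Peirce_right[OF d x] by simp_all
    from additive_upper_triangular[OF ad'(1) this(1) ad'(2) Peirce_zero this(2) Peirce_zero]
    show "additive_at ((a + (b + c)) \<circ>\<^sub>J x) (d \<circ>\<^sub>J x)"
      by (simp add: jordan_product_add_left[of a] ad' add_ac)
  qed
  then show ?thesis
    using additive_R11_off_diagonal[OF a b c] by (simp add: additive_at_def add_ac)
qed

theorem additive:
  assumes "x \<in> R" "y \<in> R"
  shows "\<phi> (x + y) = \<phi> x + \<phi> y"
proof -
  obtain a b c d where x: "a \<in> R11" "b \<in> R12" "c \<in> R21" "d \<in> R22" "x = a + b + c + d"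
    using Peirce_decompose[OF assms(1)] .
  obtain a' b' c' d' where y: "a' \<in> R11" "b' \<in> R12" "c' \<in> R21" "d' \<in> R22" "y = a' + b' + c' + d'"
    using Peirce_decompose[OF assms(2)] .
  have "\<phi> ((a + a') + (b + b') + (c + c') + (d + d'))
      = \<phi> (a + a') + \<phi> ((b + b') + (c + c')) + \<phi> (d + d')"
    using x y by (intro additive_Peirce_sum Peirce_add)
  moreover have "\<phi> (a + a') = \<phi> a + \<phi> a'" "\<phi> (d + d') = \<phi> d + \<phi> d'"
    "\<phi> ((b + c) + (b' + c')) = \<phi> (b + c) + \<phi> (b' + c')"
    using x y additive_R11_R11[of a a'] additive_R22_R22[of d d'] additive_off_diagonal[of b c b' c']
    by (simp_all add: additive_at_def)
  ultimately show ?thesis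
    using x y additive_Peirce_sum[of a b c d] additive_Peirce_sum[of a' b' c' d']
    by (simp add: add_ac)
qed

end

section \<open>Additive Jordan isomorphisms onto prime algebras\<close>

text \<open>
  As for a group covered by two subgroups: if \<open>x\<close> satisfies only \<open>U\<close> and \<open>y\<close> satisfies only \<open>V\<close>, then
  \<open>x + y\<close> can satisfy neither.
\<close>

lemma two_subgroups_cover:
  fixes R :: "'a::ab_group_add set"
  assumes closed: "\<And>x y. x \<in> R \<Longrightarrow> y \<in> R \<Longrightarrow> x + y \<in> R"
    and U: "\<And>x y. x \<in> R \<Longrightarrow> y \<in> R \<Longrightarrow> U x \<Longrightarrow> U (x + y) \<Longrightarrow> U y"
    and V: "\<And>x y. x \<in> R \<Longrightarrow> y \<in> R \<Longrightarrow> V x \<Longrightarrow> V (y + x) \<Longrightarrow> V y"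
    and cover: "\<And>x. x \<in> R \<Longrightarrow> U x \<or> V x"
  shows "(\<forall>x\<in>R. U x) \<or> (\<forall>x\<in>R. V x)"
proof (rule ccontr)
  assume "\<not> ?thesis"
  then obtain x y where x: "x \<in> R" "\<not> V x" and y: "y \<in> R" "\<not> U y" by blast
  then have "U x" "V y" using cover by blast+
  then have "\<not> U (x + y)" "\<not> V (x + y)"
    using U[OF x(1) y(1)] V[OF y(1) x(1)] x y by auto
  then show False using cover closed x y by blast
qed

text \<open>
  Moving \<open>u\<close> past \<open>v\<close> three times inside \<open>(u z v) y (u z v)\<close> returns its negative, so this
  element is zero for all \<open>y\<close>, and primeness applies twice.
\<close>

lemma (in prime_subalgebra) skew_sandwich_zero:
  assumes u: "u \<in> R" and v: "v \<in> R"
    and skew: "\<And>z. z \<in> R \<Longrightarrow> u * z * v + v * z * u = 0"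
  shows "u = 0 \<or> v = 0"
proof (rule prime[OF u v])
  fix z assume z: "z \<in> R"
  have flip: "u * z * v = - (v * z * u)" if "z \<in> R" for z
    using skew[OF that] by (simp add: eq_neg_iff_add_eq_0)
  have "(u * z * v) * y * (u * z * v) = 0" if y: "y \<in> R" for y
  proof -
    have "(u * z * v) * y * (u * z * v) = - ((u * z * v) * y * (v * z * u))"
      by (simp add: flip[OF z])
    also have "\<dots> = - ((u * (z * v * y) * v) * z * u)"
      by (simp add: mult.assoc)
    also have "\<dots> = (v * (z * v * y) * u) * z * u"
      using u v y z by (simp add: flip)
    also have "\<dots> = v * z * (v * y * u) * z * u"
      by (simp add: mult.assoc)
    also have "\<dots> = - (v * z * (u * y * v) * z * u)"
      by (simp add: flip[OF y])
    also have "\<dots> = - ((v * z * u) * y * (v * z * u))"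
      by (simp add: mult.assoc)
    also have "\<dots> = - ((u * z * v) * y * (u * z * v))"
      by (simp add: flip[OF z])
    finally show ?thesis
      using vector_double_eq_0_iff[of "(u * z * v) * y * (u * z * v)"] by (simp add: eq_neg_iff_add_eq_0)
  qed
  then show "u * z * v = 0"
    using prime[of "u * z * v" "u * z * v"] u v z by auto
qed

locale additive_Jordan_iso = prime_subalgebra R + T: prime_subalgebra S
  for R :: "'r::real_algebra set" and S :: "'s::real_algebra set" +
  fixes \<phi> :: "'r \<Rightarrow> 's"
  assumes surj: "\<phi> ` R = S"
    and add: "\<And>x y. x \<in> R \<Longrightarrow> y \<in> R \<Longrightarrow> \<phi> (x + y) = \<phi> x + \<phi> y"
    and jordan: "\<And>x y. x \<in> R \<Longrightarrow> y \<in> R \<Longrightarrow> \<phi> (x * y + y * x) = \<phi> x * \<phi> y + \<phi> y * \<phi> x"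
begin

lemma phi_in: "x \<in> R \<Longrightarrow> \<phi> x \<in> S"
  using surj by auto

lemma phi_cancel_double:
  assumes "x \<in> R" "\<phi> (x + x) = y + y"
  shows "\<phi> x = y"
proof -
  have "(\<phi> x - y) + (\<phi> x - y) = (\<phi> x + \<phi> x) - (y + y)" by simp
  also have "\<dots> = 0" using assms by (simp add: add)
  finally have "(\<phi> x - y) + (\<phi> x - y) = 0" .
  then show ?thesis by (simp only: vector_double_eq_0_iff) simp
qed

lemma square: "x \<in> R \<Longrightarrow> \<phi> (x * x) = \<phi> x * \<phi> x"
  by (rule phi_cancel_double) (simp_all add: jordan)

lemma sandwich:
  assumes x: "x \<in> R" and y: "y \<in> R"
  shows "\<phi> (x * y * x) = \<phi> x * \<phi> y * \<phi> x"
proof (rule phi_cancel_double)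
  let ?s = "x * y + y * x"
  have "x * ?s + ?s * x = ((x * x) * y + y * (x * x)) + (x * y * x + x * y * x)"
    by (simp add: algebra_simps)
  then have "\<phi> (x * ?s + ?s * x) = \<phi> (x * x) * \<phi> y + \<phi> y * \<phi> (x * x) + \<phi> (x * y * x + x * y * x)"
    using x y add[of "(x * x) * y + y * (x * x)" "x * y * x + x * y * x"] jordan[of "x * x" y] by simp
  moreover have "\<phi> (x * ?s + ?s * x) = \<phi> x * \<phi> ?s + \<phi> ?s * \<phi> x"
    using x y by (intro jordan) auto
  moreover have "\<phi> ?s = \<phi> x * \<phi> y + \<phi> y * \<phi> x"
    using x y by (rule jordan)
  ultimately show "\<phi> (x * y * x + x * y * x) = \<phi> x * \<phi> y * \<phi> x + \<phi> x * \<phi> y * \<phi> x"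
    using x by (simp add: square algebra_simps)
qed (use x y in simp)

lemma triple:
  assumes x: "x \<in> R" and y: "y \<in> R" and z: "z \<in> R"
  shows "\<phi> (x * z * y + y * z * x) = \<phi> x * \<phi> z * \<phi> y + \<phi> y * \<phi> z * \<phi> x"
proof -
  have "(x + y) * z * (x + y) = x * z * x + y * z * y + (x * z * y + y * z * x)"
    by (simp add: algebra_simps)
  then have "\<phi> ((x + y) * z * (x + y)) = \<phi> (x * z * x) + \<phi> (y * z * y) + \<phi> (x * z * y + y * z * x)"
    using x y z by (simp only: add closed)
  moreover have "\<phi> ((x + y) * z * (x + y)) = \<phi> (x + y) * \<phi> z * \<phi> (x + y)"
    using x y z by (intro sandwich) auto
  ultimately show ?thesis
    using x y z sandwich[OF x z] sandwich[OF y z] by (simp add: add algebra_simps)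
qed

text \<open>
  The image \<open>t\<close> of \<open>x y\<close> is compared with \<open>a b\<close> and with \<open>b a\<close>. The element
  \<open>(x y) z (y x) + (y x) z (x y)\<close> is a triple product in \<open>x y\<close> and \<open>y x\<close>, and also a sum of nested
  sandwiches of \<open>x\<close> and \<open>y\<close>. The two expressions for its image differ by
  \<open>(t - a b) w (t - b a) + (t - b a) w (t - a b)\<close>.
\<close>

lemma mult_or_antimult:
  assumes x: "x \<in> R" and y: "y \<in> R"
  shows "\<phi> (x * y) = \<phi> x * \<phi> y \<or> \<phi> (x * y) = \<phi> y * \<phi> x"
proof -
  define a b t where "a = \<phi> x" and "b = \<phi> y" and "t = \<phi> (x * y)"
  have S: "a \<in> S" "b \<in> S" "t \<in> S"
    using x y phi_in by (auto simp: a_def b_def t_def)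
  have yx: "\<phi> (y * x) = a * b + b * a - t"
    using jordan[OF x y] add[of "x * y" "y * x"] x y by (simp add: a_def b_def t_def eq_diff_eq add.commute)
  have "(t - a * b) * w * (t - b * a) + (t - b * a) * w * (t - a * b) = 0" if "w \<in> S" for w
  proof -
    obtain z where z: "z \<in> R" "w = \<phi> z" using \<open>w \<in> S\<close> surj by auto
    have "\<phi> ((x * y) * z * (y * x) + (y * x) * z * (x * y))
        = t * w * (a * b + b * a - t) + (a * b + b * a - t) * w * t"
      using triple[of "x * y" "y * x" z] x y z yx by (simp add: t_def)
    moreover have "(x * y) * z * (y * x) + (y * x) * z * (x * y) = x * (y * z * y) * x + y * (x * z * x) * y"
      by (simp add: mult.assoc)
    moreover have "\<phi> (x * (y * z * y) * x + y * (x * z * x) * y) = a * (b * w * b) * a + b * (a * w * a) * b"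
      using x y z by (simp add: add sandwich a_def b_def)
    ultimately have "t * w * (a * b + b * a - t) + (a * b + b * a - t) * w * t
        = a * (b * w * b) * a + b * (a * w * a) * b"
      by simp
    then show ?thesis by (simp add: algebra_simps)
  qed
  then have "t - a * b = 0 \<or> t - b * a = 0"
    using S by (intro T.skew_sandwich_zero) auto
  then show ?thesis by (simp add: a_def b_def t_def)
qed

text \<open>
  For fixed \<open>x\<close>, multiplicativity and antimultiplicativity are additive conditions on \<open>y\<close>, and
  after that on \<open>x\<close>; so the alternative can be chosen once for all pairs.
\<close>

theorem mult_or_antimult_global:
  "(\<forall>x\<in>R. \<forall>y\<in>R. \<phi> (x * y) = \<phi> x * \<phi> y) \<or> (\<forall>x\<in>R. \<forall>y\<in>R. \<phi> (x * y) = \<phi> y * \<phi> x)"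
proof (rule two_subgroups_cover)
  fix x assume x: "x \<in> R"
  show "(\<forall>y\<in>R. \<phi> (x * y) = \<phi> x * \<phi> y) \<or> (\<forall>y\<in>R. \<phi> (x * y) = \<phi> y * \<phi> x)"
  proof (rule two_subgroups_cover)
    fix y z assume yz: "y \<in> R" "z \<in> R"
    have *: "\<phi> (x * (y + z)) = \<phi> (x * y) + \<phi> (x * z)" "\<phi> (y + z) = \<phi> y + \<phi> z"
      using x yz by (simp_all add: add distrib_left)
    show "\<phi> (x * z) = \<phi> x * \<phi> z" if "\<phi> (x * y) = \<phi> x * \<phi> y" "\<phi> (x * (y + z)) = \<phi> x * \<phi> (y + z)"
      using that * by (simp add: distrib_left)
    show "\<phi> (x * z) = \<phi> z * \<phi> x" if "\<phi> (x * y) = \<phi> y * \<phi> x" "\<phi> (x * (z + y)) = \<phi> (z + y) * \<phi> x"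
      using that by (simp add: * distrib_right add.commute[of z])
  qed (use x mult_or_antimult in auto)
next
  fix x y assume xy: "x \<in> R" "y \<in> R"
  have *: "\<phi> ((x + y) * z) = \<phi> (x * z) + \<phi> (y * z)" if "z \<in> R" for z
    using xy that by (simp add: add distrib_right)
  have **: "\<phi> (x + y) = \<phi> x + \<phi> y"
    using xy by (rule add)
  show "\<forall>z\<in>R. \<phi> (y * z) = \<phi> y * \<phi> z"
    if "\<forall>z\<in>R. \<phi> (x * z) = \<phi> x * \<phi> z" "\<forall>z\<in>R. \<phi> ((x + y) * z) = \<phi> (x + y) * \<phi> z"
    using that xy by (simp add: ** add distrib_right)
  show "\<forall>z\<in>R. \<phi> (y * z) = \<phi> z * \<phi> y"
    if "\<forall>z\<in>R. \<phi> (x * z) = \<phi> z * \<phi> x" "\<forall>z\<in>R. \<phi> ((y + x) * z) = \<phi> z * \<phi> (y + x)"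
    using that by (simp add: * ** add.commute[of y] distrib_left)
qed auto

end

section \<open>Sublinear functionals and linear minorants\<close>

definition sublinear :: "('a::real_vector \<Rightarrow> real) \<Rightarrow> bool" where
  "sublinear q \<longleftrightarrow> (\<forall>x y. q (x + y) \<le> q x + q y) \<and> (\<forall>x. \<forall>t>0. q (t *\<^sub>R x) = t * q x)"

lemma sublinear_add: "sublinear q \<Longrightarrow> q (x + y) \<le> q x + q y"
  and sublinear_scale: "sublinear q \<Longrightarrow> t > 0 \<Longrightarrow> q (t *\<^sub>R x) = t * q x"
  by (simp_all add: sublinear_def)

lemma sublinear_zero:
  assumes "sublinear q" shows "q 0 = 0"
  using sublinear_scale[OF assms, of 2 0] by simp

lemma sublinear_minus_ge:
  assumes "sublinear q" shows "- q (- x) \<le> q x"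
  using sublinear_add[OF assms, of x "- x"] sublinear_zero[OF assms] by simp

lemma sublinearI:
  assumes "\<And>x y. q (x + y) \<le> q x + q y"
    and le: "\<And>t x. t > 0 \<Longrightarrow> q (t *\<^sub>R x) \<le> t * q x"
  shows "sublinear q"
  unfolding sublinear_def
proof (intro conjI allI impI)
  fix x and t :: real assume t: "t > 0"
  have "t * q x = t * q ((1/t) *\<^sub>R (t *\<^sub>R x))" using t by simp
  also have "\<dots> \<le> t * ((1/t) * q (t *\<^sub>R x))"
    using t by (intro mult_left_mono le) auto
  also have "\<dots> = q (t *\<^sub>R x)" using t by simp
  finally show "q (t *\<^sub>R x) = t * q x" using le[OF t, of x] by simp
qed (use assms in auto)

text \<open>
  The infimum over \<open>t \<ge> 0\<close> of \<open>q (x + t u) - t q u\<close> has these properties; \<open>t = 0\<close> and \<open>t = 1\<close> give the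
  two inequalities. As always \<open>- q u \<le> q (- u)\<close>, a minimal sublinear functional is therefore odd.
  Applied to the norm, the construction keeps a linear minorant from vanishing at \<open>u\<close>.
\<close>

lemma sublinear_descend:
  fixes u :: "'a::real_vector"
  assumes q: "sublinear q"
  obtains q' where "sublinear q'" "\<And>x. q' x \<le> q x" "q' (- u) \<le> - q u"
proof
  define g where "g x t = q (x + t *\<^sub>R u) - t * q u" for x t
  define q' where "q' x = (INF t\<in>{0..}. g x t)" for x
  have lower: "- q (- x) \<le> g x t" if "t \<ge> 0" for x t
  proof -
    have "t * q u = q (t *\<^sub>R u)"
      using that sublinear_scale[OF q, of t u] sublinear_zero[OF q] by (cases "t = 0") auto
    also have "\<dots> \<le> q (x + t *\<^sub>R u) + q (- x)"
      using sublinear_add[OF q, of "x + t *\<^sub>R u" "- x"] by simp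
    finally show ?thesis by (simp add: g_def)
  qed
  have bdd: "bdd_below (g x ` {0..})" for x
    using lower by (intro bdd_belowI2[where m = "- q (- x)"]) auto
  have q'_le: "q' x \<le> g x t" if "t \<ge> 0" for x t
    unfolding q'_def using that by (intro cINF_lower bdd) auto
  have q'_ge: "c \<le> q' x" if "\<And>t. t \<ge> 0 \<Longrightarrow> c \<le> g x t" for c x
    unfolding q'_def using that by (intro cINF_greatest) auto
  show "sublinear q'"
  proof (rule sublinearI)
    fix x y
    have "q' (x + y) \<le> g x t + g y s" if "t \<ge> 0" "s \<ge> 0" for t s
    proof -
      have "q' (x + y) \<le> g (x + y) (t + s)" using that by (intro q'_le) auto
      also have "\<dots> \<le> g x t + g y s"
        using sublinear_add[OF q, of "x + t *\<^sub>R u" "y + s *\<^sub>R u"]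
        by (simp add: g_def algebra_simps)
      finally show ?thesis .
    qed
    then have "q' (x + y) - g y s \<le> q' x" if "s \<ge> 0" for s
      using that by (intro q'_ge) (simp add: algebra_simps)
    then have "q' (x + y) - q' x \<le> q' y"
      by (intro q'_ge) (simp add: algebra_simps)
    then show "q' (x + y) \<le> q' x + q' y" by simp
  next
    fix c :: real and x assume c: "c > 0"
    have "q' (c *\<^sub>R x) / c \<le> g x t" if "t \<ge> 0" for t
    proof -
      have "q' (c *\<^sub>R x) \<le> g (c *\<^sub>R x) (c * t)" using that c by (intro q'_le) auto
      also have "\<dots> = q (c *\<^sub>R (x + t *\<^sub>R u)) - c * t * q u"
        by (simp add: g_def scaleR_add_right)
      also have "\<dots> = c * q (x + t *\<^sub>R u) - c * t * q u"
        by (simp only: sublinear_scale[OF q c])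
      also have "\<dots> = c * g x t"
        by (simp add: g_def right_diff_distrib)
      finally show ?thesis using c by (simp add: field_simps)
    qed
    then have "q' (c *\<^sub>R x) / c \<le> q' x" by (rule q'_ge)
    then show "q' (c *\<^sub>R x) \<le> c * q' x" using c by (simp add: field_simps)
  qed
  show "q' x \<le> q x" for x using q'_le[of 0 x] by (simp add: g_def)
  show "q' (- u) \<le> - q u" using q'_le[of 1 "- u"] sublinear_zero[OF q] by (simp add: g_def)
qed

text \<open>
  A form of the Hahn-Banach theorem. A minimal sublinear functional below \<open>p\<close>, which exists by
  Zorn's lemma since chains have pointwise infima, is odd and hence linear. This avoids
  partially defined functionals.
\<close>

lemma linear_below_sublinear:
  fixes p :: "'a::real_vector \<Rightarrow> real"
  assumes p: "sublinear p"
  obtains f where "linear f" "\<And>x. f x \<le> p x"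
proof -
  define Q where "Q = {q :: 'a \<Rightarrow> real. sublinear q \<and> q \<le> p}"
  have "\<exists>m\<in>Q. \<forall>q\<in>Q. q \<le> m \<longrightarrow> q = m"
  proof (rule predicate_Zorn)
    show "partial_order_on Q (relation_of (\<lambda>a b. b \<le> a) Q)"
      by (auto simp: partial_order_on_def preorder_on_def refl_on_def trans_def antisym_def relation_of_def)
  next
    fix C assume C: "C \<in> Chains (relation_of (\<lambda>a b. b \<le> a) Q)"
    then have CQ: "C \<subseteq> Q" and chain: "\<And>a b. a \<in> C \<Longrightarrow> b \<in> C \<Longrightarrow> a \<le> b \<or> b \<le> a"
      by (auto simp: Chains_def relation_of_def)
    show "\<exists>u\<in>Q. \<forall>a\<in>C. u \<le> a"
    proof (cases "C = {}")
      case True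
      then show ?thesis using p by (auto simp: Q_def)
    next
      case False
      define u where "u x = (INF q\<in>C. q x)" for x
      have lower: "- p (- x) \<le> q x" if "q \<in> C" for q x
      proof -
        have "q (- x) \<le> p (- x)" "sublinear q" using that CQ by (auto simp: Q_def le_fun_def)
        then show ?thesis using sublinear_minus_ge[of q x] by simp
      qed
      have bdd: "bdd_below ((\<lambda>q. q x) ` C)" for x
        using lower by (intro bdd_belowI2[where m = "- p (- x)"]) auto
      have u_le: "u x \<le> q x" if "q \<in> C" for q x
        unfolding u_def using that by (intro cINF_lower bdd) auto
      have u_ge: "c \<le> u x" if "\<And>q. q \<in> C \<Longrightarrow> c \<le> q x" for c x
        unfolding u_def using that False by (intro cINF_greatest) auto
      have "sublinear u"
      proof (rule sublinearI)
        fix x y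
        have *: "u (x + y) \<le> q x + r y" if qr: "q \<in> C" "r \<in> C" for q r
        proof -
          obtain s where s: "s \<in> C" "s \<le> q" "s \<le> r" using chain[OF qr] qr by auto
          then have "sublinear s" using CQ by (auto simp: Q_def)
          then have "u (x + y) \<le> s x + s y"
            using u_le[OF s(1), of "x + y"] sublinear_add order_trans by blast
          also have "\<dots> \<le> q x + r y" using s by (intro add_mono) (auto simp: le_fun_def)
          finally show ?thesis .
        qed
        have "u (x + y) - r y \<le> u x" if "r \<in> C" for r
          using *[OF _ that] by (intro u_ge) (simp add: algebra_simps)
        then have "u (x + y) - u x \<le> u y"
          by (intro u_ge) (simp add: algebra_simps)
        then show "u (x + y) \<le> u x + u y" by simp
      next
        fix c :: real and x assume c: "c > 0"
        have "u (c *\<^sub>R x) / c \<le> q x" if "q \<in> C" for q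
        proof -
          have "sublinear q" using that CQ by (auto simp: Q_def)
          then show ?thesis
            using u_le[OF that, of "c *\<^sub>R x"] c by (simp add: sublinear_scale field_simps)
        qed
        then have "u (c *\<^sub>R x) / c \<le> u x" by (rule u_ge)
        then show "u (c *\<^sub>R x) \<le> c * u x" using c by (simp add: field_simps)
      qed
      moreover obtain q where q: "q \<in> C" using False by auto
      then have "u \<le> p"
        using u_le[OF q] CQ by (auto simp: Q_def le_fun_def intro: order_trans)
      ultimately have "u \<in> Q" by (simp add: Q_def)
      then show ?thesis using u_le by (auto simp: le_fun_def)
    qed
  qed
  then obtain m where m: "m \<in> Q" and min: "\<And>q. q \<in> Q \<Longrightarrow> q \<le> m \<Longrightarrow> q = m" by blast
  have sm: "sublinear m" and mp: "m \<le> p" using m by (auto simp: Q_def)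
  have odd: "m (- u) = - m u" for u
  proof -
    obtain q where q: "sublinear q" "\<And>x. q x \<le> m x" "q (- u) \<le> - m u"
      using sublinear_descend[OF sm, of u] by metis
    then have "q \<le> m" by (simp add: le_fun_def)
    moreover have "q \<in> Q" using q(1) \<open>q \<le> m\<close> mp by (auto simp: Q_def)
    ultimately have "q = m" by (intro min)
    then show ?thesis using q(3) sublinear_minus_ge[OF sm, of u] by simp
  qed
  have add: "m (x + y) = m x + m y" for x y
    using sublinear_add[OF sm, of x y] sublinear_add[OF sm, of "x + y" "- y"] odd[of y] by simp
  have scale: "m (t *\<^sub>R x) = t * m x" for t x
  proof (cases t "0::real" rule: linorder_cases)
    case less
    then have "m ((- t) *\<^sub>R x) = - t * m x" by (intro sublinear_scale[OF sm]) auto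
    then show ?thesis using odd[of "t *\<^sub>R x"] by simp
  qed (use sublinear_scale[OF sm] sublinear_zero[OF sm] in auto)
  have "linear m" by (rule linearI) (simp_all add: add scale)
  then show thesis using that mp by (auto simp: le_fun_def)
qed

section \<open>Bounded complex-linear operators\<close>

definition cblin :: "('a::complex_normed_vector \<Rightarrow> 'b::complex_normed_vector) \<Rightarrow> ('a \<Rightarrow>\<^sub>C 'b)" where
  "cblin f = Abs_cblinfun (Blinfun f)"

lemma cblin_apply: "bounded_clinear f \<Longrightarrow> cblinfun_apply (cblin f) = f"
  by (simp add: cblin_def cblinfun_apply_def Abs_cblinfun_inverse bounded_linear_Blinfun_apply
      bounded_clinear_def)

lemma bounded_clinear_cblinfun: "bounded_clinear (cblinfun_apply A)"
  using blinfun_of_cblinfun[of A] by (simp add: cblinfun_apply_def)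

lemma bounded_clinearI:
  assumes "\<And>x y. f (x + y) = f x + f y" "\<And>c x. f (c *\<^sub>C x) = c *\<^sub>C f x"
    and "\<And>x. norm (f x) \<le> K * norm x"
  shows "bounded_clinear f"
  unfolding bounded_clinear_def
proof (intro conjI bounded_linear_intro[where K = K] allI)
  fix r x show "f (r *\<^sub>R x) = r *\<^sub>R f x"
    using assms(2)[of "complex_of_real r" x] by (simp add: scaleC_of_real)
qed (use assms in \<open>auto simp: mult.commute\<close>)

lemma cblinfun_apply_bounded_linear: "bounded_linear (cblinfun_apply A)"
  using bounded_clinear_cblinfun[of A] by (simp add: bounded_clinear_def)

lemma cblinfun_add_right: "cblinfun_apply A (x + y) = cblinfun_apply A x + cblinfun_apply A y"
  using cblinfun_apply_bounded_linear[of A] by (simp add: linear_simps)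

lemma cblinfun_zero_right [simp]: "cblinfun_apply A 0 = 0"
  using cblinfun_apply_bounded_linear[of A] by (simp add: linear_simps)

lemma cblinfun_diff_right: "cblinfun_apply A (x - y) = cblinfun_apply A x - cblinfun_apply A y"
  using cblinfun_apply_bounded_linear[of A] by (simp add: linear_simps)

lemma cblinfun_scaleC_right: "cblinfun_apply A (c *\<^sub>C x) = c *\<^sub>C cblinfun_apply A x"
  using bounded_clinear_cblinfun[of A] by (simp add: bounded_clinear_def)

lemma cblinfun_sum_right: "cblinfun_apply A (sum f I) = (\<Sum>i\<in>I. cblinfun_apply A (f i))"
  by (rule linear_sum) (rule bounded_linear.linear[OF cblinfun_apply_bounded_linear])

lemma cblinfun_norm: "norm (cblinfun_apply A x) \<le> norm A * norm x"
  by (simp add: cblinfun_apply_def norm_cblinfun.rep_eq norm_blinfun)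

lemma cblinfun_zero_left [simp]: "cblinfun_apply 0 x = 0"
  by (simp add: cblinfun_apply_def zero_cblinfun.rep_eq)

lemma cblinfun_diff_left: "cblinfun_apply (A - B) x = cblinfun_apply A x - cblinfun_apply B x"
  using cblinfun_apply_add[of "A - B" B x] by simp

lemma scaleC_complex_apply [simp]: "c *\<^sub>C (z::complex) = c * z"
  by (simp add: scaleC_complex_def)

lemma cblinfun_sum_left: "cblinfun_apply (sum F I) x = (\<Sum>i\<in>I. cblinfun_apply (F i) x)"
  by (induction I rule: infinite_finite_induct) (simp_all add: cblinfun_apply_add)

section \<open>Separation by bounded functionals\<close>

text \<open>
  A real-linear functional \<open>g\<close> dominated by the norm is the real part of the complex-linear
  functional \<open>x \<mapsto> g x - \<i> g (\<i> x)\<close>.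
\<close>

lemma dual_separates:
  fixes u :: "'a::complex_normed_vector"
  assumes "u \<noteq> 0"
  obtains f :: "'a dual" where "cblinfun_apply f u = 1"
proof -
  have "sublinear (norm :: 'a \<Rightarrow> real)"
    by (auto simp: sublinear_def norm_triangle_ineq)
  then obtain p where p: "sublinear p" "\<And>x. p x \<le> norm (x::'a)" "p (- u) \<le> - norm u"
    using sublinear_descend by metis
  obtain g where g: "linear g" "\<And>x. g x \<le> p x" using linear_below_sublinear[OF p(1)] by metis
  have g_le: "\<bar>g x\<bar> \<le> norm x" for x
    using g(2)[of x] p(2)[of x] g(2)[of "- x"] p(2)[of "- x"] linear_neg[OF g(1), of x] by simp
  have gu: "g u \<ge> norm u"
    using g(2)[of "- u"] p(3) linear_neg[OF g(1), of u] by simp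
  define F where "F x = Complex (g x) (- g (\<i> *\<^sub>C x))" for x
  \<comment> \<open>the values of \<open>g\<close> on the complex line of \<open>x\<close> are determined by those at \<open>x\<close> and \<open>\<i> x\<close>\<close>
  have g_scaleC: "g (c *\<^sub>C x) = Re c * g x + Im c * g (\<i> *\<^sub>C x)" for c x
  proof -
    have "c = complex_of_real (Re c) + complex_of_real (Im c) * \<i>"
      by (simp add: complex_eq_iff)
    then have "c *\<^sub>C x = (complex_of_real (Re c) + complex_of_real (Im c) * \<i>) *\<^sub>C x"
      by simp
    also have "\<dots> = Re c *\<^sub>R x + Im c *\<^sub>R (\<i> *\<^sub>C x)"
      by (simp only: scaleC_add_left scaleC_scaleC[symmetric] scaleC_of_real)
    finally have "c *\<^sub>C x = Re c *\<^sub>R x + Im c *\<^sub>R (\<i> *\<^sub>C x)" .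
    then show ?thesis by (simp add: linear_add[OF g(1)] linear_cmul[OF g(1)])
  qed
  have "bounded_clinear F"
  proof (rule bounded_clinearI)
    show "F (x + y) = F x + F y" for x y
      by (simp add: F_def scaleC_add_right linear_add[OF g(1)] complex_eq_iff)
    show "F (c *\<^sub>C x) = c *\<^sub>C F x" for c x
      using g_scaleC[of c x] g_scaleC[of "\<i> * c" x]
      by (simp add: F_def scaleC_scaleC complex_eq_iff algebra_simps)
    show "norm (F x) \<le> 2 * norm x" for x
      using cmod_le[of "F x"] g_le[of x] g_le[of "\<i> *\<^sub>C x"] by (simp add: F_def norm_scaleC)
  qed
  then have F: "cblinfun_apply (cblin F) = F" by (rule cblin_apply)
  have "F u \<noteq> 0" using gu assms by (auto simp: F_def complex_eq_iff)
  then show thesis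
    by (intro that[of "(1 / F u) *\<^sub>C cblin F"]) (simp add: F cblinfun_apply_scaleC)
qed

lemma cblinfun_zero_on_span:
  assumes "\<And>b. b \<in> B \<Longrightarrow> cblinfun_apply A b = 0" "v \<in> complex_vector.span B"
  shows "cblinfun_apply A v = 0"
proof -
  have "complex_vector.subspace {v. cblinfun_apply A v = 0}"
    by (simp add: complex_vector.subspace_def cblinfun_add_right cblinfun_scaleC_right)
  then have "complex_vector.span B \<subseteq> {v. cblinfun_apply A v = 0}"
    using assms(1) by (intro complex_vector.span_minimal) auto
  then show ?thesis using assms(2) by auto
qed

text \<open>
  Induction on \<open>B\<close>: if \<open>g\<close> kills \<open>B\<close> and takes the value \<open>1\<close> at the new vector \<open>b\<close>, then a functional
  separating \<open>x - g x b\<close> from the span of \<open>B\<close> can be corrected by a multiple of \<open>g\<close> so that it also kills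
  \<open>b\<close>.
\<close>

lemma dual_separates_span:
  fixes x :: "'a::complex_normed_vector"
  assumes "finite B" "x \<notin> complex_vector.span B"
  shows "\<exists>f :: 'a dual. cblinfun_apply f x = 1 \<and> (\<forall>b\<in>B. cblinfun_apply f b = 0)"
  using assms
proof (induction B arbitrary: x rule: finite_induct)
  case empty
  then have "x \<noteq> 0" by auto
  then obtain f :: "'a dual" where "cblinfun_apply f x = 1" by (rule dual_separates)
  then show ?case by blast
next
  case (insert b B)
  show ?case
  proof (cases "b \<in> complex_vector.span B")
    case True
    then have "x \<notin> complex_vector.span B"
      using insert.prems complex_vector.span_redundant[OF True] by simp
    then obtain f :: "'a dual" where f: "cblinfun_apply f x = 1" "\<forall>b\<in>B. cblinfun_apply f b = 0"
      using insert.IH by blast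
    have "cblinfun_apply f b = 0"
      by (rule cblinfun_zero_on_span[OF _ True]) (use f in auto)
    then show ?thesis using f by auto
  next
    case False
    then obtain g :: "'a dual" where g: "cblinfun_apply g b = 1" "\<forall>b\<in>B. cblinfun_apply g b = 0"
      using insert.IH by blast
    have "x - cblinfun_apply g x *\<^sub>C b \<notin> complex_vector.span B"
      using insert.prems complex_vector.span_breakdown_eq[of x b B] by blast
    then obtain f :: "'a dual" where f: "cblinfun_apply f (x - cblinfun_apply g x *\<^sub>C b) = 1"
      "\<forall>b\<in>B. cblinfun_apply f b = 0"
      using insert.IH by blast
    let ?h = "f - cblinfun_apply f b *\<^sub>C g"
    have "cblinfun_apply ?h x = 1"
      using f(1) by (simp add: cblinfun_diff_left cblinfun_diff_right cblinfun_apply_scaleC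
          cblinfun_scaleC_right algebra_simps)
    moreover have "\<forall>c\<in>insert b B. cblinfun_apply ?h c = 0"
      using f g by (simp add: cblinfun_diff_left cblinfun_apply_scaleC)
    ultimately show ?thesis by blast
  qed
qed

text \<open>
  Vectors and functionals are chosen together. A new vector outside the span of the previous
  ones is first projected into the common kernel of the previous functionals; it stays outside
  that span, so a functional killing the previous vectors can be normalised at it.
\<close>

lemma biorthogonal_sequence:
  assumes "\<not> finite_dimensional (UNIV :: 'a::complex_normed_vector set)"
  obtains x :: "nat \<Rightarrow> 'a::complex_normed_vector" and f :: "nat \<Rightarrow> 'a dual"
  where "\<And>i j. cblinfun_apply (f i) (x j) = (if i = j then 1 else 0)"
proof -
  define P where "P F n p \<longleftrightarrow> cblinfun_apply (snd p) (fst p) = 1 \<and>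
      (\<forall>i<n. cblinfun_apply (snd (F i)) (fst p) = 0 \<and> cblinfun_apply (snd p) (fst (F i)) = 0)"
    for F :: "nat \<Rightarrow> 'a \<times> 'a dual" and n and p :: "'a \<times> 'a dual"
  have "\<exists>F. \<forall>n. P F n (F n)"
  proof (rule dependent_wf_choice[OF wf_less_than])
    show "P F n p = P G n p" if "\<And>i. (i, n) \<in> less_than \<Longrightarrow> F i = G i" for F G n p
      using that by (auto simp: P_def)
  next
    fix n F assume IH: "\<And>i. (i, n) \<in> less_than \<Longrightarrow> P F i (F i)"
    have bi: "cblinfun_apply (snd (F i)) (fst (F j)) = (if i = j then 1 else 0)"
      if "i < n" "j < n" for i j
      using IH[of i] IH[of j] that by (cases i j rule: linorder_cases) (auto simp: P_def)
    define B where "B = (\<lambda>i. fst (F i)) ` {..<n}"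
    have B: "finite B" by (simp add: B_def)
    then obtain y where y: "y \<notin> complex_vector.span B"
      using assms by (auto simp: finite_dimensional_def)
    define x where "x = y - (\<Sum>i<n. cblinfun_apply (snd (F i)) y *\<^sub>C fst (F i))"
    have sum: "(\<Sum>i<n. cblinfun_apply (snd (F i)) y *\<^sub>C fst (F i)) \<in> complex_vector.span B"
      unfolding B_def
      by (intro complex_vector.span_sum complex_vector.span_scale complex_vector.span_base) auto
    have "x \<notin> complex_vector.span B"
      using y complex_vector.span_add[OF _ sum, of x] by (auto simp: x_def)
    then obtain f :: "'a dual" where f: "cblinfun_apply f x = 1" "\<forall>b\<in>B. cblinfun_apply f b = 0"
      using dual_separates_span[OF B] by blast
    have "cblinfun_apply (snd (F i)) x = 0" if "i < n" for i
      using that by (simp add: x_def cblinfun_diff_right cblinfun_sum_right cblinfun_scaleC_right bi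
          if_distrib[of "\<lambda>c. _ * c"] cong: if_cong)
    then have "P F n (x, f)" using f by (auto simp: P_def B_def)
    then show "\<exists>p. P F n p" ..
  qed
  then obtain F where F: "\<And>n. P F n (F n)" by blast
  show thesis
  proof (rule that[of "\<lambda>i. snd (F i)" "\<lambda>i. fst (F i)"])
    fix i j show "cblinfun_apply (snd (F i)) (fst (F j)) = (if i = j then 1 else 0)"
      using F[of i] F[of j] by (cases i j rule: linorder_cases) (auto simp: P_def)
  qed
qed

section \<open>The closed graph theorem\<close>

text \<open>
  By Baire's theorem the closure of some \<open>{x. norm (T x) \<le> n}\<close> contains a ball. After centring the
  ball at \<open>0\<close>, every \<open>x\<close> is approximated to any accuracy by some \<open>u\<close> with \<open>norm (T u) \<le> K * norm x\<close>.
  Repeating this for the remainders writes \<open>x\<close> as a series \<open>\<Sum> u k\<close> whose image converges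
  absolutely, and the closed graph identifies the sum of the images with \<open>T x\<close>.
\<close>

lemma closed_graph:
  fixes T :: "'a::banach \<Rightarrow> 'b::banach"
  assumes lin: "linear T"
    and graph: "\<And>X x y. X \<longlonglongrightarrow> x \<Longrightarrow> (\<lambda>n. T (X n)) \<longlonglongrightarrow> y \<Longrightarrow> T x = y"
  shows "bounded_linear T"
proof -
  define V where "V n = closure {x. norm (T x) \<le> real n}" for n
  have "\<exists>n. interior (V n) \<noteq> {}"
  proof (rule ccontr)
    assume "\<not> ?thesis"
    then have "(euclidean :: 'a topology) interior_of (\<Union>(range V)) = {}"
      by (intro Baire_category_alt disjI1 completely_metrizable_space_euclidean)
         (auto simp: V_def simp del: interior_closure)
    moreover have "x \<in> \<Union>(range V)" for x
    proof -
      obtain n where "norm (T x) \<le> real n" using real_arch_simple by blast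
      then have "x \<in> V n" unfolding V_def by (intro subsetD[OF closure_subset]) simp
      then show ?thesis by (rule UN_I[OF UNIV_I])
    qed
    then have "\<Union>(range V) = UNIV" by (rule UNIV_eq_I[symmetric])
    ultimately show False by simp
  qed
  then obtain n z where "z \<in> interior (V n)" by blast
  then obtain r where r: "r > 0" "ball z r \<subseteq> V n" by (auto simp: mem_interior)
  define K where "K = 2 * real n / r"
  have K: "K \<ge> 0" using r by (simp add: K_def)
  have approx: "\<exists>u. norm (x - u) < \<epsilon> \<and> norm (T u) \<le> K * norm x" if "\<epsilon> > 0" for x \<epsilon>
  proof (cases "x = 0")
    case True
    then show ?thesis using that linear_0[OF lin] by (intro exI[of _ 0]) auto
  next
    case False
    define s where "s = r / (2 * norm x)"
    have s: "s > 0" "s * norm x = r / 2" using False r by (auto simp: s_def)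
    have "z + s *\<^sub>R x \<in> ball z r" "z - s *\<^sub>R x \<in> ball z r"
      using s r by (auto simp: dist_norm)
    then have "z + s *\<^sub>R x \<in> V n" "z - s *\<^sub>R x \<in> V n" using r by auto
    moreover have "s * \<epsilon> > 0" using s that by simp
    ultimately obtain a b where a: "norm (T a) \<le> real n" "dist a (z + s *\<^sub>R x) < s * \<epsilon>"
      and b: "norm (T b) \<le> real n" "dist b (z - s *\<^sub>R x) < s * \<epsilon>"
      unfolding V_def closure_approachable by (smt (verit, del_insts) mem_Collect_eq)
    define u where "u = (1 / (2 * s)) *\<^sub>R (a - b)"
    define p q where "p = (z + s *\<^sub>R x) - a" and "q = (z - s *\<^sub>R x) - b"
    have "p - q = (s *\<^sub>R x + s *\<^sub>R x) - (a - b)"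
      by (simp add: p_def q_def)
    also have "s *\<^sub>R x + s *\<^sub>R x = (2 * s) *\<^sub>R x"
      by (simp only: mult_2 scaleR_add_left)
    finally have "x - u = (1 / (2 * s)) *\<^sub>R (p - q)"
      using s by (simp add: u_def scaleR_diff_right)
    then have "norm (x - u) = (1 / (2 * s)) * norm (p - q)"
      using s by simp
    also have "\<dots> \<le> (1 / (2 * s)) * (norm p + norm q)"
      using s by (intro mult_left_mono norm_triangle_ineq4) auto
    also have "\<dots> < (1 / (2 * s)) * (s * \<epsilon> + s * \<epsilon>)"
    proof (intro mult_strict_left_mono add_strict_mono)
      show "norm p < s * \<epsilon>" "norm q < s * \<epsilon>"
        using a(2) b(2) by (simp_all only: p_def q_def dist_norm norm_minus_commute[of a] norm_minus_commute[of b])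
    qed (use s in simp)
    also have "\<dots> = \<epsilon>" using s by simp
    finally have 1: "norm (x - u) < \<epsilon>" .
    have "norm (T u) = (1 / (2 * s)) * norm (T a - T b)"
      using s by (simp add: u_def linear_cmul[OF lin] linear_diff[OF lin])
    also have "\<dots> \<le> (1 / (2 * s)) * (real n + real n)"
      using s a b norm_triangle_ineq4[of "T a" "T b"] by (intro mult_left_mono) auto
    also have "\<dots> = K * norm x" using False r by (simp add: s_def K_def field_simps)
    finally show ?thesis using 1 by blast
  qed
  define U where "U x \<epsilon> = (SOME u. norm (x - u) < \<epsilon> \<and> norm (T u) \<le> K * norm x)" for x \<epsilon>
  have U: "norm (x - U x \<epsilon>) < \<epsilon>" "norm (T (U x \<epsilon>)) \<le> K * norm x" if "\<epsilon> > 0" for x \<epsilon>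
    using someI_ex[OF approx[OF that, of x]] by (simp_all add: U_def)
  have "norm (T x) \<le> norm x * (2 * K)" for x
  proof (cases "x = 0")
    case False
    define e where "e k = norm x * (1/2) ^ k" for k
    have e: "e k > 0" for k using False by (simp add: e_def)
    define X where "X = rec_nat x (\<lambda>k y. y - U y (e (Suc k)))"
    define u where "u k = U (X k) (e (Suc k))" for k
    have X: "X 0 = x" "X (Suc k) = X k - u k" for k by (simp_all add: X_def u_def)
    have Xe: "norm (X k) \<le> e k" for k
    proof (cases k)
      case (Suc j)
      then show ?thesis using U(1)[OF e[of k], of "X j"] by (simp add: X u_def)
    qed (simp add: X e_def)
    have Tu: "norm (T (u k)) \<le> K * e k" for k
      unfolding u_def using U(2)[OF e] mult_left_mono[OF Xe K] by (rule order_trans)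
    have e_sums: "(\<lambda>k. K * e k) sums (K * (norm x * 2))"
      unfolding e_def using geometric_sums[of "1/2 :: real"] by (intro sums_mult) simp
    have summ: "summable (\<lambda>k. norm (T (u k)))"
      using Tu by (intro summable_comparison_test'[OF sums_summable[OF e_sums], of 0]) simp
    define S where "S m = (\<Sum>k<m. u k)" for m
    have S: "S m = x - X m" for m
      by (induction m) (simp_all add: S_def X)
    have "e \<longlonglongrightarrow> 0"
      unfolding e_def by (intro tendsto_mult_right_zero LIMSEQ_power_zero) simp
    then have "X \<longlonglongrightarrow> 0"
      using Xe by (intro Lim_null_comparison[of X e] always_eventually) auto
    then have "S \<longlonglongrightarrow> x"
      using tendsto_diff[OF tendsto_const[of x], of X 0] by (simp add: S[abs_def])
    moreover have "(\<lambda>m. T (S m)) \<longlonglongrightarrow> (\<Sum>k. T (u k))"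
      using summable_LIMSEQ[OF summable_norm_cancel[OF summ]]
      by (simp add: S_def linear_sum[OF lin])
    ultimately have "T x = (\<Sum>k. T (u k))" by (rule graph)
    also have "norm \<dots> \<le> (\<Sum>k. norm (T (u k)))" by (rule summable_norm[OF summ])
    also have "\<dots> \<le> (\<Sum>k. K * e k)"
      by (rule suminf_le[OF Tu summ sums_summable[OF e_sums]])
    also have "\<dots> = K * (norm x * 2)" using e_sums by (simp add: sums_iff)
    finally show ?thesis by (simp add: algebra_simps)
  qed (simp add: linear_0[OF lin])
  then show ?thesis
    by (intro bounded_linear_intro[of T "2 * K"]) (simp_all add: linear_add[OF lin] linear_cmul[OF lin])
qed

section \<open>Rank-one operators\<close>

definition rank_one :: "'b::complex_normed_vector \<Rightarrow> 'a::complex_normed_vector dual \<Rightarrow> ('a \<Rightarrow>\<^sub>C 'b)" where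
  "rank_one y f = cblin (\<lambda>x. cblinfun_apply f x *\<^sub>C y)"

lemma rank_one_apply [simp]: "cblinfun_apply (rank_one y f) x = cblinfun_apply f x *\<^sub>C y"
proof -
  have "bounded_clinear (\<lambda>x. cblinfun_apply f x *\<^sub>C y)"
  proof (rule bounded_clinearI[where K = "norm f * norm y"])
    show "norm (cblinfun_apply f x *\<^sub>C y) \<le> norm f * norm y * norm x" for x
      using mult_right_mono[OF cblinfun_norm[of f x] norm_ge_zero[of y]] by (simp add: norm_scaleC mult_ac)
  qed (simp_all add: cblinfun_add_right cblinfun_scaleC_right scaleC_add_left scaleC_scaleC)
  then show ?thesis by (simp add: rank_one_def cblin_apply)
qed

lemma finite_rank_rank_one: "finite_rank (rank_one y f)"
  unfolding finite_rank_def finite_dimensional_def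
  by (rule exI[of _ "{y}"]) (auto intro: complex_vector.span_scale complex_vector.span_base)

lemma compose_rank_one: "A o\<^sub>C rank_one y f = rank_one (cblinfun_apply A y) f"
  by (rule cblinfun_eqI) (simp add: cblinfun_apply_compose cblinfun_scaleC_right)

lemma rank_one_add_left: "rank_one (y + z) f = rank_one y f + rank_one z f"
  by (rule cblinfun_eqI) (simp add: cblinfun_apply_add scaleC_add_right)

lemma standard_rank_one: "standard_operator_algebra \<A> \<Longrightarrow> rank_one y f \<in> \<A>"
  using finite_rank_rank_one[of y f] by (auto simp: standard_operator_algebra_def)

lemma in_span_singleton: "x \<in> complex_vector.span {y} \<longleftrightarrow> (\<exists>c. x = c *\<^sub>C y)"
  by (auto simp: complex_vector.span_singleton)

section \<open>Locally bounded automorphisms of the complex numbers\<close>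

text \<open>
  If \<open>norm c < 1\<close> then the powers of \<open>c\<close> tend to \<open>0\<close>, where \<open>h\<close> is bounded; so the powers of
  \<open>h c\<close> are bounded and \<open>norm (h c) \<le> 1\<close>. Scaling by rationals, which \<open>h\<close> fixes, gives
  \<open>norm (h c) \<le> norm c\<close>. Hence \<open>h\<close> is continuous and fixes the reals, and only the choice of
  \<open>h \<i>\<close> among the square roots of \<open>-1\<close> remains.
\<close>

lemma automorphism_locally_bounded:
  fixes h :: "complex \<Rightarrow> complex"
  assumes add: "\<And>a b. h (a + b) = h a + h b" and mult: "\<And>a b. h (a * b) = h a * h b"
    and one: "h 1 = 1"
    and bounded: "\<epsilon> > 0" "\<And>c. norm c < \<epsilon> \<Longrightarrow> norm (h c) \<le> M"
  shows "(\<forall>c. h c = c) \<or> (\<forall>c. h c = cnj c)"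
proof -
  have zero: "h 0 = 0" using add[of 0 0] by simp
  have minus: "h (- a) = - h a" for a
    using add[of "- a" a] zero by (simp add: eq_neg_iff_add_eq_0)
  have diff: "h (a - b) = h a - h b" for a b
    using add[of a "- b"] minus[of b] by simp
  have power: "h (a ^ n) = h a ^ n" for a n
    by (induction n) (simp_all add: one mult)
  have nat: "h (of_nat n) = of_nat n" for n
    by (induction n) (simp_all add: zero add one)
  have int: "h (of_int n) = of_int n" for n
    by (cases n rule: int_cases2) (simp_all add: nat minus)
  have rat: "h (complex_of_real (of_rat q)) = complex_of_real (of_rat q)" for q
  proof -
    obtain a b where q: "q = Fract a b" "b > 0" by (cases q) auto
    let ?r = "complex_of_real (of_rat q)"
    have r: "?r * of_int b = of_int a" using q by (simp add: of_rat_rat)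
    have "h ?r * of_int b = h (?r * of_int b)" by (simp only: mult int)
    also have "\<dots> = ?r * of_int b" by (simp only: r int)
    finally show ?thesis using q(2) by simp
  qed
  have le1: "norm (h c) \<le> 1" if c: "norm c < 1" for c
  proof (rule ccontr)
    assume "\<not> norm (h c) \<le> 1"
    then have "norm (h c) > 1" by simp
    then obtain k where k: "M < norm (h c) ^ k" using real_arch_pow by blast
    have "norm (h c) ^ n > M" if "n \<ge> k" for n
      using k power_increasing[OF that, of "norm (h c)"] \<open>norm (h c) > 1\<close> by linarith
    then have "eventually (\<lambda>n. norm (h c) ^ n > M) sequentially"
      by (rule eventually_sequentiallyI)
    moreover have "(\<lambda>n. norm c ^ n) \<longlonglongrightarrow> 0"
      using c by (intro LIMSEQ_power_zero) simp
    then have "eventually (\<lambda>n. norm c ^ n < \<epsilon>) sequentially"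
      using bounded(1) by (rule order_tendstoD)
    ultimately have "eventually (\<lambda>n. norm (h c) ^ n > M \<and> norm c ^ n < \<epsilon>) sequentially"
      by (rule eventually_conj)
    then obtain n where n: "norm (h c) ^ n > M" "norm c ^ n < \<epsilon>"
      using eventually_happens'[OF sequentially_bot] by blast
    then show False using bounded(2)[of "c ^ n"] by (simp add: power norm_power)
  qed
  have contract: "norm (h c) \<le> norm c" for c
  proof (rule ccontr)
    assume "\<not> norm (h c) \<le> norm c"
    then obtain q where q: "norm c < of_rat q" "of_rat q < norm (h c)"
      using of_rat_dense[of "norm c" "norm (h c)"] by auto
    let ?q = "complex_of_real (of_rat q)"
    have pos: "(of_rat q :: real) > 0" using q(1) norm_ge_zero[of c] by linarith
    then have "norm (h (c / ?q)) \<le> 1"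
      using q by (intro le1) (simp add: norm_divide)
    then have "norm (h (c / ?q)) * of_rat q \<le> 1 * of_rat q"
      using pos by (intro mult_right_mono) auto
    moreover have "norm (h c) = norm (h (c / ?q)) * of_rat q"
    proof -
      have "c = c / ?q * ?q" using pos by simp
      then have "h c = h (c / ?q) * ?q" using mult[of "c / ?q" ?q] rat by metis
      then show ?thesis using pos by (simp add: norm_mult)
    qed
    ultimately show False using q by simp
  qed
  have real: "h (complex_of_real t) = complex_of_real t" for t
  proof (rule ccontr)
    assume ne: "\<not> ?thesis"
    define \<delta> where "\<delta> = norm (h (complex_of_real t) - complex_of_real t)"
    have "\<delta> > 0" using ne by (simp add: \<delta>_def)
    then obtain q where q: "t < of_rat q" "of_rat q < t + \<delta> / 2"
      using of_rat_dense[of t "t + \<delta> / 2"] by auto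
    let ?q = "complex_of_real (of_rat q)"
    have *: "norm (complex_of_real t - ?q) < \<delta> / 2"
    proof -
      have "norm (complex_of_real t - ?q) = \<bar>t - of_rat q\<bar>"
        by (simp only: of_real_diff[symmetric] norm_of_real)
      then show ?thesis using q by simp
    qed
    have "h (complex_of_real t) - complex_of_real t = h (complex_of_real t - ?q) - (complex_of_real t - ?q)"
      by (simp add: diff rat)
    then have "\<delta> \<le> norm (h (complex_of_real t - ?q)) + norm (complex_of_real t - ?q)"
      unfolding \<delta>_def by (simp only: norm_triangle_ineq4)
    then show False using * contract[of "complex_of_real t - ?q"] by simp
  qed
  have "h \<i> * h \<i> = - 1" using mult[of \<i> \<i>] minus[of 1] one by simp
  then have "(h \<i> - \<i>) * (h \<i> + \<i>) = 0" by (simp add: algebra_simps)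
  then have i: "h \<i> = \<i> \<or> h \<i> = - \<i>" by (auto simp: eq_neg_iff_add_eq_0)
  have form: "h c = complex_of_real (Re c) + h \<i> * complex_of_real (Im c)" for c
  proof -
    have "h (complex_of_real (Re c) + \<i> * complex_of_real (Im c))
        = complex_of_real (Re c) + h \<i> * complex_of_real (Im c)"
      by (simp only: add mult real)
    then show ?thesis by (simp only: complex_eq[symmetric])
  qed
  from i show ?thesis
  proof
    assume "h \<i> = \<i>"
    then have "h c = c" for c using form[of c] by (simp add: complex_eq[symmetric])
    then show ?thesis by blast
  next
    assume "h \<i> = - \<i>"
    then have "h c = cnj c" for c using form[of c] by (simp add: complex_eq_iff)
    then show ?thesis by blast
  qed
qed

section \<open>Semilinear intertwiners of operator ring isomorphisms\<close>

text \<open>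
  The algebra \<open>\<C>\<close> is only asked to contain the rank-one operators whose functional lies in \<open>W\<close>.
  This covers a standard operator algebra on \<open>X\<close>, with all functionals, and also the algebra of
  adjoints of such operators. The latter acts on the dual of \<open>X\<close>, but among the functionals on
  that dual its rank-one elements involve only the evaluations at points of \<open>X\<close>.
\<close>

locale operator_ring_iso =
  fixes \<C> :: "('z::complex_banach \<Rightarrow>\<^sub>C 'z) set" and W :: "'z dual set"
    and \<B> :: "('y::complex_banach \<Rightarrow>\<^sub>C 'y) set" and \<psi> :: "('z \<Rightarrow>\<^sub>C 'z) \<Rightarrow> ('y \<Rightarrow>\<^sub>C 'y)"
  assumes nontrivial: "\<exists>z::'z. z \<noteq> 0"
    and W_separates: "\<And>x z. z \<notin> complex_vector.span {x} \<Longrightarrow>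
      \<exists>w\<in>W. cblinfun_apply w x = 0 \<and> cblinfun_apply w z \<noteq> 0"
    and rank_one_C: "\<And>z w. w \<in> W \<Longrightarrow> rank_one z w \<in> \<C>"
    and rank_one_B: "\<And>y g. rank_one y g \<in> \<B>"
    and bij_psi: "bij_betw \<psi> \<C> \<B>"
    and psi_add: "\<And>A B. A \<in> \<C> \<Longrightarrow> B \<in> \<C> \<Longrightarrow> \<psi> (A + B) = \<psi> A + \<psi> B"
    and psi_mult: "\<And>A B. A \<in> \<C> \<Longrightarrow> B \<in> \<C> \<Longrightarrow> \<psi> (A o\<^sub>C B) = \<psi> A o\<^sub>C \<psi> B"
begin

lemma W_nonzero:
  assumes "z \<noteq> 0"
  obtains w where "w \<in> W" "cblinfun_apply w z \<noteq> 0"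
  using W_separates[of z 0] assms by auto

text \<open>
  For a rank-one idempotent \<open>P = rank_one x0 w0\<close> and a vector \<open>y0\<close> fixed by \<open>\<psi> P\<close>, the operators
  \<open>rank_one z w0\<close> form a copy of the space \<open>'z\<close> on which \<open>\<C>\<close> acts by left multiplication; so
  \<open>T z = \<psi> (rank_one z w0) y0\<close> intertwines the two actions. Two vectors are linearly dependent iff every
  operator of the algebra that kills the first one also kills the second one, provided the first one is not zero.
  Both algebras detect this, hence \<open>T\<close> maps complex lines onto complex lines.
  On the line through \<open>x0\<close> it induces a field automorphism, and multiplying by
  \<open>rank_one z w0\<close> shows that every other line has the same automorphism.
\<close>

theorem semilinear_intertwiner:
  "\<exists>(T :: 'z \<Rightarrow> 'y) h. bij T \<and> (\<forall>x y. T (x + y) = T x + T y) \<and>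
    (\<forall>c x. T (c *\<^sub>C x) = h c *\<^sub>C T x) \<and> ring_automorphism h \<and>
    (\<forall>A\<in>\<C>. \<forall>x. cblinfun_apply (\<psi> A) (T x) = T (cblinfun_apply A x))"
proof -
  obtain z0 :: 'z where "z0 \<noteq> 0" using nontrivial by auto
  then obtain w0 where w0: "w0 \<in> W" "cblinfun_apply w0 z0 \<noteq> 0" by (rule W_nonzero)
  \<comment> \<open>rescaling makes \<open>rank_one x0 w0\<close> idempotent\<close>
  define x0 where "x0 = (1 / cblinfun_apply w0 z0) *\<^sub>C z0"
  have x0: "cblinfun_apply w0 x0 = 1"
    using w0 by (simp add: x0_def cblinfun_scaleC_right)
  then have x0_nz: "x0 \<noteq> 0" by auto
  let ?P = "rank_one x0 w0"
  have R: "rank_one z w0 \<in> \<C>" for z using w0(1) by (rule rank_one_C)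
  have zero_C: "0 \<in> \<C>"
  proof -
    have "rank_one 0 w0 = (0 :: 'z \<Rightarrow>\<^sub>C 'z)" by (rule cblinfun_eqI) simp
    then show ?thesis using R[of 0] by simp
  qed
  have psi_0: "\<psi> 0 = 0" using psi_add[OF zero_C zero_C] by simp
  have "?P \<noteq> 0"
  proof
    assume "?P = 0"
    then have "cblinfun_apply ?P x0 = 0" by simp
    then show False using x0 x0_nz by simp
  qed
  then have "\<psi> ?P \<noteq> 0"
    using bij_psi zero_C R[of x0] psi_0 by (metis bij_betw_inv_into_left)
  then obtain v where v: "cblinfun_apply (\<psi> ?P) v \<noteq> 0"
    using cblinfun_eqI[of "\<psi> ?P" 0] by auto
  define y0 where "y0 = cblinfun_apply (\<psi> ?P) v"
  have y0_nz: "y0 \<noteq> 0" using v by (simp add: y0_def)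
  have apply_mult: "cblinfun_apply (\<psi> (A o\<^sub>C B)) y = cblinfun_apply (\<psi> A) (cblinfun_apply (\<psi> B) y)"
    if "A \<in> \<C>" "B \<in> \<C>" for A B y
    using psi_mult[OF that] by (simp add: cblinfun_apply_compose)
  define T where "T z = cblinfun_apply (\<psi> (rank_one z w0)) y0" for z
  have T_x0: "T x0 = y0"
    using apply_mult[OF R R, of x0 x0 v] x0 by (simp add: T_def y0_def compose_rank_one)
  have T_add: "T (x + y) = T x + T y" for x y
    by (simp add: T_def rank_one_add_left psi_add[OF R R] cblinfun_apply_add)
  have T_int: "cblinfun_apply (\<psi> A) (T x) = T (cblinfun_apply A x)" if "A \<in> \<C>" for A x
    using apply_mult[OF that R, of x y0] by (simp add: T_def compose_rank_one)
  have T_0: "T 0 = 0" using T_add[of 0 0] by simp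
  have T_diff: "T (x - y) = T x - T y" for x y
    using T_add[of "x - y" y] by simp
  have ker: "z = 0" if "T z = 0" for z
  proof (rule ccontr)
    assume "z \<noteq> 0"
    then obtain w where w: "w \<in> W" "cblinfun_apply w z \<noteq> 0" by (rule W_nonzero)
    let ?A = "rank_one ((1 / cblinfun_apply w z) *\<^sub>C x0) w"
    have "cblinfun_apply ?A z = x0" using w by (simp add: scaleC_scaleC)
    then have "y0 = cblinfun_apply (\<psi> ?A) (T z)"
      using T_int[OF rank_one_C[OF w(1)]] T_x0 by metis
    then show False using y0_nz that by simp
  qed
  have inj: "inj T"
    using ker T_diff by (metis (no_types, lifting) eq_iff_diff_eq_0 injI)
  have obtain_B: "\<exists>A\<in>\<C>. \<psi> A = rank_one y g" for y g
    using bij_psi rank_one_B[of y g] by (metis bij_betw_def imageE)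
  have surj: "surj T"
    unfolding surj_def
  proof
    fix y
    obtain g :: "'y dual" where g: "cblinfun_apply g y0 = 1" using y0_nz by (rule dual_separates)
    obtain A where "A \<in> \<C>" "\<psi> A = rank_one y g" using obtain_B by blast
    then have "T (cblinfun_apply A x0) = y" using T_int[of A x0] T_x0 g by simp
    then show "\<exists>x. y = T x" by metis
  qed
  have line: "\<exists>d. T (c *\<^sub>C z) = d *\<^sub>C T z" for c z
  proof (rule ccontr)
    assume "\<not> ?thesis"
    then have "T (c *\<^sub>C z) \<notin> complex_vector.span {T z}" by (simp add: in_span_singleton)
    then obtain g :: "'y dual" where g: "cblinfun_apply g (T (c *\<^sub>C z)) = 1" "cblinfun_apply g (T z) = 0"
      using dual_separates_span[of "{T z}" "T (c *\<^sub>C z)"] by auto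
    obtain A where A: "A \<in> \<C>" "\<psi> A = rank_one y0 g" using obtain_B by blast
    have "T (cblinfun_apply A z) = 0" using T_int[OF A(1), of z] A(2) g by simp
    then have "cblinfun_apply A (c *\<^sub>C z) = 0" using ker by (simp add: cblinfun_scaleC_right)
    then have "cblinfun_apply (\<psi> A) (T (c *\<^sub>C z)) = 0" using T_int[OF A(1)] T_0 by simp
    then show False using A(2) g y0_nz by simp
  qed
  have line': "\<exists>c. z' = c *\<^sub>C z" if "T z' = d *\<^sub>C T z" for z z' d
  proof (rule ccontr)
    assume "\<not> ?thesis"
    then have "z' \<notin> complex_vector.span {z}" by (simp add: in_span_singleton)
    then obtain w where w: "w \<in> W" "cblinfun_apply w z = 0" "cblinfun_apply w z' \<noteq> 0"
      using W_separates by blast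
    let ?A = "rank_one x0 w"
    have "cblinfun_apply (\<psi> ?A) (T z) = 0"
      using T_int[OF rank_one_C[OF w(1)], of x0 z] w T_0 by simp
    then have "T (cblinfun_apply ?A z') = 0"
      using T_int[OF rank_one_C[OF w(1)], of x0 z'] that by (simp add: cblinfun_scaleC_right)
    then have "cblinfun_apply ?A z' = 0" by (rule ker)
    then show False using w x0_nz by simp
  qed
  define h where "h c = (SOME d. T (c *\<^sub>C x0) = d *\<^sub>C T x0)" for c
  have h0: "T (c *\<^sub>C x0) = h c *\<^sub>C y0" for c
    using someI_ex[OF line[of c x0]] by (simp add: h_def T_x0)
  have T_scale: "T (c *\<^sub>C z) = h c *\<^sub>C T z" for c z
  proof -
    have "T (c *\<^sub>C z) = T (cblinfun_apply (rank_one z w0) (c *\<^sub>C x0))"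
      by (simp add: cblinfun_scaleC_right x0)
    also have "\<dots> = cblinfun_apply (\<psi> (rank_one z w0)) (h c *\<^sub>C y0)"
      using T_int[OF R, of z "c *\<^sub>C x0"] h0[of c] by (simp del: rank_one_apply)
    finally show ?thesis by (simp add: T_def cblinfun_scaleC_right)
  qed
  have cancel: "a = b" if "a *\<^sub>C y0 = b *\<^sub>C y0" for a b
    using that y0_nz by simp
  have h_add: "h (a + b) = h a + h b" for a b
    by (rule cancel) (simp add: h0[symmetric] scaleC_add_left T_add)
  have h_mult: "h (a * b) = h a * h b" for a b
  proof (rule cancel)
    have "h (a * b) *\<^sub>C y0 = T (a *\<^sub>C (b *\<^sub>C x0))" by (simp add: h0[symmetric] scaleC_scaleC)
    also have "\<dots> = h a *\<^sub>C (h b *\<^sub>C y0)" by (simp only: T_scale T_x0)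
    also have "\<dots> = (h a * h b) *\<^sub>C y0" by (rule scaleC_scaleC)
    finally show "h (a * b) *\<^sub>C y0 = (h a * h b) *\<^sub>C y0" .
  qed
  have h_one: "h 1 = 1"
    by (rule cancel) (simp add: h0[symmetric] T_x0)
  have h_zero: "h 0 = 0" using h_add[of 0 0] by simp
  have "inj h"
  proof (rule injI)
    fix a b assume "h a = h b"
    then have "T (a *\<^sub>C x0) = T (b *\<^sub>C x0)" by (simp add: h0)
    then have "a *\<^sub>C x0 = b *\<^sub>C x0" using inj by (simp add: inj_eq)
    then show "a = b" using x0_nz by simp
  qed
  moreover have "surj h"
    unfolding surj_def
  proof
    fix d
    obtain z where z: "T z = d *\<^sub>C T x0" using surj by (metis surjD)
    then obtain c where "z = c *\<^sub>C x0" using line' by blast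
    then have "h c *\<^sub>C y0 = d *\<^sub>C y0" using z h0 T_x0 by simp
    then show "\<exists>c. d = h c" using cancel by metis
  qed
  moreover have "comm_ring_hom h"
    by unfold_locales (simp_all add: h_add h_mult h_one h_zero)
  ultimately have "ring_automorphism h" by (simp add: ring_automorphism_def bij_def)
  moreover have "bij T" using inj surj by (simp add: bij_def)
  ultimately show ?thesis using T_add T_scale T_int by blast
qed

text \<open>
  Three steps. First, \<open>h \<circ> u \<circ> inv T\<close> is a bounded functional for every \<open>u\<close> in \<open>W\<close>: it is read off from
  the bounded operator \<open>\<psi> (rank_one x0 u)\<close>. Second, if \<open>h\<close> were unbounded near \<open>0\<close>, there would be
  coefficients \<open>c n\<close> so small that \<open>x = \<Sum> c n z n\<close> converges, while \<open>h (c n)\<close>, the value of the \<open>n\<close>-th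
  of these functionals at \<open>T x\<close>, exceeds \<open>n\<close> times its norm; this contradicts boundedness at the
  single vector \<open>T x\<close>. So \<open>h\<close> is the identity or the conjugation. Third, the functionals of the first
  step separate points and are continuous, hence the graph of \<open>T\<close> is closed.
\<close>

theorem bounded_intertwiner:
  fixes z :: "nat \<Rightarrow> 'z" and w :: "nat \<Rightarrow> 'z dual"
  assumes w_in: "\<And>i. w i \<in> W" and bi: "\<And>i j. cblinfun_apply (w i) (z j) = (if i = j then 1 else 0)"
  shows "(\<exists>T :: 'z \<Rightarrow> 'y. invertible_bounded_clinear T \<and>
      (\<forall>A\<in>\<C>. cblinfun_apply (\<psi> A) = T \<circ> cblinfun_apply A \<circ> inv_into UNIV T)) \<or>
    (\<exists>T :: 'z \<Rightarrow> 'y. invertible_bounded_antilinear T \<and>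
      (\<forall>A\<in>\<C>. cblinfun_apply (\<psi> A) = T \<circ> cblinfun_apply A \<circ> inv_into UNIV T))"
proof -
  obtain T :: "'z \<Rightarrow> 'y" and h where T: "bij T" "\<And>x y. T (x + y) = T x + T y"
    "\<And>c x. T (c *\<^sub>C x) = h c *\<^sub>C T x" and "ring_automorphism h"
    and T_int: "\<And>A x. A \<in> \<C> \<Longrightarrow> cblinfun_apply (\<psi> A) (T x) = T (cblinfun_apply A x)"
    using semilinear_intertwiner by blast
  then interpret h: comm_ring_hom h by (simp add: ring_automorphism_def)
  have "bij h" using \<open>ring_automorphism h\<close> by (simp add: ring_automorphism_def)
  have T_0: "T 0 = 0" using T(2)[of 0 0] by simp
  have functional: "\<exists>g :: 'y dual. \<forall>x. cblinfun_apply g (T x) = h (cblinfun_apply u x)"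
    if u: "u \<in> W" for u
  proof -
    obtain x0 :: 'z where "x0 \<noteq> 0" using nontrivial by auto
    then have "T x0 \<noteq> 0" using T_0 bij_is_inj[OF T(1)] by (metis injD)
    then obtain g :: "'y dual" where g: "cblinfun_apply g (T x0) = 1" by (rule dual_separates)
    have "cblinfun_apply (g o\<^sub>C \<psi> (rank_one x0 u)) (T x) = h (cblinfun_apply u x)" for x
      using T_int[OF rank_one_C[OF u]] g
      by (simp add: cblinfun_apply_compose T(3) cblinfun_scaleC_right)
    then show ?thesis by blast
  qed
  have bounded_near_0: "\<exists>\<epsilon> M. \<epsilon> > 0 \<and> (\<forall>c. norm c < \<epsilon> \<longrightarrow> norm (h c) \<le> M)"
  proof (rule ccontr)
    assume "\<not> ?thesis"
    then have "\<not> (\<forall>c. norm c < \<epsilon> \<longrightarrow> norm (h c) \<le> M)" if "\<epsilon> > 0" for \<epsilon> M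
      using that by blast
    then have unbounded: "\<exists>c. norm c < \<epsilon> \<and> norm (h c) > M" if "\<epsilon> > 0" for \<epsilon> M
      using that by (simp add: not_le)
    have "\<forall>n. \<exists>g :: 'y dual. \<forall>x. cblinfun_apply g (T x) = h (cblinfun_apply (w n) x)"
      using functional w_in by blast
    from choice[OF this] obtain g :: "nat \<Rightarrow> 'y dual"
      where g: "\<And>n x. cblinfun_apply (g n) (T x) = h (cblinfun_apply (w n) x)"
      by blast
    have "\<forall>n. \<exists>c. norm c < (1/2) ^ n / (1 + norm (z n)) \<and> norm (h c) > real n * (1 + norm (g n))"
      by (intro allI unbounded) (simp add: add_pos_nonneg)
    from choice[OF this] obtain c where c: "\<And>n. norm (c n) < (1/2) ^ n / (1 + norm (z n))"
      "\<And>n. norm (h (c n)) > real n * (1 + norm (g n))"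
      by blast
    have cz: "norm (c n *\<^sub>C z n) \<le> (1/2) ^ n" for n
    proof -
      have "norm (c n) * norm (z n) \<le> norm (c n) * (1 + norm (z n))"
        by (intro mult_left_mono) auto
      also have "\<dots> \<le> (1/2) ^ n"
        using c(1)[of n] by (simp add: pos_less_divide_eq add_pos_nonneg less_imp_le)
      finally show ?thesis by (simp add: norm_scaleC)
    qed
    have "summable (\<lambda>n. (1/2 :: real) ^ n)" by (rule summable_geometric) simp
    then have summ: "summable (\<lambda>n. c n *\<^sub>C z n)"
      by (rule summable_comparison_test'[where N = 0]) (rule cz)
    define x where "x = (\<Sum>n. c n *\<^sub>C z n)"
    have wx: "cblinfun_apply (w n) x = c n" for n
    proof -
      have "(\<lambda>k. cblinfun_apply (w n) (c k *\<^sub>C z k)) sums cblinfun_apply (w n) x"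
        unfolding x_def
        by (rule bounded_linear.sums[OF cblinfun_apply_bounded_linear summable_sums[OF summ]])
      moreover have "(\<lambda>k. cblinfun_apply (w n) (c k *\<^sub>C z k)) = (\<lambda>k. if k = n then c k else 0)"
        by (auto simp: cblinfun_scaleC_right bi)
      ultimately have "(\<lambda>k. if k = n then c k else 0) sums cblinfun_apply (w n) x"
        by simp
      then show ?thesis using sums_single[of n c] by (rule sums_unique2)
    qed
    have "real n \<le> norm (T x)" for n
    proof -
      have "real n * (1 + norm (g n)) < norm (h (c n))" by (rule c(2))
      also have "\<dots> = norm (cblinfun_apply (g n) (T x))" by (simp add: g wx)
      also have "\<dots> \<le> norm (g n) * norm (T x)" by (rule cblinfun_norm)
      also have "\<dots> \<le> norm (T x) * (1 + norm (g n))" by (simp add: algebra_simps)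
      finally show ?thesis
        by (simp add: add_pos_nonneg)
    qed
    moreover obtain n where "norm (T x) < real n" using reals_Archimedean2 by blast
    ultimately show False using leD by blast
  qed
  then have h_cases: "(\<forall>c. h c = c) \<or> (\<forall>c. h c = cnj c)"
    using automorphism_locally_bounded[of h] by (auto simp: h.hom_add h.hom_mult)
  then have h_real: "h (complex_of_real r) = complex_of_real r" for r by auto
  have h_cont: "(\<lambda>n. h (X n)) \<longlonglongrightarrow> h x" if "X \<longlonglongrightarrow> x" for X x
    using h_cases that by (auto intro: tendsto_cnj)
  have T_lin: "linear T"
  proof (rule linearI)
    show "T (r *\<^sub>R x) = r *\<^sub>R T x" for r x
      using T(3)[of "complex_of_real r" x] by (simp add: h_real scaleC_of_real)
  qed (rule T(2))
  have graph: "T x = y" if X: "X \<longlonglongrightarrow> x" "(\<lambda>n. T (X n)) \<longlonglongrightarrow> y" for X x y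
  proof (rule ccontr)
    assume "T x \<noteq> y"
    obtain u where u: "y = T u" using bij_is_surj[OF T(1)] by (metis surjD)
    then have "u - x \<noteq> 0" using \<open>T x \<noteq> y\<close> by auto
    then obtain v where v: "v \<in> W" "cblinfun_apply v (u - x) \<noteq> 0" by (rule W_nonzero)
    obtain g :: "'y dual" where g: "\<And>x. cblinfun_apply g (T x) = h (cblinfun_apply v x)"
      using functional[OF v(1)] by blast
    have "(\<lambda>n. cblinfun_apply g (T (X n))) \<longlonglongrightarrow> cblinfun_apply g y"
      by (rule bounded_linear.tendsto[OF cblinfun_apply_bounded_linear X(2)])
    moreover have "(\<lambda>n. cblinfun_apply g (T (X n))) \<longlonglongrightarrow> h (cblinfun_apply v x)"
      unfolding g by (intro h_cont bounded_linear.tendsto[OF cblinfun_apply_bounded_linear X(1)])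
    ultimately have "cblinfun_apply g y = h (cblinfun_apply v x)" by (rule LIMSEQ_unique)
    then have "h (cblinfun_apply v u) = h (cblinfun_apply v x)" by (simp add: u g)
    then have "cblinfun_apply v u = cblinfun_apply v x"
      using \<open>bij h\<close> by (simp add: bij_def inj_eq)
    then show False using v(2) by (simp add: cblinfun_diff_right)
  qed
  have bl: "bounded_linear T"
    by (rule closed_graph[OF T_lin]) (rule graph)
  let ?S = "inv_into UNIV T"
  have TS: "T (?S y) = y" "?S (T x) = x" for x y
    using T(1) by (simp_all add: bij_is_surj surj_f_inv_f bij_is_inj)
  have S_eq: "?S y = x" if "T x = y" for x y using that TS by auto
  have S_lin: "linear ?S"
    by (rule linearI) (rule S_eq, simp add: linear_add[OF T_lin] linear_cmul[OF T_lin] TS)+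
  have blS: "bounded_linear ?S"
  proof (rule closed_graph[OF S_lin])
    fix Y :: "nat \<Rightarrow> 'y" and y x assume "Y \<longlonglongrightarrow> y" "(\<lambda>n. ?S (Y n)) \<longlonglongrightarrow> x"
    then have "T x = y" by (intro graph[of "\<lambda>n. ?S (Y n)"]) (simp_all add: TS)
    then show "?S y = x" by (rule S_eq)
  qed
  have form: "cblinfun_apply (\<psi> A) = T \<circ> cblinfun_apply A \<circ> ?S" if "A \<in> \<C>" for A
  proof
    fix y
    have "cblinfun_apply (\<psi> A) y = cblinfun_apply (\<psi> A) (T (?S y))" by (simp only: TS)
    then show "cblinfun_apply (\<psi> A) y = (T \<circ> cblinfun_apply A \<circ> ?S) y" by (simp only: T_int[OF that] comp_def)
  qed
  from h_cases show ?thesis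
  proof
    assume h: "\<forall>c. h c = c"
    have "?S (c *\<^sub>C y) = c *\<^sub>C ?S y" for c y by (rule S_eq) (simp add: T(3) h TS)
    then have "invertible_bounded_clinear T"
      using bl blS T h by (simp add: invertible_bounded_clinear_def bounded_clinear_def)
    then show ?thesis using form by blast
  next
    assume h: "\<forall>c. h c = cnj c"
    have "?S (c *\<^sub>C y) = cnj c *\<^sub>C ?S y" for c y by (rule S_eq) (simp add: T(3) h TS)
    then have "invertible_bounded_antilinear T"
      using bl blS T h by (simp add: invertible_bounded_antilinear_def bounded_antilinear_def)
    then show ?thesis using form by blast
  qed
qed

end

section \<open>Standard operator algebras as prime algebras\<close>

lemma cblinfun_apply_scaleR: "cblinfun_apply (r *\<^sub>R f) x = r *\<^sub>R cblinfun_apply f x"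
  using cblinfun_apply_scaleC[of "complex_of_real r" f x] by (simp add: scaleC_of_real)

lemma cblinfun_scaleR_right: "cblinfun_apply f (r *\<^sub>R x) = r *\<^sub>R cblinfun_apply f x"
  using cblinfun_scaleC_right[of f "complex_of_real r" x] by (simp add: scaleC_of_real)

text \<open>
  A copy of the type of bounded operators on one space, on which composition can be the
  multiplication of a type class, so that the results on algebras apply.
\<close>

typedef (overloaded) 'a endo = "UNIV :: ('a::complex_normed_vector \<Rightarrow>\<^sub>C 'a) set"
  morphisms operator_of Endo
  by simp

setup_lifting type_definition_endo

instantiation endo :: (complex_normed_vector) real_algebra
begin

lift_definition zero_endo :: "'a endo" is 0 .
lift_definition plus_endo :: "'a endo \<Rightarrow> 'a endo \<Rightarrow> 'a endo" is "(+)" .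
lift_definition minus_endo :: "'a endo \<Rightarrow> 'a endo \<Rightarrow> 'a endo" is "(-)" .
lift_definition uminus_endo :: "'a endo \<Rightarrow> 'a endo" is uminus .
lift_definition scaleR_endo :: "real \<Rightarrow> 'a endo \<Rightarrow> 'a endo" is scaleR .
lift_definition times_endo :: "'a endo \<Rightarrow> 'a endo \<Rightarrow> 'a endo" is "(o\<^sub>C)" .

instance
  by (standard; transfer)
     (auto intro!: cblinfun_eqI simp: cblinfun_apply_compose cblinfun_apply_add cblinfun_add_right
       cblinfun_apply_scaleR cblinfun_scaleR_right algebra_simps)

end

lemma Endo_simps:
  "Endo A * Endo B = Endo (A o\<^sub>C B)" "Endo A + Endo B = Endo (A + B)" "r *\<^sub>R Endo A = Endo (r *\<^sub>R A)"
  "0 = Endo 0" "Endo A = Endo B \<longleftrightarrow> A = B" "operator_of (Endo A) = A"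
  by (simp_all add: times_endo.abs_eq plus_endo.abs_eq scaleR_endo.abs_eq zero_endo_def
      eq_onp_def Endo_inject Endo_inverse)

lemma scaleC_of_half: "(1/2) *\<^sub>C x = (1/2) *\<^sub>R (x :: 'a::complex_normed_vector)"
  using scaleC_of_real[of "1/2" x] by simp

text \<open>
  If \<open>A\<close> and \<open>B\<close> are not zero, a rank-one operator between them can carry a nonzero value of \<open>B\<close> to
  a vector at which \<open>A\<close> does not vanish.
\<close>

lemma prime_standard_operator_algebra:
  assumes "standard_operator_algebra \<A>"
  shows "prime_subalgebra (Endo ` \<A>)"
proof
  have sub: "complex_vector.subspace \<A>" and mult: "\<And>A B. A \<in> \<A> \<Longrightarrow> B \<in> \<A> \<Longrightarrow> A o\<^sub>C B \<in> \<A>"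
    using assms by (auto simp: standard_operator_algebra_def)
  have scaleR: "r *\<^sub>R A \<in> \<A>" if "A \<in> \<A>" for r A
    using complex_vector.subspace_scale[OF sub that, of "complex_of_real r"] by (simp add: scaleC_of_real)
  show "subspace (Endo ` \<A>)"
    unfolding subspace_def
    by (auto simp: Endo_simps intro!: imageI complex_vector.subspace_0[OF sub]
        complex_vector.subspace_add[OF sub] scaleR)
  fix x y assume xy: "x \<in> Endo ` \<A>" "y \<in> Endo ` \<A>"
  then show "x * y \<in> Endo ` \<A>" by (auto simp: Endo_simps mult)
  assume zero: "\<And>r. r \<in> Endo ` \<A> \<Longrightarrow> x * r * y = 0"
  obtain A B where AB: "x = Endo A" "y = Endo B" using xy by auto
  show "x = 0 \<or> y = 0"
  proof (rule ccontr)
    assume "\<not> (x = 0 \<or> y = 0)"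
    then have "A \<noteq> 0" "B \<noteq> 0" by (auto simp: AB Endo_simps)
    then obtain u v where u: "cblinfun_apply A u \<noteq> 0" and v: "cblinfun_apply B v \<noteq> 0"
      by (metis cblinfun_eqI cblinfun_zero_left)
    obtain g :: "'a dual" where g: "cblinfun_apply g (cblinfun_apply B v) = 1"
      using v by (rule dual_separates)
    have "x * Endo (rank_one u g) * y = 0"
      using standard_rank_one[OF assms] by (intro zero) auto
    then have "A o\<^sub>C rank_one u g o\<^sub>C B = 0" by (simp add: AB Endo_simps)
    then have "cblinfun_apply (A o\<^sub>C rank_one u g o\<^sub>C B) v = 0" by simp
    then show False using u g by (simp add: cblinfun_apply_compose)
  qed
qed

lemma exists_two_independent:
  assumes "finite_dimensional (UNIV :: 'a::complex_normed_vector set) \<longrightarrow> complex_vector.dim (UNIV :: 'a set) > 1"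
  obtains x z :: "'a::complex_normed_vector" where "x \<noteq> 0" "z \<notin> complex_vector.span {x}"
proof -
  have *: "\<exists>z :: 'a. z \<notin> complex_vector.span B" if B: "finite B" "card B \<le> 1" for B
  proof (rule ccontr)
    assume "\<not> ?thesis"
    then have sub: "UNIV \<subseteq> complex_vector.span B" by auto
    then have "finite_dimensional (UNIV :: 'a set)" using B by (auto simp: finite_dimensional_def)
    moreover have "complex_vector.dim (UNIV :: 'a set) \<le> card B"
      by (rule complex_vector.dim_le_card[OF sub B(1)])
    ultimately show False using assms B by simp
  qed
  obtain x :: 'a where "x \<notin> complex_vector.span {}" using *[of "{}"] by auto
  moreover obtain z where "z \<notin> complex_vector.span {x}" using *[of "{x}"] by auto
  ultimately show thesis by (intro that[of x z]) auto
qed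

lemma peirce_standard_operator_algebra:
  fixes \<A> :: "('a::complex_normed_vector \<Rightarrow>\<^sub>C 'a) set"
  assumes \<A>: "standard_operator_algebra \<A>"
    and x: "x \<noteq> 0" and z: "z \<notin> complex_vector.span {x :: 'a}"
  obtains e where "peirce_algebra (Endo ` \<A>) e"
proof -
  interpret prime_subalgebra "Endo ` \<A>" using \<A> by (rule prime_standard_operator_algebra)
  obtain f :: "'a dual" where f: "cblinfun_apply f x = 1" using x by (rule dual_separates)
  obtain g :: "'a dual" where g: "cblinfun_apply g z = 1" "cblinfun_apply g x = 0"
    using dual_separates_span[of "{x}" z] z by auto
  let ?P = "rank_one x f"
  have in_A: "Endo (rank_one u v) \<in> Endo ` \<A>" for u and v :: "'a dual"
    using standard_rank_one[OF \<A>] by auto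
  have "peirce_algebra (Endo ` \<A>) (Endo ?P)"
  proof
    show "Endo ?P \<in> Endo ` \<A>" by (rule in_A)
    show "Endo ?P * Endo ?P = Endo ?P" by (simp add: Endo_simps compose_rank_one f)
    have "cblinfun_apply ?P x \<noteq> 0" using f x by simp
    then have "?P \<noteq> 0" by (metis cblinfun_zero_left)
    then show "Endo ?P \<noteq> 0" by (simp add: Endo_simps)
    have "?P o\<^sub>C rank_one z f \<noteq> rank_one z f"
    proof
      assume "?P o\<^sub>C rank_one z f = rank_one z f"
      then have "cblinfun_apply (?P o\<^sub>C rank_one z f) x = cblinfun_apply (rank_one z f) x" by simp
      then have "z = cblinfun_apply f z *\<^sub>C x" using f by (simp add: cblinfun_apply_compose)
      then show False using z in_span_singleton by blast
    qed
    then show "\<exists>s\<in>Endo ` \<A>. Endo ?P * s \<noteq> s"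
      using in_A by (intro bexI[of _ "Endo (rank_one z f)"]) (simp_all add: Endo_simps)
    have "rank_one x g o\<^sub>C ?P \<noteq> rank_one x g"
    proof
      assume "rank_one x g o\<^sub>C ?P = rank_one x g"
      then have "cblinfun_apply (rank_one x g o\<^sub>C ?P) z = cblinfun_apply (rank_one x g) z" by simp
      then show False using g x by (simp add: cblinfun_apply_compose cblinfun_scaleC_right)
    qed
    then show "\<exists>s\<in>Endo ` \<A>. s * Endo ?P \<noteq> s"
      using in_A by (intro bexI[of _ "Endo (rank_one x g)"]) (simp_all add: Endo_simps)
  qed
  then show thesis by (rule that)
qed

lemma Jordan_isomorphism_dichotomy:
  fixes \<A> :: "('a::complex_normed_vector \<Rightarrow>\<^sub>C 'a) set"
    and \<B> :: "('b::complex_normed_vector \<Rightarrow>\<^sub>C 'b) set"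
  assumes dim_X: "finite_dimensional (UNIV :: 'a set) \<longrightarrow> complex_vector.dim (UNIV :: 'a set) > 1"
    and \<A>: "standard_operator_algebra \<A>"
    and \<B>: "standard_operator_algebra \<B>"
    and bij: "bij_betw \<phi> \<A> \<B>"
    and jordan: "\<And>A B. A \<in> \<A> \<Longrightarrow> B \<in> \<A> \<Longrightarrow>
      \<phi> ((1/2) *\<^sub>C (A o\<^sub>C B + B o\<^sub>C A)) = (1/2) *\<^sub>C (\<phi> A o\<^sub>C \<phi> B + \<phi> B o\<^sub>C \<phi> A)"
  shows "\<forall>A\<in>\<A>. \<forall>B\<in>\<A>. \<phi> (A + B) = \<phi> A + \<phi> B"
    and "(\<forall>A\<in>\<A>. \<forall>B\<in>\<A>. \<phi> (A o\<^sub>C B) = \<phi> A o\<^sub>C \<phi> B) \<or>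
      (\<forall>A\<in>\<A>. \<forall>B\<in>\<A>. \<phi> (A o\<^sub>C B) = \<phi> B o\<^sub>C \<phi> A)"
proof -
  define \<Phi> where "\<Phi> x = Endo (\<phi> (operator_of x))" for x
  have Phi: "\<Phi> (Endo A) = Endo (\<phi> A)" for A by (simp add: \<Phi>_def Endo_simps)
  obtain x z :: 'a where xz: "x \<noteq> 0" "z \<notin> complex_vector.span {x}"
    using dim_X by (rule exists_two_independent)
  obtain e where "peirce_algebra (Endo ` \<A>) e"
    using \<A> xz by (rule peirce_standard_operator_algebra)
  then interpret R: peirce_algebra "Endo ` \<A>" e .
  interpret S: prime_subalgebra "Endo ` \<B>" using \<B> by (rule prime_standard_operator_algebra)
  have Phi_jordan: "\<Phi> (a \<circ>\<^sub>J b) = \<Phi> a \<circ>\<^sub>J \<Phi> b" if "a \<in> Endo ` \<A>" "b \<in> Endo ` \<A>" for a b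
    using that jordan by (auto simp: jordan_product_def Endo_simps Phi scaleC_of_half)
  have image: "\<Phi> ` Endo ` \<A> = Endo ` \<B>"
    using bij by (auto simp: bij_betw_def image_image Phi)
  have Phi_bij: "bij_betw \<Phi> (Endo ` \<A>) (Endo ` \<B>)"
    using bij image by (auto simp: bij_betw_def inj_on_def Phi Endo_simps)
  interpret J: Jordan_multiplicative "Endo ` \<A>" e "Endo ` \<B>" \<Phi>
    by unfold_locales (use Phi_bij Phi_jordan in auto)
  interpret M: additive_Jordan_iso "Endo ` \<A>" "Endo ` \<B>" \<Phi>
  proof
    fix a b assume ab: "a \<in> Endo ` \<A>" "b \<in> Endo ` \<A>"
    show "\<Phi> (a + b) = \<Phi> a + \<Phi> b" using ab by (rule J.additive)
    have "a * b + b * a = a \<circ>\<^sub>J b + a \<circ>\<^sub>J b"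
      by (simp add: jordan_product_def scaleR_left.add[symmetric])
    moreover have "\<Phi> a * \<Phi> b + \<Phi> b * \<Phi> a = \<Phi> a \<circ>\<^sub>J \<Phi> b + \<Phi> a \<circ>\<^sub>J \<Phi> b"
      by (simp add: jordan_product_def scaleR_left.add[symmetric])
    ultimately show "\<Phi> (a * b + b * a) = \<Phi> a * \<Phi> b + \<Phi> b * \<Phi> a"
      using ab J.additive[of "a \<circ>\<^sub>J b" "a \<circ>\<^sub>J b"] Phi_jordan[OF ab] by simp
  qed (rule image)
  show "\<forall>A\<in>\<A>. \<forall>B\<in>\<A>. \<phi> (A + B) = \<phi> A + \<phi> B"
  proof (intro ballI)
    fix A B assume "A \<in> \<A>" "B \<in> \<A>"
    then show "\<phi> (A + B) = \<phi> A + \<phi> B"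
      using J.additive[of "Endo A" "Endo B"] by (simp add: Endo_simps Phi)
  qed
  show "(\<forall>A\<in>\<A>. \<forall>B\<in>\<A>. \<phi> (A o\<^sub>C B) = \<phi> A o\<^sub>C \<phi> B) \<or>
      (\<forall>A\<in>\<A>. \<forall>B\<in>\<A>. \<phi> (A o\<^sub>C B) = \<phi> B o\<^sub>C \<phi> A)"
    using M.mult_or_antimult_global by (auto simp: Endo_simps Phi)
qed

section \<open>Adjoints and evaluations\<close>

definition evaluation :: "'a::complex_normed_vector \<Rightarrow> 'a dual dual" where
  "evaluation x = cblin (\<lambda>f. cblinfun_apply f x)"

lemma evaluation_apply [simp]: "cblinfun_apply (evaluation x) f = cblinfun_apply f x"
proof -
  have "bounded_clinear (\<lambda>f :: 'a dual. cblinfun_apply f x)"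
    by (rule bounded_clinearI[where K = "norm x"])
       (simp_all add: cblinfun_apply_add cblinfun_apply_scaleC mult.commute[of "norm x"] cblinfun_norm)
  then show ?thesis by (simp add: evaluation_def cblin_apply)
qed

lemma dual_adjoint_rank_one: "dual_adjoint (rank_one x f) = rank_one f (evaluation x)"
  by (rule cblinfun_eqI)
     (rule cblinfun_eqI, simp add: dual_adjoint_apply cblinfun_apply_compose cblinfun_apply_scaleC cblinfun_scaleC_right mult.commute)

lemma dual_adjoint_add: "dual_adjoint (A + B) = dual_adjoint A + dual_adjoint B"
  by (rule cblinfun_eqI)
     (rule cblinfun_eqI, simp add: dual_adjoint_apply cblinfun_apply_compose cblinfun_apply_add cblinfun_add_right)

lemma dual_adjoint_compose: "dual_adjoint (A o\<^sub>C B) = dual_adjoint B o\<^sub>C dual_adjoint A"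
  by (rule cblinfun_eqI)
     (rule cblinfun_eqI, simp add: dual_adjoint_apply cblinfun_apply_compose)

lemma inj_dual_adjoint: "inj dual_adjoint"
proof (rule injI)
  fix A B :: "'a \<Rightarrow>\<^sub>C 'b" assume eq: "dual_adjoint A = dual_adjoint B"
  show "A = B"
  proof (rule cblinfun_eqI, rule ccontr)
    fix x assume "cblinfun_apply A x \<noteq> cblinfun_apply B x"
    then have "cblinfun_apply A x - cblinfun_apply B x \<noteq> 0" by simp
    then obtain f :: "'b dual" where f: "cblinfun_apply f (cblinfun_apply A x - cblinfun_apply B x) = 1"
      by (rule dual_separates)
    have "cblinfun_apply (cblinfun_apply (dual_adjoint A) f) x = cblinfun_apply (cblinfun_apply (dual_adjoint B) f) x"
      by (simp add: eq)
    then show False using f by (simp add: dual_adjoint_apply cblinfun_apply_compose cblinfun_diff_right)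
  qed
qed

text \<open>
  A functional that vanishes on the kernel of \<open>f\<close> is a multiple of \<open>f\<close>.
\<close>

lemma evaluations_separate:
  fixes f g :: "'a::complex_normed_vector dual"
  assumes "g \<notin> complex_vector.span {f}"
  shows "\<exists>x. cblinfun_apply f x = 0 \<and> cblinfun_apply g x \<noteq> 0"
proof (rule ccontr)
  assume "\<not> ?thesis"
  then have ker: "cblinfun_apply g x = 0" if "cblinfun_apply f x = 0" for x
    using that by blast
  show False
  proof (cases "\<exists>u. cblinfun_apply f u \<noteq> 0")
    case True
    then obtain u where u: "cblinfun_apply f u \<noteq> 0" by blast
    have "g = (cblinfun_apply g u / cblinfun_apply f u) *\<^sub>C f"
    proof (rule cblinfun_eqI)
      fix x
      have "cblinfun_apply g (x - (cblinfun_apply f x / cblinfun_apply f u) *\<^sub>C u) = 0"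
        using u by (intro ker) (simp add: cblinfun_diff_right cblinfun_scaleC_right)
      then show "cblinfun_apply g x = cblinfun_apply ((cblinfun_apply g u / cblinfun_apply f u) *\<^sub>C f) x"
        by (simp add: cblinfun_diff_right cblinfun_scaleC_right cblinfun_apply_scaleC)
    qed
    then show False using assms in_span_singleton by blast
  next
    case False
    then have "g = 0 *\<^sub>C f" using ker by (intro cblinfun_eqI) simp
    then show False using assms in_span_singleton by blast
  qed
qed

section \<open>Ordered bases\<close>

text \<open>
  Taking the coordinate functionals in the dual space makes their boundedness part of the
  statement; it comes from separating each basis vector from the span of the others.
\<close>

lemma basis_coordinates:
  fixes e :: "nat \<Rightarrow> 'a::complex_normed_vector"
  assumes "is_ordered_basis n e"
  obtains \<epsilon> :: "nat \<Rightarrow> 'a dual"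
  where "\<And>i j. i < n \<Longrightarrow> j < n \<Longrightarrow> cblinfun_apply (\<epsilon> i) (e j) = (if i = j then 1 else 0)"
    and "\<And>x. (\<Sum>i<n. cblinfun_apply (\<epsilon> i) x *\<^sub>C e i) = x"
    and "\<And>i x. i < n \<Longrightarrow> complex_vector.representation (e ` {..<n}) x (e i) = cblinfun_apply (\<epsilon> i) x"
proof -
  have inj: "inj_on e {..<n}" and indep: "complex_vector.independent (e ` {..<n})"
    and span: "complex_vector.span (e ` {..<n}) = UNIV"
    using assms by (auto simp: is_ordered_basis_def)
  have "\<exists>f :: 'a dual. cblinfun_apply f (e i) = 1 \<and> (\<forall>j<n. j \<noteq> i \<longrightarrow> cblinfun_apply f (e j) = 0)"
    if i: "i < n" for i
  proof -
    have "e i \<notin> complex_vector.span (e ` {..<n} - {e i})"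
      using indep i unfolding complex_vector.dependent_def by auto
    then obtain f :: "'a dual" where f: "cblinfun_apply f (e i) = 1"
      "\<forall>b\<in>e ` {..<n} - {e i}. cblinfun_apply f b = 0"
      using dual_separates_span[of "e ` {..<n} - {e i}" "e i"] by auto
    have "cblinfun_apply f (e j) = 0" if "j < n" "j \<noteq> i" for j
      using f(2) that i inj by (auto simp: inj_on_def)
    then show ?thesis using f(1) by blast
  qed
  then have "\<forall>i. \<exists>f :: 'a dual. i < n \<longrightarrow> cblinfun_apply f (e i) = 1 \<and>
      (\<forall>j<n. j \<noteq> i \<longrightarrow> cblinfun_apply f (e j) = 0)"
    by blast
  from choice[OF this] obtain \<epsilon> :: "nat \<Rightarrow> 'a dual"
    where \<epsilon>: "\<forall>i. i < n \<longrightarrow> cblinfun_apply (\<epsilon> i) (e i) = 1 \<and>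
      (\<forall>j<n. j \<noteq> i \<longrightarrow> cblinfun_apply (\<epsilon> i) (e j) = 0)" ..
  have bi: "cblinfun_apply (\<epsilon> i) (e j) = (if i = j then 1 else 0)" if "i < n" "j < n" for i j
    using \<epsilon> that by auto
  let ?r = "complex_vector.representation (e ` {..<n})"
  have rep: "(\<Sum>i<n. ?r x (e i) *\<^sub>C e i) = x" for x
  proof -
    have "(\<Sum>b\<in>e ` {..<n}. ?r x b *\<^sub>C b) = x"
      using span by (intro complex_vector.sum_representation_eq indep) auto
    then show ?thesis by (simp add: sum.reindex[OF inj])
  qed
  have coord: "?r x (e i) = cblinfun_apply (\<epsilon> i) x" if i: "i < n" for i x
  proof -
    have "cblinfun_apply (\<epsilon> i) x = cblinfun_apply (\<epsilon> i) (\<Sum>j<n. ?r x (e j) *\<^sub>C e j)"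
      by (simp only: rep)
    also have "\<dots> = (\<Sum>j<n. ?r x (e j) * cblinfun_apply (\<epsilon> i) (e j))"
      by (simp add: cblinfun_sum_right cblinfun_scaleC_right)
    also have "\<dots> = (\<Sum>j<n. if j = i then ?r x (e j) else 0)"
      using i by (intro sum.cong) (auto simp: bi)
    finally show ?thesis using i by simp
  qed
  have "(\<Sum>i<n. cblinfun_apply (\<epsilon> i) x *\<^sub>C e i) = x" for x
  proof -
    have "(\<Sum>i<n. cblinfun_apply (\<epsilon> i) x *\<^sub>C e i) = (\<Sum>i<n. ?r x (e i) *\<^sub>C e i)"
      by (intro sum.cong) (simp_all add: coord)
    then show ?thesis by (simp only: rep)
  qed
  with bi coord show thesis by (intro that[of \<epsilon>])
qed

lemma is_ordered_basisI:
  fixes b :: "nat \<Rightarrow> 'a::complex_normed_vector"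
  assumes span: "\<And>x. \<exists>c. x = (\<Sum>i<n. c i *\<^sub>C b i)"
    and indep: "\<And>c i. (\<Sum>i<n. c i *\<^sub>C b i) = 0 \<Longrightarrow> i < n \<Longrightarrow> c i = 0"
  shows "is_ordered_basis n b"
proof -
  have inj: "inj_on b {..<n}"
  proof (rule inj_onI, rule ccontr)
    fix i j assume ij: "i \<in> {..<n}" "j \<in> {..<n}" "b i = b j" "i \<noteq> j"
    \<comment> \<open>a repeated vector would give the relation \<open>b i - b j = 0\<close>\<close>
    define c :: "nat \<Rightarrow> complex" where "c k = (if k = i then 1 else 0) - (if k = j then 1 else 0)" for k
    have "(\<Sum>k<n. c k *\<^sub>C b k) = (\<Sum>k<n. if k = i then b k else 0) - (\<Sum>k<n. if k = j then b k else 0)"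
      unfolding sum_subtractf[symmetric]
      by (intro sum.cong) (auto simp: c_def complex_vector.scale_left_diff_distrib)
    also have "\<dots> = 0" using ij by simp
    finally have "c i = 0" using ij by (intro indep) auto
    then show False using ij by (simp add: c_def)
  qed
  have "complex_vector.independent (b ` {..<n})"
  proof
    assume "complex_vector.dependent (b ` {..<n})"
    then obtain u v where u: "v \<in> b ` {..<n}" "u v \<noteq> 0" "(\<Sum>v\<in>b ` {..<n}. u v *\<^sub>C v) = 0"
      by (subst (asm) complex_vector.dependent_finite) auto
    then have "(\<Sum>i<n. u (b i) *\<^sub>C b i) = 0" by (simp add: sum.reindex[OF inj])
    then have "u (b i) = 0" if "i < n" for i using indep[of "\<lambda>i. u (b i)"] that by auto
    then show False using u by auto
  qed
  moreover have "complex_vector.span (b ` {..<n}) = UNIV"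
  proof (rule UNIV_eq_I[symmetric])
    fix x
    obtain c where "x = (\<Sum>i<n. c i *\<^sub>C b i)" using span by blast
    also have "\<dots> \<in> complex_vector.span (b ` {..<n})"
      by (intro complex_vector.span_sum complex_vector.span_scale complex_vector.span_base) auto
    finally show "x \<in> complex_vector.span (b ` {..<n})" .
  qed
  ultimately show ?thesis using inj by (simp add: is_ordered_basis_def)
qed

lemma dual_basis:
  fixes e :: "nat \<Rightarrow> 'a::complex_normed_vector" and \<epsilon> :: "nat \<Rightarrow> 'a dual"
  assumes bi: "\<And>i j. i < n \<Longrightarrow> j < n \<Longrightarrow> cblinfun_apply (\<epsilon> i) (e j) = (if i = j then 1 else 0)"
    and expand: "\<And>x. (\<Sum>i<n. cblinfun_apply (\<epsilon> i) x *\<^sub>C e i) = x"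
  shows "f = (\<Sum>i<n. cblinfun_apply f (e i) *\<^sub>C \<epsilon> i)" and "is_ordered_basis n \<epsilon>"
proof -
  show form: "f = (\<Sum>i<n. cblinfun_apply f (e i) *\<^sub>C \<epsilon> i)" for f
  proof (rule cblinfun_eqI)
    fix x
    have "cblinfun_apply f x = cblinfun_apply f (\<Sum>i<n. cblinfun_apply (\<epsilon> i) x *\<^sub>C e i)"
      by (simp only: expand)
    then show "cblinfun_apply f x = cblinfun_apply (\<Sum>i<n. cblinfun_apply f (e i) *\<^sub>C \<epsilon> i) x"
      by (simp add: cblinfun_sum_right cblinfun_scaleC_right cblinfun_sum_left cblinfun_apply_scaleC mult.commute)
  qed
  show "is_ordered_basis n \<epsilon>"
  proof (rule is_ordered_basisI)
    show "\<exists>c. f = (\<Sum>i<n. c i *\<^sub>C \<epsilon> i)" for f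
      using form[of f] by (rule exI[of _ "\<lambda>i. cblinfun_apply f (e i)"])
    fix c i assume z: "(\<Sum>i<n. c i *\<^sub>C \<epsilon> i) = 0" and i: "i < n"
    have "0 = cblinfun_apply (\<Sum>k<n. c k *\<^sub>C \<epsilon> k) (e i)" by (simp add: z)
    also have "\<dots> = (\<Sum>k<n. if k = i then c k else 0)"
      unfolding cblinfun_sum_left cblinfun_apply_scaleC using i by (intro sum.cong) (auto simp: bi)
    finally show "c i = 0" using i by simp
  qed
qed

lemma ordered_basis_exists:
  assumes "finite_dimensional (UNIV :: 'a::complex_normed_vector set)"
  obtains e :: "nat \<Rightarrow> 'a::complex_normed_vector" where "is_ordered_basis (complex_vector.dim (UNIV :: 'a set)) e"
proof -
  obtain B :: "'a set" where B: "complex_vector.independent B" "UNIV \<subseteq> complex_vector.span B"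
    "card B = complex_vector.dim (UNIV :: 'a set)"
    using complex_vector.basis_exists[of "UNIV :: 'a set"] by metis
  obtain C :: "'a set" where "finite C" "UNIV \<subseteq> complex_vector.span C"
    using assms by (auto simp: finite_dimensional_def)
  then have "finite B" using complex_vector.independent_span_bound[of C B] B(1) by auto
  then obtain e where "bij_betw e {0..<card B} B" using ex_bij_betw_nat_finite by blast
  then have "inj_on e {..<card B}" "e ` {..<card B} = B"
    by (auto simp: bij_betw_def atLeast0LessThan)
  then have "is_ordered_basis (complex_vector.dim (UNIV :: 'a set)) e"
    using B by (auto simp: is_ordered_basis_def)
  then show thesis by (rule that)
qed

lemma ordered_basis_dim:
  assumes "is_ordered_basis n (e :: nat \<Rightarrow> 'a::complex_normed_vector)"
  shows "finite_dimensional (UNIV :: 'a set)" "complex_vector.dim (UNIV :: 'a set) = n"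
proof -
  show "finite_dimensional (UNIV :: 'a set)"
    unfolding finite_dimensional_def using assms
    by (intro exI[of _ "e ` {..<n}"]) (auto simp: is_ordered_basis_def)
  have "complex_vector.dim (UNIV :: 'a set) = card (e ` {..<n})"
    using assms by (intro complex_vector.dim_unique[of "e ` {..<n}"]) (auto simp: is_ordered_basis_def)
  then show "complex_vector.dim (UNIV :: 'a set) = n"
    using assms by (simp add: is_ordered_basis_def card_image)
qed

section \<open>Matrices of operators\<close>

lemma matrix_of_carrier [simp]: "matrix_of n e A \<in> carrier_mat n n"
  by (simp add: matrix_of_def)

lemma matrix_of_bij:
  fixes e :: "nat \<Rightarrow> 'a::complex_normed_vector"
  assumes "is_ordered_basis n e"
  shows "inj (matrix_of n e)" "\<And>M. M \<in> carrier_mat n n \<Longrightarrow> \<exists>A. matrix_of n e A = M"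
proof -
  obtain \<epsilon> :: "nat \<Rightarrow> 'a dual" where
    bi: "\<And>i j. i < n \<Longrightarrow> j < n \<Longrightarrow> cblinfun_apply (\<epsilon> i) (e j) = (if i = j then 1 else 0)"
    and expand: "\<And>x. (\<Sum>i<n. cblinfun_apply (\<epsilon> i) x *\<^sub>C e i) = x"
    and rep: "\<And>i x. i < n \<Longrightarrow> complex_vector.representation (e ` {..<n}) x (e i) = cblinfun_apply (\<epsilon> i) x"
    using basis_coordinates[OF assms] by blast
  have entry: "matrix_of n e A $$ (i, j) = cblinfun_apply (\<epsilon> i) (cblinfun_apply A (e j))"
    if "i < n" "j < n" for A i j
    using that by (simp add: matrix_of_def rep)
  show "inj (matrix_of n e)"
  proof (rule injI)
    fix A B assume eq: "matrix_of n e A = matrix_of n e B"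
    have basis: "cblinfun_apply A (e j) = cblinfun_apply B (e j)" if j: "j < n" for j
    proof -
      have "cblinfun_apply A (e j) = (\<Sum>i<n. cblinfun_apply (\<epsilon> i) (cblinfun_apply A (e j)) *\<^sub>C e i)"
        by (simp only: expand)
      also have "\<dots> = (\<Sum>i<n. cblinfun_apply (\<epsilon> i) (cblinfun_apply B (e j)) *\<^sub>C e i)"
        using j by (intro sum.cong) (simp_all add: entry[symmetric] eq)
      finally show ?thesis by (simp only: expand)
    qed
    show "A = B"
    proof (rule cblinfun_eqI)
      fix x
      have "cblinfun_apply A (\<Sum>i<n. cblinfun_apply (\<epsilon> i) x *\<^sub>C e i)
          = cblinfun_apply B (\<Sum>i<n. cblinfun_apply (\<epsilon> i) x *\<^sub>C e i)"
        by (simp add: cblinfun_sum_right cblinfun_scaleC_right basis)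
      then show "cblinfun_apply A x = cblinfun_apply B x" by (simp only: expand)
    qed
  qed
  fix M :: "complex mat" assume M: "M \<in> carrier_mat n n"
  let ?A = "\<Sum>i<n. \<Sum>j<n. M $$ (i, j) *\<^sub>C rank_one (e i) (\<epsilon> j)"
  have A: "cblinfun_apply ?A (e l) = (\<Sum>i<n. M $$ (i, l) *\<^sub>C e i)" if l: "l < n" for l
  proof -
    have "cblinfun_apply ?A (e l) = (\<Sum>i<n. \<Sum>j<n. M $$ (i, j) *\<^sub>C cblinfun_apply (\<epsilon> j) (e l) *\<^sub>C e i)"
      by (simp add: cblinfun_sum_left cblinfun_apply_scaleC)
    also have "\<dots> = (\<Sum>i<n. \<Sum>j<n. if j = l then M $$ (i, j) *\<^sub>C e i else 0)"
      using l by (intro sum.cong refl) (auto simp: bi)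
    finally show ?thesis using l by simp
  qed
  have "matrix_of n e ?A $$ (k, l) = M $$ (k, l)" if kl: "k < n" "l < n" for k l
  proof -
    have "matrix_of n e ?A $$ (k, l) = (\<Sum>i<n. M $$ (i, l) * cblinfun_apply (\<epsilon> k) (e i))"
      by (simp only: entry[OF kl] A[OF kl(2)] cblinfun_sum_right cblinfun_scaleC_right scaleC_complex_apply)
    also have "\<dots> = (\<Sum>i<n. if i = k then M $$ (i, l) else 0)"
      using kl by (intro sum.cong refl) (auto simp: bi)
    finally show ?thesis using kl by simp
  qed
  then have "matrix_of n e ?A = M"
    using M by (intro eq_matI) (auto simp: matrix_of_def)
  then show "\<exists>A. matrix_of n e A = M" ..
qed

text \<open>
  The entries of the transition matrices are the values of the coordinate functionals of one
  basis at the vectors of the other one.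
\<close>

lemma change_of_basis:
  fixes f u :: "nat \<Rightarrow> 'b::complex_normed_vector"
  assumes f: "is_ordered_basis n f" and u: "is_ordered_basis n u"
  obtains T S where "T \<in> carrier_mat n n" "S \<in> carrier_mat n n" "inverts_mat T S" "inverts_mat S T"
    "\<And>B. matrix_of n f B = T * matrix_of n u B * S"
proof -
  obtain \<eta> :: "nat \<Rightarrow> 'b dual" where
    f_bi: "\<And>i j. i < n \<Longrightarrow> j < n \<Longrightarrow> cblinfun_apply (\<eta> i) (f j) = (if i = j then 1 else 0)"
    and f_expand: "\<And>x. (\<Sum>i<n. cblinfun_apply (\<eta> i) x *\<^sub>C f i) = x"
    and f_rep: "\<And>i x. i < n \<Longrightarrow> complex_vector.representation (f ` {..<n}) x (f i) = cblinfun_apply (\<eta> i) x"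
    using basis_coordinates[OF f] by blast
  obtain \<upsilon> :: "nat \<Rightarrow> 'b dual" where
    u_bi: "\<And>i j. i < n \<Longrightarrow> j < n \<Longrightarrow> cblinfun_apply (\<upsilon> i) (u j) = (if i = j then 1 else 0)"
    and u_expand: "\<And>x. (\<Sum>i<n. cblinfun_apply (\<upsilon> i) x *\<^sub>C u i) = x"
    and u_rep: "\<And>i x. i < n \<Longrightarrow> complex_vector.representation (u ` {..<n}) x (u i) = cblinfun_apply (\<upsilon> i) x"
    using basis_coordinates[OF u] by blast
  define T where "T = mat n n (\<lambda>(i, j). cblinfun_apply (\<eta> i) (u j))"
  define S where "S = mat n n (\<lambda>(i, j). cblinfun_apply (\<upsilon> i) (f j))"
  have comp_u: "(\<Sum>k<n. cblinfun_apply g (u k) * cblinfun_apply (\<upsilon> k) x) = cblinfun_apply g x"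
    for g :: "'b dual" and x
  proof -
    have "cblinfun_apply g x = cblinfun_apply g (\<Sum>k<n. cblinfun_apply (\<upsilon> k) x *\<^sub>C u k)"
      by (simp only: u_expand)
    then show ?thesis by (simp add: cblinfun_sum_right cblinfun_scaleC_right mult.commute)
  qed
  have comp_f: "(\<Sum>k<n. cblinfun_apply g (f k) * cblinfun_apply (\<eta> k) x) = cblinfun_apply g x"
    for g :: "'b dual" and x
  proof -
    have "cblinfun_apply g x = cblinfun_apply g (\<Sum>k<n. cblinfun_apply (\<eta> k) x *\<^sub>C f k)"
      by (simp only: f_expand)
    then show ?thesis by (simp add: cblinfun_sum_right cblinfun_scaleC_right mult.commute)
  qed
  have TS: "T \<in> carrier_mat n n" "S \<in> carrier_mat n n" by (simp_all add: T_def S_def)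
  have "T * S = 1\<^sub>m n"
    by (rule eq_matI) (simp_all add: T_def S_def scalar_prod_def atLeast0LessThan comp_u f_bi)
  moreover have "S * T = 1\<^sub>m n"
    by (rule eq_matI) (simp_all add: T_def S_def scalar_prod_def atLeast0LessThan comp_f u_bi)
  moreover have "matrix_of n f B = T * matrix_of n u B * S" for B
  proof (rule eq_matI)
    fix i j assume "i < dim_row (T * matrix_of n u B * S)" "j < dim_col (T * matrix_of n u B * S)"
    then have ij: "i < n" "j < n" by (simp_all add: T_def S_def)
    have "(T * matrix_of n u B) $$ (i, l) = cblinfun_apply (\<eta> i) (cblinfun_apply B (u l))" if "l < n" for l
      using ij that
      by (simp add: T_def matrix_of_def scalar_prod_def atLeast0LessThan u_rep comp_u)
    then have "(T * matrix_of n u B * S) $$ (i, j)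
        = (\<Sum>l<n. cblinfun_apply (\<eta> i) (cblinfun_apply B (u l)) * cblinfun_apply (\<upsilon> l) (f j))"
      using ij by (simp add: S_def T_def matrix_of_def scalar_prod_def atLeast0LessThan)
    also have "\<dots> = cblinfun_apply (\<eta> i) (cblinfun_apply B (f j))"
      using comp_u[of "\<eta> i o\<^sub>C B" "f j"] by (simp add: cblinfun_apply_compose)
    finally show "matrix_of n f B $$ (i, j) = (T * matrix_of n u B * S) $$ (i, j)"
      using ij by (simp add: matrix_of_def f_rep)
  qed (simp_all add: T_def S_def matrix_of_def)
  ultimately show thesis using TS by (intro that[of T S]) (auto simp: inverts_mat_def)
qed

lemma semilinear_sum:
  assumes "\<And>x y. T (x + y) = T x + T y" "\<And>c x. T (c *\<^sub>C x) = h c *\<^sub>C T x"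
  shows "T (\<Sum>i\<in>I. c i *\<^sub>C b i) = (\<Sum>i\<in>I. h (c i) *\<^sub>C T (b i))"
proof -
  have "T 0 = 0" using assms(1)[of 0 0] by simp
  then show ?thesis
    by (induction I rule: infinite_finite_induct) (simp_all add: assms)
qed

lemma semilinear_image_basis:
  fixes T :: "'z::complex_normed_vector \<Rightarrow> 'y::complex_normed_vector"
  assumes T: "bij T" "\<And>x y. T (x + y) = T x + T y" "\<And>c x. T (c *\<^sub>C x) = h c *\<^sub>C T x"
    and h: "ring_automorphism h" and b: "is_ordered_basis n b"
  shows "is_ordered_basis n (\<lambda>i. T (b i))"
proof -
  obtain \<epsilon> :: "nat \<Rightarrow> 'z dual" where
    bi: "\<And>i j. i < n \<Longrightarrow> j < n \<Longrightarrow> cblinfun_apply (\<epsilon> i) (b j) = (if i = j then 1 else 0)"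
    and expand: "\<And>x. (\<Sum>i<n. cblinfun_apply (\<epsilon> i) x *\<^sub>C b i) = x"
    and "\<And>i x. i < n \<Longrightarrow> complex_vector.representation (b ` {..<n}) x (b i) = cblinfun_apply (\<epsilon> i) x"
    using basis_coordinates[OF b] by blast
  interpret h: comm_ring_hom h using h by (simp add: ring_automorphism_def)
  have T_sum: "T (\<Sum>i<n. c i *\<^sub>C b i) = (\<Sum>i<n. h (c i) *\<^sub>C T (b i))" for c
    by (rule semilinear_sum[OF T(2,3)])
  show ?thesis
  proof (rule is_ordered_basisI)
    fix y
    obtain x where "y = T x" using bij_is_surj[OF T(1)] by (metis surjD)
    then have "y = T (\<Sum>i<n. cblinfun_apply (\<epsilon> i) x *\<^sub>C b i)" by (simp only: expand)
    then show "\<exists>c. y = (\<Sum>i<n. c i *\<^sub>C T (b i))"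
      unfolding T_sum by (rule exI[of _ "\<lambda>i. h (cblinfun_apply (\<epsilon> i) x)"])
  next
    fix c i assume z: "(\<Sum>i<n. c i *\<^sub>C T (b i)) = 0" and i: "i < n"
    let ?g = "inv_into UNIV h"
    have hs: "h (?g d) = d" for d
      using h by (simp add: ring_automorphism_def bij_is_surj surj_f_inv_f)
    have T_0: "T 0 = 0" using T(2)[of 0 0] by simp
    have "T (\<Sum>i<n. ?g (c i) *\<^sub>C b i) = T 0" using z by (simp add: T_sum hs T_0)
    then have z': "(\<Sum>i<n. ?g (c i) *\<^sub>C b i) = 0" using bij_is_inj[OF T(1)] by (metis injD)
    have "0 = cblinfun_apply (\<epsilon> i) (\<Sum>k<n. ?g (c k) *\<^sub>C b k)" by (simp add: z')
    also have "\<dots> = (\<Sum>k<n. if k = i then ?g (c k) else 0)"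
      unfolding cblinfun_sum_right cblinfun_scaleC_right using i by (intro sum.cong) (auto simp: bi)
    finally have "?g (c i) = 0" using i by simp
    then show "c i = 0" using hs[of "c i"] by simp
  qed
qed

lemma matrix_of_expand:
  fixes u :: "nat \<Rightarrow> 'b::complex_normed_vector"
  assumes u: "is_ordered_basis n u"
    and B: "\<And>j. j < n \<Longrightarrow> cblinfun_apply B (u j) = (\<Sum>k<n. m k j *\<^sub>C u k)"
  shows "matrix_of n u B = mat n n (\<lambda>(i, j). m i j)"
proof -
  obtain \<upsilon> :: "nat \<Rightarrow> 'b dual" where
    u_bi: "\<And>i j. i < n \<Longrightarrow> j < n \<Longrightarrow> cblinfun_apply (\<upsilon> i) (u j) = (if i = j then 1 else 0)"
    and "\<And>x. (\<Sum>i<n. cblinfun_apply (\<upsilon> i) x *\<^sub>C u i) = x"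
    and u_rep: "\<And>i x. i < n \<Longrightarrow> complex_vector.representation (u ` {..<n}) x (u i) = cblinfun_apply (\<upsilon> i) x"
    using basis_coordinates[OF u] by blast
  have "cblinfun_apply (\<upsilon> i) (cblinfun_apply B (u j)) = m i j" if ij: "i < n" "j < n" for i j
  proof -
    have "cblinfun_apply (\<upsilon> i) (cblinfun_apply B (u j)) = (\<Sum>k<n. m k j * cblinfun_apply (\<upsilon> i) (u k))"
      by (simp add: B[OF ij(2)] cblinfun_sum_right cblinfun_scaleC_right)
    also have "\<dots> = (\<Sum>k<n. if k = i then m k j else 0)"
      using ij by (intro sum.cong refl) (auto simp: u_bi)
    finally show ?thesis using ij by simp
  qed
  then show ?thesis by (intro eq_matI) (simp_all add: matrix_of_def u_rep)
qed

section \<open>Jordan multiplicative bijections of standard operator algebras\<close>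

lemma multiplicative_operator_ring_iso:
  fixes \<A> :: "('a::complex_banach \<Rightarrow>\<^sub>C 'a) set" and \<B> :: "('b::complex_banach \<Rightarrow>\<^sub>C 'b) set"
  assumes \<A>: "standard_operator_algebra \<A>" and \<B>: "standard_operator_algebra \<B>"
    and bij: "bij_betw \<phi> \<A> \<B>" and nontrivial: "\<exists>x :: 'a. x \<noteq> 0"
    and add: "\<forall>A\<in>\<A>. \<forall>B\<in>\<A>. \<phi> (A + B) = \<phi> A + \<phi> B"
    and mult: "\<forall>A\<in>\<A>. \<forall>B\<in>\<A>. \<phi> (A o\<^sub>C B) = \<phi> A o\<^sub>C \<phi> B"
  shows "operator_ring_iso \<A> UNIV \<B> \<phi>"
proof
  show "\<exists>w\<in>(UNIV :: 'a dual set). cblinfun_apply w x = 0 \<and> cblinfun_apply w z \<noteq> 0"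
    if "z \<notin> complex_vector.span {x}" for x z :: 'a
  proof -
    obtain w :: "'a dual" where "cblinfun_apply w z = 1" "cblinfun_apply w x = 0"
      using dual_separates_span[of "{x}" z] \<open>z \<notin> _\<close> by auto
    then show ?thesis by (intro bexI[of _ w]) auto
  qed
qed (use assms standard_rank_one in auto)

lemma antimultiplicative_operator_ring_iso:
  fixes \<A> :: "('a::complex_banach \<Rightarrow>\<^sub>C 'a) set" and \<B> :: "('b::complex_banach \<Rightarrow>\<^sub>C 'b) set"
  assumes \<A>: "standard_operator_algebra \<A>" and \<B>: "standard_operator_algebra \<B>"
    and bij: "bij_betw \<phi> \<A> \<B>" and nontrivial: "\<exists>x :: 'a. x \<noteq> 0"
    and add: "\<forall>A\<in>\<A>. \<forall>B\<in>\<A>. \<phi> (A + B) = \<phi> A + \<phi> B"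
    and antimult: "\<forall>A\<in>\<A>. \<forall>B\<in>\<A>. \<phi> (A o\<^sub>C B) = \<phi> B o\<^sub>C \<phi> A"
  shows "operator_ring_iso (dual_adjoint ` \<A>) (range evaluation) \<B>
    (\<lambda>A'. \<phi> (inv_into UNIV dual_adjoint A'))"
proof
  let ?inv = "inv_into UNIV (dual_adjoint :: ('a \<Rightarrow>\<^sub>C 'a) \<Rightarrow> _)"
  have inv: "?inv (dual_adjoint A) = A" for A
    by (rule inv_f_f[OF inj_dual_adjoint])
  have sub: "complex_vector.subspace \<A>" and comp: "\<And>A B. A \<in> \<A> \<Longrightarrow> B \<in> \<A> \<Longrightarrow> A o\<^sub>C B \<in> \<A>"
    using \<A> by (auto simp: standard_operator_algebra_def)
  show "\<exists>f :: 'a dual. f \<noteq> 0"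
  proof -
    obtain x :: 'a where "x \<noteq> 0" using nontrivial by auto
    then obtain f :: "'a dual" where "cblinfun_apply f x = 1" by (rule dual_separates)
    then show ?thesis by (intro exI[of _ f]) auto
  qed
  show "\<exists>w\<in>range evaluation. cblinfun_apply w f = 0 \<and> cblinfun_apply w g \<noteq> 0"
    if "g \<notin> complex_vector.span {f}" for f g :: "'a dual"
    using evaluations_separate[OF that] by auto
  show "rank_one f w \<in> dual_adjoint ` \<A>" if "w \<in> range evaluation" for f :: "'a dual" and w
    using that standard_rank_one[OF \<A>] by (auto simp: dual_adjoint_rank_one[symmetric])
  show "rank_one y g \<in> \<B>" for y and g :: "'b dual" by (rule standard_rank_one[OF \<B>])
  show "bij_betw (\<lambda>A'. \<phi> (?inv A')) (dual_adjoint ` \<A>) \<B>"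
    using bij by (auto simp: bij_betw_def inj_on_def image_image inv)
  fix A' B' assume AB': "A' \<in> dual_adjoint ` \<A>" "B' \<in> dual_adjoint ` \<A>"
  then obtain A B where AB: "A \<in> \<A>" "A' = dual_adjoint A" "B \<in> \<A>" "B' = dual_adjoint B" by blast
  show "\<phi> (?inv (A' + B')) = \<phi> (?inv A') + \<phi> (?inv B')"
    using AB add by (simp add: dual_adjoint_add[symmetric] inv)
  show "\<phi> (?inv (A' o\<^sub>C B')) = \<phi> (?inv A') o\<^sub>C \<phi> (?inv B')"
    using AB antimult by (simp add: dual_adjoint_compose[symmetric] inv)
qed

text \<open>
  In the basis \<open>T e\<close> of the target, \<open>\<phi> A\<close> has the coordinates of \<open>A e\<close>, transformed by \<open>h\<close>.
\<close>

lemma multiplicative_matrix_form: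
  fixes \<B> :: "('b::complex_banach \<Rightarrow>\<^sub>C 'b) set" and \<phi> :: "('a::complex_banach \<Rightarrow>\<^sub>C 'a) \<Rightarrow> ('b \<Rightarrow>\<^sub>C 'b)"
  assumes "operator_ring_iso UNIV UNIV \<B> \<phi>"
  shows "\<exists>h. ring_automorphism h \<and> (\<forall>n e. is_ordered_basis n e \<longrightarrow>
    (\<exists>u. is_ordered_basis n u \<and> (\<forall>A. matrix_of n u (\<phi> A) = map_mat h (matrix_of n e A))))"
proof -
  interpret operator_ring_iso UNIV UNIV \<B> \<phi> by fact
  obtain T :: "'a \<Rightarrow> 'b" and h where T: "bij T" "\<And>x y. T (x + y) = T x + T y"
    "\<And>c x. T (c *\<^sub>C x) = h c *\<^sub>C T x" and h: "ring_automorphism h"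
    and T_int: "\<And>A x. cblinfun_apply (\<phi> A) (T x) = T (cblinfun_apply A x)"
    using semilinear_intertwiner by blast
  have "\<exists>u. is_ordered_basis n u \<and> (\<forall>A. matrix_of n u (\<phi> A) = map_mat h (matrix_of n e A))"
    if e: "is_ordered_basis n e" for n e
  proof -
    obtain \<epsilon> :: "nat \<Rightarrow> 'a dual" where
      bi: "\<And>i j. i < n \<Longrightarrow> j < n \<Longrightarrow> cblinfun_apply (\<epsilon> i) (e j) = (if i = j then 1 else 0)"
      and expand: "\<And>x. (\<Sum>i<n. cblinfun_apply (\<epsilon> i) x *\<^sub>C e i) = x"
      and rep: "\<And>i x. i < n \<Longrightarrow> complex_vector.representation (e ` {..<n}) x (e i) = cblinfun_apply (\<epsilon> i) x"
      using basis_coordinates[OF e] by blast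
    have u: "is_ordered_basis n (\<lambda>i. T (e i))"
      by (rule semilinear_image_basis[OF T h e])
    have "matrix_of n (\<lambda>i. T (e i)) (\<phi> A)
        = mat n n (\<lambda>(i, j). h (cblinfun_apply (\<epsilon> i) (cblinfun_apply A (e j))))" for A
    proof (rule matrix_of_expand[OF u])
      fix j
      have "cblinfun_apply (\<phi> A) (T (e j))
          = T (\<Sum>k<n. cblinfun_apply (\<epsilon> k) (cblinfun_apply A (e j)) *\<^sub>C e k)"
        by (simp only: T_int expand)
      then show "cblinfun_apply (\<phi> A) (T (e j))
          = (\<Sum>k<n. h (cblinfun_apply (\<epsilon> k) (cblinfun_apply A (e j))) *\<^sub>C T (e k))"
        by (simp only: semilinear_sum[OF T(2,3)])
    qed
    then have "matrix_of n (\<lambda>i. T (e i)) (\<phi> A) = map_mat h (matrix_of n e A)" for A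
      by (intro eq_matI) (simp_all add: matrix_of_def rep)
    then show ?thesis using u by blast
  qed
  then show ?thesis using h by blast
qed

text \<open>
  The intertwiner starts in the dual space, and the matrix of an adjoint in the dual basis is the
  transposed matrix.
\<close>

lemma antimultiplicative_matrix_form:
  fixes \<B> :: "('b::complex_banach \<Rightarrow>\<^sub>C 'b) set" and \<phi> :: "('a::complex_banach \<Rightarrow>\<^sub>C 'a) \<Rightarrow> ('b \<Rightarrow>\<^sub>C 'b)"
  assumes "operator_ring_iso (range dual_adjoint) (range evaluation) \<B>
    (\<lambda>A'. \<phi> (inv_into UNIV dual_adjoint A'))"
  shows "\<exists>h. ring_automorphism h \<and> (\<forall>n e. is_ordered_basis n e \<longrightarrow>
    (\<exists>u. is_ordered_basis n u \<and> (\<forall>A. matrix_of n u (\<phi> A) = transpose_mat (map_mat h (matrix_of n e A)))))"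
proof -
  interpret operator_ring_iso "range dual_adjoint" "range evaluation" \<B>
    "\<lambda>A'. \<phi> (inv_into UNIV dual_adjoint A')" by fact
  obtain T :: "'a dual \<Rightarrow> 'b" and h where T: "bij T" "\<And>x y. T (x + y) = T x + T y"
    "\<And>c x. T (c *\<^sub>C x) = h c *\<^sub>C T x" and h: "ring_automorphism h"
    and T_int': "\<And>A' x. A' \<in> range dual_adjoint \<Longrightarrow>
      cblinfun_apply (\<phi> (inv_into UNIV dual_adjoint A')) (T x) = T (cblinfun_apply A' x)"
    using semilinear_intertwiner by blast
  have T_int: "cblinfun_apply (\<phi> A) (T f) = T (f o\<^sub>C A)" for A f
    using T_int'[of "dual_adjoint A" f] by (simp add: inv_f_f[OF inj_dual_adjoint] dual_adjoint_apply)
  have "\<exists>u. is_ordered_basis n u \<and> (\<forall>A. matrix_of n u (\<phi> A) = transpose_mat (map_mat h (matrix_of n e A)))"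
    if e: "is_ordered_basis n e" for n e
  proof -
    obtain \<epsilon> :: "nat \<Rightarrow> 'a dual" where
      bi: "\<And>i j. i < n \<Longrightarrow> j < n \<Longrightarrow> cblinfun_apply (\<epsilon> i) (e j) = (if i = j then 1 else 0)"
      and expand: "\<And>x. (\<Sum>i<n. cblinfun_apply (\<epsilon> i) x *\<^sub>C e i) = x"
      and rep: "\<And>i x. i < n \<Longrightarrow> complex_vector.representation (e ` {..<n}) x (e i) = cblinfun_apply (\<epsilon> i) x"
      using basis_coordinates[OF e] by blast
    have u: "is_ordered_basis n (\<lambda>i. T (\<epsilon> i))"
      by (rule semilinear_image_basis[OF T h dual_basis(2)[OF bi expand]])
    have "matrix_of n (\<lambda>i. T (\<epsilon> i)) (\<phi> A)
        = mat n n (\<lambda>(i, j). h (cblinfun_apply (\<epsilon> j) (cblinfun_apply A (e i))))" for A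
    proof (rule matrix_of_expand[OF u])
      fix j
      have "cblinfun_apply (\<phi> A) (T (\<epsilon> j)) = T (\<epsilon> j o\<^sub>C A)" by (rule T_int)
      also have "\<epsilon> j o\<^sub>C A = (\<Sum>k<n. cblinfun_apply (\<epsilon> j o\<^sub>C A) (e k) *\<^sub>C \<epsilon> k)"
        by (rule dual_basis(1)[OF bi expand])
      finally show "cblinfun_apply (\<phi> A) (T (\<epsilon> j))
          = (\<Sum>k<n. h (cblinfun_apply (\<epsilon> j) (cblinfun_apply A (e k))) *\<^sub>C T (\<epsilon> k))"
        by (simp only: semilinear_sum[OF T(2,3)] cblinfun_apply_compose comp_def)
    qed
    then have "matrix_of n (\<lambda>i. T (\<epsilon> i)) (\<phi> A) = transpose_mat (map_mat h (matrix_of n e A))" for A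
      by (intro eq_matI) (simp_all add: matrix_of_def rep)
    then show ?thesis using u by blast
  qed
  then show ?thesis using h by blast
qed

lemma standard_operator_algebra_finite_dimensional:
  fixes \<A> :: "('a::complex_normed_vector \<Rightarrow>\<^sub>C 'a) set"
  assumes "standard_operator_algebra \<A>" and "finite_dimensional (UNIV :: 'a set)"
  shows "\<A> = UNIV"
proof -
  obtain B :: "'a set" where "finite B" "UNIV \<subseteq> complex_vector.span B"
    using assms(2) by (auto simp: finite_dimensional_def)
  then have "finite_rank A" for A :: "'a \<Rightarrow>\<^sub>C 'a"
    unfolding finite_rank_def finite_dimensional_def by blast
  then show ?thesis using assms(1) by (auto simp: standard_operator_algebra_def)
qed

lemma matrix_map_form:
  fixes \<phi> :: "('a::complex_normed_vector \<Rightarrow>\<^sub>C 'a) \<Rightarrow> ('b::complex_normed_vector \<Rightarrow>\<^sub>C 'b)"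
  assumes e: "is_ordered_basis n e" and f: "is_ordered_basis n f" and u: "is_ordered_basis n u"
    and g: "\<And>A. matrix_of n u (\<phi> A) = g (matrix_of n e A)"
  shows "\<exists>T S. T \<in> carrier_mat n n \<and> S \<in> carrier_mat n n \<and> inverts_mat T S \<and> inverts_mat S T \<and>
    (\<forall>M \<in> carrier_mat n n. matrix_map n e f \<phi> M = T * g M * S)"
proof -
  obtain T S where TS: "T \<in> carrier_mat n n" "S \<in> carrier_mat n n" "inverts_mat T S" "inverts_mat S T"
    "\<And>B. matrix_of n f B = T * matrix_of n u B * S"
    using change_of_basis[OF f u] by blast
  have "matrix_map n e f \<phi> M = T * g M * S" if M: "M \<in> carrier_mat n n" for M
  proof -
    obtain A where A: "matrix_of n e A = M" using matrix_of_bij(2)[OF e M] by blast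
    then have "the_inv (matrix_of n e) M = A" using the_inv_f_f[OF matrix_of_bij(1)[OF e]] by auto
    then show ?thesis by (simp add: matrix_map_def TS(5) g A)
  qed
  then show ?thesis using TS by blast
qed

theorem theorem1:
  fixes \<A> :: "('a::complex_banach \<Rightarrow>\<^sub>C 'a) set"
    and \<B> :: "('b::complex_banach \<Rightarrow>\<^sub>C 'b) set"
    and \<phi> :: "('a \<Rightarrow>\<^sub>C 'a) \<Rightarrow> ('b \<Rightarrow>\<^sub>C 'b)"
  assumes dim_X: "finite_dimensional (UNIV :: 'a set) \<longrightarrow> complex_vector.dim (UNIV :: 'a set) > 1"
    and \<A>: "standard_operator_algebra \<A>"
    and \<B>: "standard_operator_algebra \<B>"
    and bij: "bij_betw \<phi> \<A> \<B>"
    and jordan: "\<And>A B. A \<in> \<A> \<Longrightarrow> B \<in> \<A> \<Longrightarrow>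
      \<phi> ((1/2) *\<^sub>C (A o\<^sub>C B + B o\<^sub>C A)) = (1/2) *\<^sub>C (\<phi> A o\<^sub>C \<phi> B + \<phi> B o\<^sub>C \<phi> A)"
  shows "(\<not> finite_dimensional (UNIV :: 'a set) \<longrightarrow>
      (\<exists>T :: 'a \<Rightarrow> 'b. invertible_bounded_clinear T \<and>
         (\<forall>A\<in>\<A>. cblinfun_apply (\<phi> A) = T \<circ> cblinfun_apply A \<circ> inv_into UNIV T)) \<or>
      (\<exists>T :: 'a \<Rightarrow> 'b. invertible_bounded_antilinear T \<and>
         (\<forall>A\<in>\<A>. cblinfun_apply (\<phi> A) = T \<circ> cblinfun_apply A \<circ> inv_into UNIV T)) \<or>
      (\<exists>T :: 'a dual \<Rightarrow> 'b. invertible_bounded_clinear T \<and>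
         (\<forall>A\<in>\<A>. cblinfun_apply (\<phi> A) = T \<circ> cblinfun_apply (dual_adjoint A) \<circ> inv_into UNIV T)) \<or>
      (\<exists>T :: 'a dual \<Rightarrow> 'b. invertible_bounded_antilinear T \<and>
         (\<forall>A\<in>\<A>. cblinfun_apply (\<phi> A) = T \<circ> cblinfun_apply (dual_adjoint A) \<circ> inv_into UNIV T)))
    \<and> (finite_dimensional (UNIV :: 'a set) \<longrightarrow>
      finite_dimensional (UNIV :: 'b set) \<and>
      complex_vector.dim (UNIV :: 'a set) = complex_vector.dim (UNIV :: 'b set) \<and>
      \<A> = UNIV \<and> \<B> = UNIV \<and>
      (\<forall>n e f. n = complex_vector.dim (UNIV :: 'a set) \<longrightarrow>
         is_ordered_basis n (e :: nat \<Rightarrow> 'a) \<longrightarrow> is_ordered_basis n (f :: nat \<Rightarrow> 'b) \<longrightarrow>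
         (\<exists>h T S. ring_automorphism h \<and> T \<in> carrier_mat n n \<and> S \<in> carrier_mat n n \<and>
            inverts_mat T S \<and> inverts_mat S T \<and>
            (\<forall>M \<in> carrier_mat n n. matrix_map n e f \<phi> M = T * map_mat h M * S)) \<or>
         (\<exists>h T S. ring_automorphism h \<and> T \<in> carrier_mat n n \<and> S \<in> carrier_mat n n \<and>
            inverts_mat T S \<and> inverts_mat S T \<and>
            (\<forall>M \<in> carrier_mat n n. matrix_map n e f \<phi> M = T * transpose_mat (map_mat h M) * S))))"
proof (intro conjI impI)
  obtain x :: 'a where "x \<noteq> 0" using exists_two_independent[OF dim_X] by metis
  then have nontrivial: "\<exists>x :: 'a. x \<noteq> 0" by blast
  have add: "\<forall>A\<in>\<A>. \<forall>B\<in>\<A>. \<phi> (A + B) = \<phi> A + \<phi> B"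
    by (rule Jordan_isomorphism_dichotomy(1)[OF dim_X \<A> \<B> bij]) (rule jordan)
  have dichotomy: "(\<forall>A\<in>\<A>. \<forall>B\<in>\<A>. \<phi> (A o\<^sub>C B) = \<phi> A o\<^sub>C \<phi> B) \<or>
      (\<forall>A\<in>\<A>. \<forall>B\<in>\<A>. \<phi> (A o\<^sub>C B) = \<phi> B o\<^sub>C \<phi> A)"
    by (rule Jordan_isomorphism_dichotomy(2)[OF dim_X \<A> \<B> bij]) (rule jordan)
  {
    assume "\<not> finite_dimensional (UNIV :: 'a set)"
    then obtain x :: "nat \<Rightarrow> 'a" and f :: "nat \<Rightarrow> 'a dual"
      where bi: "\<And>i j. cblinfun_apply (f i) (x j) = (if i = j then 1 else 0)"
      by (rule biorthogonal_sequence) (rule that)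
    from dichotomy show "(\<exists>T :: 'a \<Rightarrow> 'b. invertible_bounded_clinear T \<and>
         (\<forall>A\<in>\<A>. cblinfun_apply (\<phi> A) = T \<circ> cblinfun_apply A \<circ> inv_into UNIV T)) \<or>
      (\<exists>T :: 'a \<Rightarrow> 'b. invertible_bounded_antilinear T \<and>
         (\<forall>A\<in>\<A>. cblinfun_apply (\<phi> A) = T \<circ> cblinfun_apply A \<circ> inv_into UNIV T)) \<or>
      (\<exists>T :: 'a dual \<Rightarrow> 'b. invertible_bounded_clinear T \<and>
         (\<forall>A\<in>\<A>. cblinfun_apply (\<phi> A) = T \<circ> cblinfun_apply (dual_adjoint A) \<circ> inv_into UNIV T)) \<or>
      (\<exists>T :: 'a dual \<Rightarrow> 'b. invertible_bounded_antilinear T \<and>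
         (\<forall>A\<in>\<A>. cblinfun_apply (\<phi> A) = T \<circ> cblinfun_apply (dual_adjoint A) \<circ> inv_into UNIV T))"
      (is "?i \<or> ?ii \<or> ?iii \<or> ?iv")
    proof
      assume "\<forall>A\<in>\<A>. \<forall>B\<in>\<A>. \<phi> (A o\<^sub>C B) = \<phi> A o\<^sub>C \<phi> B"
      then interpret operator_ring_iso \<A> UNIV \<B> \<phi>
        by (rule multiplicative_operator_ring_iso[OF \<A> \<B> bij nontrivial add])
      have "?i \<or> ?ii" by (rule bounded_intertwiner[OF UNIV_I bi])
      then show ?thesis by (elim disjE) simp_all
    next
      assume "\<forall>A\<in>\<A>. \<forall>B\<in>\<A>. \<phi> (A o\<^sub>C B) = \<phi> B o\<^sub>C \<phi> A"
      then interpret operator_ring_iso "dual_adjoint ` \<A>" "range evaluation" \<B>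
        "\<lambda>A'. \<phi> (inv_into UNIV dual_adjoint A')"
        by (rule antimultiplicative_operator_ring_iso[OF \<A> \<B> bij nontrivial add])
      have "cblinfun_apply (evaluation (x i)) (f j) = (if i = j then 1 else 0)" for i j
        by (simp add: bi)
      from bounded_intertwiner[of "\<lambda>i. evaluation (x i)", OF _ this]
      have "?iii \<or> ?iv" by (simp add: inv_f_f[OF inj_dual_adjoint])
      then show ?thesis by (elim disjE) simp_all
    qed
  }
  assume fin: "finite_dimensional (UNIV :: 'a set)"
  show A_UNIV: "\<A> = UNIV" by (rule standard_operator_algebra_finite_dimensional[OF \<A> fin])
  have form: "\<exists>h g. ring_automorphism h \<and> (g = map_mat h \<or> g = (\<lambda>M. transpose_mat (map_mat h M))) \<and>
      (\<forall>n e. is_ordered_basis n e \<longrightarrow>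
        (\<exists>u. is_ordered_basis n u \<and> (\<forall>A. matrix_of n u (\<phi> A) = g (matrix_of n e A))))"
    using dichotomy
  proof
    assume "\<forall>A\<in>\<A>. \<forall>B\<in>\<A>. \<phi> (A o\<^sub>C B) = \<phi> A o\<^sub>C \<phi> B"
    then have "operator_ring_iso \<A> UNIV \<B> \<phi>"
      by (rule multiplicative_operator_ring_iso[OF \<A> \<B> bij nontrivial add])
    from multiplicative_matrix_form[OF this[unfolded A_UNIV]] show ?thesis by blast
  next
    assume "\<forall>A\<in>\<A>. \<forall>B\<in>\<A>. \<phi> (A o\<^sub>C B) = \<phi> B o\<^sub>C \<phi> A"
    then have "operator_ring_iso (dual_adjoint ` \<A>) (range evaluation) \<B>
        (\<lambda>A'. \<phi> (inv_into UNIV dual_adjoint A'))"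
      by (rule antimultiplicative_operator_ring_iso[OF \<A> \<B> bij nontrivial add])
    from antimultiplicative_matrix_form[OF this[unfolded A_UNIV]] show ?thesis by blast
  qed
  then obtain h g where h: "ring_automorphism h"
    and g: "g = map_mat h \<or> g = (\<lambda>M. transpose_mat (map_mat h M))"
    and basis: "\<And>n e. is_ordered_basis n e \<Longrightarrow>
      \<exists>u. is_ordered_basis n u \<and> (\<forall>A. matrix_of n u (\<phi> A) = g (matrix_of n e A))"
    by blast
  obtain e0 :: "nat \<Rightarrow> 'a" where "is_ordered_basis (complex_vector.dim (UNIV :: 'a set)) e0"
    using ordered_basis_exists[OF fin] .
  then obtain u0 :: "nat \<Rightarrow> 'b" where u0: "is_ordered_basis (complex_vector.dim (UNIV :: 'a set)) u0"
    using basis by blast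
  show fin_Y: "finite_dimensional (UNIV :: 'b set)" by (rule ordered_basis_dim(1)[OF u0])
  show "complex_vector.dim (UNIV :: 'a set) = complex_vector.dim (UNIV :: 'b set)"
    using ordered_basis_dim(2)[OF u0] by simp
  show "\<B> = UNIV" by (rule standard_operator_algebra_finite_dimensional[OF \<B> fin_Y])
  show "\<forall>n e f. n = complex_vector.dim (UNIV :: 'a set) \<longrightarrow>
         is_ordered_basis n (e :: nat \<Rightarrow> 'a) \<longrightarrow> is_ordered_basis n (f :: nat \<Rightarrow> 'b) \<longrightarrow>
         (\<exists>h T S. ring_automorphism h \<and> T \<in> carrier_mat n n \<and> S \<in> carrier_mat n n \<and>
            inverts_mat T S \<and> inverts_mat S T \<and>
            (\<forall>M \<in> carrier_mat n n. matrix_map n e f \<phi> M = T * map_mat h M * S)) \<or>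
         (\<exists>h T S. ring_automorphism h \<and> T \<in> carrier_mat n n \<and> S \<in> carrier_mat n n \<and>
            inverts_mat T S \<and> inverts_mat S T \<and>
            (\<forall>M \<in> carrier_mat n n. matrix_map n e f \<phi> M = T * transpose_mat (map_mat h M) * S))"
  proof (intro allI impI)
    fix n and e :: "nat \<Rightarrow> 'a" and f :: "nat \<Rightarrow> 'b"
    assume e: "is_ordered_basis n e" and f: "is_ordered_basis n f"
    obtain u where u: "is_ordered_basis n u" "\<And>A. matrix_of n u (\<phi> A) = g (matrix_of n e A)"
      using basis[OF e] by blast
    have "\<exists>T S. T \<in> carrier_mat n n \<and> S \<in> carrier_mat n n \<and> inverts_mat T S \<and> inverts_mat S T \<and>
        (\<forall>M \<in> carrier_mat n n. matrix_map n e f \<phi> M = T * g M * S)"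
      by (rule matrix_map_form[OF e f u(1), where g = g, OF u(2)])
    with g h show "(\<exists>h T S. ring_automorphism h \<and> T \<in> carrier_mat n n \<and> S \<in> carrier_mat n n \<and>
            inverts_mat T S \<and> inverts_mat S T \<and>
            (\<forall>M \<in> carrier_mat n n. matrix_map n e f \<phi> M = T * map_mat h M * S)) \<or>
         (\<exists>h T S. ring_automorphism h \<and> T \<in> carrier_mat n n \<and> S \<in> carrier_mat n n \<and>
            inverts_mat T S \<and> inverts_mat S T \<and>
            (\<forall>M \<in> carrier_mat n n. matrix_map n e f \<phi> M = T * transpose_mat (map_mat h M) * S))"
      by blast
  qed
qed

end
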